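(* Let $d\ge 3$. For $d$-dimensional polytopes $P,Q\subset\mathbb{R}^d$ consider the properties (1) $P=Q$; (2) $P,Q$ are pointwise affine-slice-equivalent; (3) $\mathcal H(P\times\{1\})=\mathcal H(Q\times\{1\})$; (4) $\mathrm{OM}(P)=\mathrm{OM}(Q)$; (5) $\mathrm{OM}(\mathcal H(P\times\{1\}))=\mathrm{OM}(\mathcal H(Q\times\{1\}))$; (6) $P,Q$ are setwise affine-slice-equivalent; (7) $P\simeq Q$. Then for every $d\ge 3$ and all $d$-dimensional polytopes $P,Q\subset\mathbb{R}^d$: (1) $\Leftrightarrow$ (2) $\Leftrightarrow$ (3); (1) $\Rightarrow$ (4); (4) $\Leftrightarrow$ (5); (4) $\Rightarrow$ (6); and (4) $\Rightarrow$ (7). Moreover, the following non-implications hold for every $d\ge 3$ (meaning that there are $d$-dimensional polytopes $P,Q\subset\mathbb{R}^d$ satisfying the first property but not the second): (4) $\not\Rightarrow$ (1); (6) $\not\Rightarrow$ (4); (7) $\not\Rightarrow$ (4); (7) $\not\Rightarrow$ (6). Finally, for $d=3$: (6) $\not\Rightarrow$ (7).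
   Context: $P\simeq Q$ means that $P$ and $Q$ are combinatorially equivalent, i.e. their face lattices are isomorphic. An affine slice of $P$ is an intersection $P\cap H$ with an affine hyperplane $H\subset\mathbb{R}^d$ (possibly empty). $P,Q$ are pointwise affine-slice-equivalent if $P\cap H\simeq Q\cap H$ for every affine hyperplane $H\subset\mathbb{R}^d$. They are setwise affine-slice-equivalent if the set of combinatorial types of affine slices of $P$ equals that of $Q$. $\mathcal H(P\times\{1\})=\{(v,1)^\perp \mid v \text{ a vertex of } P\}$ is a central hyperplane arrangement in $\mathbb{R}^{d+1}$; each hyperplane $(v,1)^\perp$ is oriented so that $e_{d+1}$ lies on its positive side. $\mathrm{OM}(\mathcal H(P\times\{1\}))$ is the oriented matroid of this oriented arrangement, identified with its set of signed covectors $(\operatorname{sgn}\langle y,(v_i,1)\rangle)_{i}\in\{-,0,+\}^n$, $y\in\mathbb{R}^{d+1}$, where $v_1,\dots,v_n$ is an ordering of the vertices of $P$. $\mathrm{OM}(P)$ is the oriented matroid of the affine point configuration of vertices of $P$ (given by the signs of affine dependencies of the vertices). Equality of the oriented matroids of $P$ and $Q$ is understood with respect to a suitable identification (ordering) of the vertices of $P$ and of $Q$. *)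

theory Defs
  imports "HOL-Analysis.Analysis"
begin

text \<open>Face lattices contain the empty face and the polytope itself; in particular the face
  lattice of the empty polytope has exactly one element.\<close>

definition face_lattice :: "'a::real_vector set \<Rightarrow> 'a set set" where
  "face_lattice P = {F. F face_of P}"

definition comb_equiv :: "'a::real_vector set \<Rightarrow> 'b::real_vector set \<Rightarrow> bool" where
  "comb_equiv P Q \<longleftrightarrow>
     (\<exists>f. bij_betw f (face_lattice P) (face_lattice Q) \<and>
          (\<forall>F\<in>face_lattice P. \<forall>G\<in>face_lattice P. F \<subseteq> G \<longleftrightarrow> f F \<subseteq> f G))"

definition affine_hyperplane :: "'a::euclidean_space set \<Rightarrow> bool" where
  "affine_hyperplane H \<longleftrightarrow> (\<exists>a b. a \<noteq> 0 \<and> H = {x. a \<bullet> x = b})"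

definition pointwise_slice_equiv :: "'a::euclidean_space set \<Rightarrow> 'a set \<Rightarrow> bool" where
  "pointwise_slice_equiv P Q \<longleftrightarrow>
     (\<forall>H. affine_hyperplane H \<longrightarrow> comb_equiv (P \<inter> H) (Q \<inter> H))"

text \<open>The combinatorial type of a polytope is its equivalence class among the polytopes (of any
  dimension) in the ambient space.\<close>

definition comb_type :: "'a::euclidean_space set \<Rightarrow> 'a set set" where
  "comb_type P = {R. polytope R \<and> comb_equiv P R}"

definition slice_types :: "'a::euclidean_space set \<Rightarrow> 'a set set set" where
  "slice_types P = {comb_type (P \<inter> H) | H. affine_hyperplane H}"

definition setwise_slice_equiv :: "'a::euclidean_space set \<Rightarrow> 'a set \<Rightarrow> bool" where
  "setwise_slice_equiv P Q \<longleftrightarrow> slice_types P = slice_types Q"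

text \<open>The arrangement \<open>\<H>(P \<times> {1})\<close>; the space \<open>\<real>\<^sup>d\<^sup>+\<^sup>1\<close> is represented as \<open>\<real>\<^sup>d \<times> \<real>\<close>.\<close>

definition lifted_arrangement :: "'a::euclidean_space set \<Rightarrow> ('a \<times> real) set set" where
  "lifted_arrangement P = {{y. y \<bullet> (v, 1) = 0} | v. v extreme_point_of P}"

definition vertex_ordering :: "'a::real_vector set \<Rightarrow> 'a list \<Rightarrow> bool" where
  "vertex_ordering P vs \<longleftrightarrow> distinct vs \<and> set vs = {v. v extreme_point_of P}"

text \<open>Oriented matroids are represented by sets of sign vectors, a sign vector being a list with
  entries in \<open>{-1, 0, 1}\<close>: the oriented matroid of a point configuration by its vectors (signs of
  all affine dependencies), that of the oriented arrangement by its signed covectors. The vector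
  \<open>(v, 1)\<close> is the normal of \<open>(v, 1)\<^sup>\<bottom>\<close> whose positive side contains the last unit vector
  \<open>(0, 1)\<close>.\<close>

definition OM_points :: "'a::real_vector list \<Rightarrow> real list set" where
  "OM_points vs =
     {map sgn c | c. length c = length vs \<and> (\<Sum>i<length vs. c ! i) = 0 \<and>
                     (\<Sum>i<length vs. (c ! i) *\<^sub>R (vs ! i)) = 0}"

definition OM_lifted_arrangement :: "'a::euclidean_space list \<Rightarrow> real list set" where
  "OM_lifted_arrangement vs = {map (\<lambda>v. sgn (y \<bullet> (v, 1))) vs | y :: 'a \<times> real. True}"

text \<open>Equality of the oriented matroids of two polytopes, up to identification of their
  vertices.\<close>

definition same_OM :: "'a::real_vector set \<Rightarrow> 'a set \<Rightarrow> bool" where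
  "same_OM P Q \<longleftrightarrow>
     (\<exists>vs ws. vertex_ordering P vs \<and> vertex_ordering Q ws \<and> OM_points vs = OM_points ws)"

definition same_arrangement_OM :: "'a::euclidean_space set \<Rightarrow> 'a set \<Rightarrow> bool" where
  "same_arrangement_OM P Q \<longleftrightarrow>
     (\<exists>vs ws. vertex_ordering P vs \<and> vertex_ordering Q ws \<and>
              OM_lifted_arrangement vs = OM_lifted_arrangement ws)"

definition full_dim_polytope :: "'a::euclidean_space set \<Rightarrow> bool" where
  "full_dim_polytope P \<longleftrightarrow> polytope P \<and> aff_dim P = int DIM('a)"

end

theory Submission
  imports Defs
begin

text \<open>The faces of a slice of \<open>P\<close> by a hyperplane \<open>h = 0\<close> correspond to the faces of \<open>P\<close> whose vertices
  all lie on the hyperplane or lie strictly on both of its sides. Hence the type of a slice depends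
  only on the vertex sets of the faces of \<open>P\<close> and on the signs of \<open>h\<close> at the vertices, that is, on the
  covectors, and those are dual to the affine dependencies by separation of convex sets.

  For the non-implications that hold in every dimension, consider the cross-polytopes in which one
  diagonal has been translated by a small vector \<open>z\<close> in the span of the others. Their face lattices do
  not depend on \<open>z\<close>. All nonzero \<open>z\<close> give the same slice types, since the symmetries of the lattice
  allow one to move the relevant signs to a coordinate where \<open>z\<close> does not vanish; but the four-element
  dependencies detect whether \<open>z\<close> has one or two nonzero coordinates. If \<open>z \<noteq> 0\<close>, then some slice meets
  all facets transversally, whereas a slice of the regular cross-polytope has fewer facets.

  In dimension three, the slices of a triangular prism and of a square pyramid are exactly the
  polygons with at most five vertices, including the degenerate ones.\<close>

section \<open>Isomorphisms of set systems\<close>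

text \<open>Faces are handled as index sets of vertices, because two polytopes can share index sets
  but not points. The skew cross-polytopes are suspensions: the apexes \<open>z + e_k\<close> and
  \<open>z - e_k\<close> over the regular cross-polytope in the other coordinates. The lattice
  survives while \<open>z\<close> stays inside the open l1 unit ball of these coordinates; the
  constant 1/4 ensures this for one and for two nonzero entries. For the signs of a functional the
  shift matters only through the value at \<open>z\<close>. If some other diagonal has ends of
  opposite sign, its coefficient may grow freely without changing signs; moved to a coordinate where
  the new shift is positive, it gives the value at the shift any desired sign. This is why nonzero
  shifts are interchangeable. For four-element dependencies the point is different: two diagonals
  that meet give one, and the shifted diagonal meets another only if \<open>z\<close> lies on a
  coordinate axis. Prism and pyramid both have five facets, which bounds the vertices of their
  slices by five. Up to five, the number of vertices determines the type of a polygon, since a graph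
  with all degrees two is then a single cycle. The solids differ because only the prism has disjoint
  facets.\<close>

definition order_iso :: "'a set set \<Rightarrow> 'b set set \<Rightarrow> bool" where
  "order_iso \<A> \<B> \<longleftrightarrow>
     (\<exists>f. bij_betw f \<A> \<B> \<and> (\<forall>A\<in>\<A>. \<forall>B\<in>\<A>. A \<subseteq> B \<longleftrightarrow> f A \<subseteq> f B))"

lemma order_isoI:
  assumes "bij_betw f \<A> \<B>" "\<And>A B. A \<in> \<A> \<Longrightarrow> B \<in> \<A> \<Longrightarrow> A \<subseteq> B \<longleftrightarrow> f A \<subseteq> f B"
  shows "order_iso \<A> \<B>"
  unfolding order_iso_def using assms by blast

text \<open>An order-reflecting map is injective by antisymmetry, so only its image remains to be
  supplied.\<close>

lemma order_isoI_embedding: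
  assumes "f ` \<A> = \<B>" "\<And>A B. A \<in> \<A> \<Longrightarrow> B \<in> \<A> \<Longrightarrow> A \<subseteq> B \<longleftrightarrow> f A \<subseteq> f B"
  shows "order_iso \<A> \<B>"
proof (rule order_isoI[of f])
  have "inj_on f \<A>"
    by (rule inj_onI) (metis assms(2) order_refl subset_antisym)
  then show "bij_betw f \<A> \<B>"
    using assms(1) by (simp add: bij_betw_def)
qed (rule assms(2))

lemma comb_equiv_iff: "comb_equiv P Q \<longleftrightarrow> order_iso (face_lattice P) (face_lattice Q)"
  by (simp add: comb_equiv_def order_iso_def)

lemma order_iso_refl: "order_iso \<A> \<A>"
  by (rule order_isoI[of id]) auto

lemma order_iso_sym:
  assumes "order_iso \<A> \<B>"
  shows "order_iso \<B> \<A>"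
proof -
  obtain f where f: "bij_betw f \<A> \<B>" "\<forall>A\<in>\<A>. \<forall>B\<in>\<A>. A \<subseteq> B \<longleftrightarrow> f A \<subseteq> f B"
    using assms unfolding order_iso_def by blast
  let ?g = "inv_into \<A> f"
  have g: "?g B \<in> \<A>" "f (?g B) = B" if "B \<in> \<B>" for B
    using f(1) that by (auto simp: bij_betw_def intro: inv_into_into f_inv_into_f)
  show ?thesis
  proof (rule order_isoI[of ?g])
    show "bij_betw ?g \<B> \<A>"
      by (rule bij_betw_inv_into[OF f(1)])
    show "A \<subseteq> B \<longleftrightarrow> ?g A \<subseteq> ?g B" if "A \<in> \<B>" "B \<in> \<B>" for A B
      using f(2) g[OF that(1)] g[OF that(2)] by metis
  qed
qed

lemma order_iso_trans:
  assumes "order_iso \<A> \<B>" "order_iso \<B> \<C>"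
  shows "order_iso \<A> \<C>"
proof -
  obtain f where f: "bij_betw f \<A> \<B>" "\<forall>A\<in>\<A>. \<forall>B\<in>\<A>. A \<subseteq> B \<longleftrightarrow> f A \<subseteq> f B"
    using assms(1) unfolding order_iso_def by blast
  obtain g where g: "bij_betw g \<B> \<C>" "\<forall>A\<in>\<B>. \<forall>B\<in>\<B>. A \<subseteq> B \<longleftrightarrow> g A \<subseteq> g B"
    using assms(2) unfolding order_iso_def by blast
  have "f A \<in> \<B>" if "A \<in> \<A>" for A
    using f(1) that by (auto simp: bij_betw_def)
  then show ?thesis
    using f g by (intro order_isoI[of "g \<circ> f"]) (auto intro: bij_betw_trans)
qed

lemma comb_equiv_refl: "comb_equiv P P"
  by (simp add: comb_equiv_iff order_iso_refl)

lemma comb_equiv_sym: "comb_equiv P Q \<Longrightarrow> comb_equiv Q P"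
  unfolding comb_equiv_iff by (rule order_iso_sym)

lemma comb_equiv_trans: "comb_equiv P Q \<Longrightarrow> comb_equiv Q R \<Longrightarrow> comb_equiv P R"
  unfolding comb_equiv_iff by (rule order_iso_trans)

lemma comb_type_cong: "comb_equiv P Q \<Longrightarrow> comb_type P = comb_type Q"
  unfolding comb_type_def by (metis (no_types) comb_equiv_sym comb_equiv_trans)

text \<open>\<open>comb_type\<close> collects polytopes only, so \<open>P\<close> has to be one in
  order to belong to its own class.\<close>

lemma comb_type_eqD:
  assumes "comb_type P = comb_type Q" "polytope P"
  shows "comb_equiv P Q"
proof -
  have "P \<in> comb_type P"
    using assms(2) comb_equiv_refl by (simp add: comb_type_def)
  then show ?thesis
    using assms(1) comb_equiv_sym unfolding comb_type_def by blast
qed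

section \<open>Faces of a hyperplane slice, in terms of vertex signs\<close>

text \<open>These are the index sets of exposed faces. The functional \<open>a = 0\<close> is
  allowed: with \<open>b = 0\<close> it gives the whole of \<open>I\<close>, with
  \<open>b = 1\<close> the empty face.\<close>

definition idx_faces :: "'i set \<Rightarrow> ('i \<Rightarrow> 'a::real_inner) \<Rightarrow> 'i set set" where
  "idx_faces I v = {A. \<exists>a b. (\<forall>i\<in>I. a \<bullet> v i \<le> b) \<and> A = {i\<in>I. a \<bullet> v i = b}}"

text \<open>The empty set satisfies the first alternative vacuously, so the empty face of a slice is
  represented as well.\<close>

definition crossing :: "('i \<Rightarrow> real) \<Rightarrow> 'i set \<Rightarrow> bool" where
  "crossing h A \<longleftrightarrow> (\<forall>i\<in>A. h i = 0) \<or> (\<exists>i\<in>A. \<exists>j\<in>A. h i < 0 \<and> 0 < h j)"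

text \<open>A face meets the hyperplane \<open>h = 0\<close> in a relatively interior point exactly if its vertex
  set is crossing; these faces correspond to the faces of the slice.\<close>

definition slice_idx :: "'i set \<Rightarrow> ('i \<Rightarrow> 'a::real_inner) \<Rightarrow> ('i \<Rightarrow> real) \<Rightarrow> 'i set set" where
  "slice_idx I v h = {A \<in> idx_faces I v. crossing h A}"

lemma idx_faces_subset: "A \<in> idx_faces I v \<Longrightarrow> A \<subseteq> I"
  by (auto simp: idx_faces_def)

lemma idx_faces_top: "I \<in> idx_faces I v"
  unfolding idx_faces_def by (rule CollectI, rule exI[of _ 0], rule exI[of _ 0]) auto

lemma idx_faces_empty: "{} \<in> idx_faces I v"
  unfolding idx_faces_def by (rule CollectI, rule exI[of _ 0], rule exI[of _ 1]) auto

lemma crossing_cong_sgn: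
  assumes "\<And>i. i \<in> A \<Longrightarrow> sgn (h i) = sgn (h' (\<phi> i))"
  shows "crossing h A \<longleftrightarrow> crossing h' (\<phi> ` A)"
proof -
  have "h i = 0 \<longleftrightarrow> h' (\<phi> i) = 0" "h i < 0 \<longleftrightarrow> h' (\<phi> i) < 0" "0 < h i \<longleftrightarrow> 0 < h' (\<phi> i)"
    if "i \<in> A" for i
    using assms[OF that] by (auto simp: sgn_if split: if_splits)
  then show ?thesis
    unfolding crossing_def by (simp cong: bex_cong ball_cong)
qed

lemma inner_convex_hull_le:
  assumes "\<And>i. i \<in> I \<Longrightarrow> a \<bullet> v i \<le> b" "x \<in> convex hull (v ` I)"
  shows "a \<bullet> x \<le> b"
proof -
  have "convex hull (v ` I) \<subseteq> {x. a \<bullet> x \<le> b}"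
    using assms(1) by (intro hull_minimal) (auto simp: convex_halfspace_le)
  then show ?thesis using assms(2) by auto
qed

text \<open>A face of the hull of a finite set is the hull of some of the generators, and those that
  lie in this face are the ones attaining \<open>b\<close>.\<close>

lemma exposed_part_convex_hull:
  fixes v :: "'i \<Rightarrow> 'a::euclidean_space"
  assumes I: "finite I" and le: "\<And>i. i \<in> I \<Longrightarrow> a \<bullet> v i \<le> b"
  shows "convex hull (v ` I) \<inter> {x. a \<bullet> x = b} = convex hull (v ` {i\<in>I. a \<bullet> v i = b})"
    (is "?F = _")
proof
  have F: "?F face_of convex hull (v ` I)"
    using inner_convex_hull_le[OF le]
    by (intro face_of_Int_supporting_hyperplane_le) auto
  then obtain S where S: "S \<subseteq> v ` I" "?F = convex hull S"
    using face_of_convex_hull_subset[of "v ` I" ?F] I finite_imp_compact by blast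
  have "S \<subseteq> ?F"
    using S(2) hull_subset by metis
  then have "S \<subseteq> v ` {i\<in>I. a \<bullet> v i = b}"
    using S(1) by fastforce
  then show "?F \<subseteq> convex hull (v ` {i\<in>I. a \<bullet> v i = b})"
    using S(2) by (metis hull_mono)
next
  have "convex hull (v ` {i\<in>I. a \<bullet> v i = b}) \<subseteq> convex hull (v ` I)"
    by (intro hull_mono) auto
  moreover have "convex hull (v ` {i\<in>I. a \<bullet> v i = b}) \<subseteq> {x. a \<bullet> x = b}"
    by (intro hull_minimal) (auto simp: convex_hyperplane)
  ultimately show "convex hull (v ` {i\<in>I. a \<bullet> v i = b}) \<subseteq> ?F"
    by blast
qed

lemma idx_face_is_face:
  fixes v :: "'i \<Rightarrow> 'a::euclidean_space"
  assumes "finite I" "A \<in> idx_faces I v"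
  shows "convex hull (v ` A) face_of convex hull (v ` I)"
proof -
  obtain a b where ab: "\<forall>i\<in>I. a \<bullet> v i \<le> b" "A = {i\<in>I. a \<bullet> v i = b}"
    using assms(2) unfolding idx_faces_def by blast
  then have le: "\<And>i. i \<in> I \<Longrightarrow> a \<bullet> v i \<le> b" by blast
  have "convex hull (v ` I) \<inter> {x. a \<bullet> x = b} face_of convex hull (v ` I)"
    using inner_convex_hull_le[OF le]
    by (intro face_of_Int_supporting_hyperplane_le) auto
  then show ?thesis
    using exposed_part_convex_hull[OF assms(1) le] ab(2) by simp
qed

text \<open>All faces of a polyhedron are exposed, so one supporting functional describes the face
  and selects its index set.\<close>

lemma face_is_idx_face:
  fixes v :: "'i \<Rightarrow> 'a::euclidean_space"
  assumes I: "finite I" and F: "F face_of convex hull (v ` I)"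
  obtains A where "A \<in> idx_faces I v" "F = convex hull (v ` A)"
proof -
  have "polyhedron (convex hull (v ` I))"
    using I by (intro polytope_imp_polyhedron) (auto simp: polytope_def)
  then have "F exposed_face_of convex hull (v ` I)"
    using F exposed_face_of_polyhedron by blast
  then obtain a b where ab: "convex hull (v ` I) \<subseteq> {x. a \<bullet> x \<le> b}"
      "F = convex hull (v ` I) \<inter> {x. a \<bullet> x = b}"
    unfolding exposed_face_of_def by blast
  have le: "\<And>i. i \<in> I \<Longrightarrow> a \<bullet> v i \<le> b"
    using ab(1) hull_subset[of "v ` I" convex] by blast
  have "{i\<in>I. a \<bullet> v i = b} \<in> idx_faces I v"
    unfolding idx_faces_def using le by blast
  then show ?thesis
    by (rule that) (use ab(2) exposed_part_convex_hull[OF I le] in simp)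
qed

text \<open>Take a minimal face containing \<open>x\<close>. If \<open>x\<close> were on its
  relative boundary, it would lie in a facet of that face, a smaller face of
  \<open>S\<close>.\<close>

lemma polytope_rel_interior_face:
  fixes S :: "'a::euclidean_space set"
  assumes "polytope S" "x \<in> S"
  obtains F where "F face_of S" "x \<in> rel_interior F"
proof -
  let ?\<F> = "{F. F face_of S \<and> x \<in> F}"
  have fin: "finite ?\<F>"
    using finite_polytope_faces[OF assms(1)] by (rule rev_finite_subset) auto
  have "S \<in> ?\<F>"
    using assms by (auto simp: face_of_refl polytope_imp_convex)
  then have "?\<F> \<noteq> {}" by blast
  from finite_has_minimal[OF fin this]
  obtain F where F: "F \<in> ?\<F>" "\<forall>G\<in>?\<F>. G \<subseteq> F \<longrightarrow> F = G" by blast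
  have poly: "polyhedron F"
    using F(1) assms(1) face_of_polytope_polytope polytope_imp_polyhedron by blast
  have "x \<in> rel_interior F"
  proof (rule ccontr)
    assume "x \<notin> rel_interior F"
    then have "x \<in> F - rel_interior F" using F(1) by blast
    then obtain G where G: "G facet_of F" "x \<in> G"
      unfolding rel_boundary_of_polyhedron[OF poly] by blast
    then have "G face_of S"
      using F(1) facet_of_imp_face_of face_of_trans by blast
    moreover have "G \<subseteq> F" using G(1) by (rule facet_of_imp_subset)
    ultimately have "G = F" using F(2) G(2) by blast
    then show False using G(1) by (simp add: facet_of_def)
  qed
  then show ?thesis using F(1) that by blast
qed

lemma crossing_positive_combination:
  assumes I: "finite A" and ne: "A \<noteq> {}" and cr: "crossing h A"
  obtains c :: "'i \<Rightarrow> real" where "\<And>i. i \<in> A \<Longrightarrow> 0 < c i" "(\<Sum>i\<in>A. c i) = 1" "(\<Sum>i\<in>A. c i * h i) = 0"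
proof -
  have "\<exists>c. (\<forall>i\<in>A. 0 < c i) \<and> (\<Sum>i\<in>A. c i * h i) = 0"
  proof (cases "\<forall>i\<in>A. h i = 0")
    case True
    then show ?thesis by (intro exI[of _ "\<lambda>_. 1"]) auto
  next
    case False
    then obtain p q where pq: "p \<in> A" "q \<in> A" "h p < 0" "0 < h q"
      using cr unfolding crossing_def by blast
    define s where "s = (\<Sum>i\<in>A. h i)"
    obtain j where j: "j \<in> A" "h j \<noteq> 0" "s / h j \<le> 0"
    proof (cases "0 \<le> s")
      case True
      then show ?thesis using pq that[of p] by (simp add: divide_le_0_iff)
    next
      case False
      then show ?thesis using pq that[of q] by (simp add: divide_le_0_iff)
    qed
    \<comment> \<open>Starting from weight 1 everywhere, the weight at \<open>j\<close> is raised by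
      \<open>- s / h j\<close>, which is nonnegative by the choice of \<open>j\<close> and cancels
      the total \<open>s\<close>.\<close>
    define c where "c i = 1 + (if i = j then - s / h j else 0)" for i
    have "(\<Sum>i\<in>A. c i * h i) = (\<Sum>i\<in>A. h i + (if i = j then - s else 0))"
      using j(2) by (intro sum.cong) (auto simp: c_def field_simps)
    also have "\<dots> = 0"
      using I j(1) by (simp add: sum.distrib s_def)
    finally have "(\<Sum>i\<in>A. c i * h i) = 0" .
    moreover have "\<forall>i\<in>A. 0 < c i"
      using j(3) by (auto simp: c_def)
    ultimately show ?thesis by blast
  qed
  then obtain c where c: "\<forall>i\<in>A. 0 < c i" "(\<Sum>i\<in>A. c i * h i) = 0" by blast
  define C where "C = (\<Sum>i\<in>A. c i)"
  have C: "0 < C" unfolding C_def using I ne c(1) by (intro sum_pos) auto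
  show ?thesis
  proof (rule that[of "\<lambda>i. c i / C"])
    show "(\<Sum>i\<in>A. c i / C) = 1"
      using C by (simp add: C_def flip: sum_divide_distrib)
    show "(\<Sum>i\<in>A. c i / C * h i) = 0"
      using c(2) by (simp add: flip: sum_divide_distrib)
  qed (use c C in auto)
qed

text \<open>Crossing provides a strictly positive combination of all vertices of \<open>A\<close> on
  the hyperplane. This point lies in the face of \<open>B\<close>, so the functional supporting that
  face is maximal there, which forces it to be maximal at every vertex of \<open>A\<close>.\<close>

lemma slice_idx_mono_iff:
  fixes v :: "'i \<Rightarrow> 'a::euclidean_space"
  assumes I: "finite I"
    and A: "A \<in> slice_idx I v (\<lambda>i. a \<bullet> v i - b)" and B: "B \<in> idx_faces I v"
    and sub: "convex hull (v ` A) \<inter> {x. a \<bullet> x = b} \<subseteq> convex hull (v ` B)"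
  shows "A \<subseteq> B"
proof (cases "A = {}")
  case False
  have AI: "A \<subseteq> I" using A idx_faces_subset unfolding slice_idx_def by blast
  then have fA: "finite A" using I finite_subset by blast
  have "crossing (\<lambda>i. a \<bullet> v i - b) A" using A by (simp add: slice_idx_def)
  then obtain c where c: "\<And>i. i \<in> A \<Longrightarrow> 0 < c i" "(\<Sum>i\<in>A. c i) = 1"
      "(\<Sum>i\<in>A. c i * (a \<bullet> v i - b)) = 0"
    using crossing_positive_combination[OF fA False] by blast
  define x where "x = (\<Sum>i\<in>A. c i *\<^sub>R v i)"
  have "x \<in> convex hull (v ` A)"
    unfolding x_def using c fA
    by (intro convex_sum) (auto simp: less_imp_le hull_inc)
  moreover have "a \<bullet> x = b"
    using c(2,3) by (simp add: x_def inner_sum_right algebra_simps sum_subtractf flip: sum_distrib_left)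
  ultimately have xB: "x \<in> convex hull (v ` B)" using sub by blast
  obtain a' b' where ab: "\<forall>i\<in>I. a' \<bullet> v i \<le> b'" "B = {i\<in>I. a' \<bullet> v i = b'}"
    using B unfolding idx_faces_def by blast
  have "a' \<bullet> x = b'"
    using xB exposed_part_convex_hull[OF I, of a' v b'] ab by auto
  then have "(\<Sum>i\<in>A. c i * (b' - a' \<bullet> v i)) = 0"
    using c(2) by (simp add: x_def inner_sum_right algebra_simps sum_subtractf flip: sum_distrib_left)
  moreover have "\<forall>i\<in>A. 0 \<le> c i * (b' - a' \<bullet> v i)"
    using ab(1) AI c(1) by (auto simp: less_imp_le)
  ultimately have "\<forall>i\<in>A. c i * (b' - a' \<bullet> v i) = 0"
    using fA by (simp add: sum_nonneg_eq_0_iff)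
  then have "\<forall>i\<in>A. a' \<bullet> v i = b'"
    using c(1) by fastforce
  then show ?thesis using ab(2) AI by auto
qed auto

text \<open>Choose a relatively interior point of \<open>G\<close> and the face \<open>F\<close> of
  the polytope having it in its relative interior. Then \<open>F\<close> meets the hyperplane in a
  face of the slice with the same relatively interior point, and such faces coincide.\<close>

lemma face_of_slice_crossing:
  fixes v :: "'i \<Rightarrow> 'a::euclidean_space"
  assumes I: "finite I" and G: "G face_of convex hull (v ` I) \<inter> {x. a \<bullet> x = b}"
  obtains A where "A \<in> slice_idx I v (\<lambda>i. a \<bullet> v i - b)"
    "G = convex hull (v ` A) \<inter> {x. a \<bullet> x = b}"
proof (cases "G = {}")
  case True
  then show ?thesis
    using that[of "{}"] idx_faces_empty by (auto simp: slice_idx_def crossing_def)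
next
  case False
  let ?P = "convex hull (v ` I)" and ?H = "{x. a \<bullet> x = b}"
  have "convex G" using G face_of_imp_convex by blast
  then obtain x where x: "x \<in> rel_interior G" using False rel_interior_eq_empty by blast
  have xG: "x \<in> G" using x rel_interior_subset by blast
  then have xPH: "x \<in> ?P" "a \<bullet> x = b" using G face_of_imp_subset by auto
  obtain F where F: "F face_of ?P" "x \<in> rel_interior F"
    using polytope_rel_interior_face[of ?P x] xPH(1) I by (metis finite_imageI polytope_def)
  obtain A where A: "A \<in> idx_faces I v" "F = convex hull (v ` A)"
    using face_is_idx_face[OF I F(1)] by blast
  have face: "F \<inter> ?H face_of ?P \<inter> ?H"
    using F(1) by (intro face_of_slice) (auto simp: convex_hyperplane)
  have "rel_interior (F \<inter> ?H) = rel_interior F \<inter> ?H"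
    using F xPH(2) face_of_imp_convex
    by (intro convex_affine_rel_interior_Int) (auto simp: affine_hyperplane)
  then have "x \<in> rel_interior (F \<inter> ?H)" using F(2) xPH(2) by auto
  then have eq: "G = F \<inter> ?H" using face_of_eq[OF G face] x by blast
  \<comment> \<open>If \<open>F\<close> lies on one side, the hyperplane supports it and cuts out a
    face that meets the relative interior of \<open>F\<close>; such a face is \<open>F\<close>
    itself.\<close>
  have "(\<forall>i\<in>A. a \<bullet> v i = b)" if one_sided: "(\<forall>i\<in>A. a \<bullet> v i \<le> b) \<or> (\<forall>i\<in>A. b \<le> a \<bullet> v i)"
  proof -
    have "F \<inter> ?H face_of F"
      using one_sided
    proof
      assume *: "\<forall>i\<in>A. a \<bullet> v i \<le> b"
      show ?thesis
        using inner_convex_hull_le[of A a v b] * unfolding A(2)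
        by (intro face_of_Int_supporting_hyperplane_le) auto
    next
      assume *: "\<forall>i\<in>A. b \<le> a \<bullet> v i"
      show ?thesis
        using inner_convex_hull_le[of A "-a" v "-b"] * unfolding A(2)
        by (intro face_of_Int_supporting_hyperplane_ge) auto
    qed
    then have "F \<inter> ?H = F"
      using face_of_disjoint_rel_interior[of "F \<inter> ?H" F] F(2) xPH(2) rel_interior_subset[of F] by auto
    moreover have "v i \<in> F" if "i \<in> A" for i
      unfolding A(2) using that by (simp add: hull_inc)
    ultimately show ?thesis by blast
  qed
  then have "crossing (\<lambda>i. a \<bullet> v i - b) A"
  proof (cases "(\<forall>i\<in>A. a \<bullet> v i \<le> b) \<or> (\<forall>i\<in>A. b \<le> a \<bullet> v i)")
    case False
    then obtain i j where "i \<in> A" "j \<in> A" "b < a \<bullet> v i" "a \<bullet> v j < b" by (meson not_le)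
    then show ?thesis unfolding crossing_def by (metis diff_gt_0_iff_gt diff_less_0_iff_less)
  qed (simp add: crossing_def)
  then show ?thesis using that A eq by (auto simp: slice_idx_def)
qed

lemma face_lattice_slice:
  fixes v :: "'i \<Rightarrow> 'a::euclidean_space"
  assumes I: "finite I"
  shows "order_iso (slice_idx I v (\<lambda>i. a \<bullet> v i - b))
    (face_lattice (convex hull (v ` I) \<inter> {x. a \<bullet> x = b}))"
proof (rule order_isoI_embedding)
  let ?f = "\<lambda>A. convex hull (v ` A) \<inter> {x. a \<bullet> x = b}"
  let ?S = "slice_idx I v (\<lambda>i. a \<bullet> v i - b)"
  show "?f ` ?S = face_lattice (convex hull (v ` I) \<inter> {x. a \<bullet> x = b})"
  proof
    show "?f ` ?S \<subseteq> face_lattice (convex hull (v ` I) \<inter> {x. a \<bullet> x = b})"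
      using idx_face_is_face[OF I]
      by (auto simp: slice_idx_def face_lattice_def convex_hyperplane intro!: face_of_slice)
    show "face_lattice (convex hull (v ` I) \<inter> {x. a \<bullet> x = b}) \<subseteq> ?f ` ?S"
    proof
      fix G assume "G \<in> face_lattice (convex hull (v ` I) \<inter> {x. a \<bullet> x = b})"
      then have "G face_of convex hull (v ` I) \<inter> {x. a \<bullet> x = b}" by (simp add: face_lattice_def)
      from face_of_slice_crossing[OF I this] show "G \<in> ?f ` ?S" by blast
    qed
  qed
  show "A \<subseteq> B \<longleftrightarrow> ?f A \<subseteq> ?f B" if "A \<in> ?S" "B \<in> ?S" for A B
  proof
    assume "A \<subseteq> B"
    then have "convex hull (v ` A) \<subseteq> convex hull (v ` B)" by (intro hull_mono) auto
    then show "?f A \<subseteq> ?f B" by blast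
  next
    assume "?f A \<subseteq> ?f B"
    then show "A \<subseteq> B"
      using slice_idx_mono_iff[OF I that(1)] that(2) by (auto simp: slice_idx_def)
  qed
qed

text \<open>The degenerate equation \<open>0 \<bullet> x = 0\<close> cuts out everything and makes
  every index set crossing, so this is an instance of the slice version.\<close>

lemma face_lattice_idx_faces:
  fixes v :: "'i \<Rightarrow> 'a::euclidean_space"
  assumes "finite I"
  shows "order_iso (idx_faces I v) (face_lattice (convex hull (v ` I)))"
  using face_lattice_slice[OF assms, of v 0 0] by (simp add: slice_idx_def crossing_def)

text \<open>Crossing depends on signs only. The bijection \<open>\<phi>\<close> leaves room for
  permuting vertices, which the cross-polytopes require.\<close>

lemma idx_faces_transfer_iso:
  assumes \<phi>: "bij_betw \<phi> I J"
    and faces: "\<And>A. A \<subseteq> I \<Longrightarrow> A \<in> idx_faces I v \<longleftrightarrow> \<phi> ` A \<in> idx_faces J w"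
    and sgn: "\<And>i. i \<in> I \<Longrightarrow> sgn (h i) = sgn (h' (\<phi> i))"
  shows "order_iso (slice_idx I v h) (slice_idx J w h')"
proof (rule order_isoI_embedding)
  have mem: "A \<in> slice_idx I v h \<longleftrightarrow> \<phi> ` A \<in> slice_idx J w h'" if "A \<subseteq> I" for A
  proof -
    have "crossing h A \<longleftrightarrow> crossing h' (\<phi> ` A)"
      using that sgn by (intro crossing_cong_sgn) auto
    then show ?thesis using faces[OF that] by (simp add: slice_idx_def)
  qed
  have sub: "A \<subseteq> I" if "A \<in> slice_idx I v h" for A
    using that idx_faces_subset unfolding slice_idx_def by blast
  have subJ: "B \<subseteq> J" if "B \<in> slice_idx J w h'" for B
    using that idx_faces_subset unfolding slice_idx_def by blast
  show "(`) \<phi> ` slice_idx I v h = slice_idx J w h'"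
  proof
    show "(`) \<phi> ` slice_idx I v h \<subseteq> slice_idx J w h'"
      using mem sub by blast
    show "slice_idx J w h' \<subseteq> (`) \<phi> ` slice_idx I v h"
    proof
      fix B assume B: "B \<in> slice_idx J w h'"
      then have "B \<subseteq> \<phi> ` I" using subJ \<phi> by (simp add: bij_betw_def)
      then obtain A where "A \<subseteq> I" "B = \<phi> ` A" by (meson subset_imageE)
      then show "B \<in> (`) \<phi> ` slice_idx I v h" using B mem by blast
    qed
  qed
  show "A \<subseteq> B \<longleftrightarrow> \<phi> ` A \<subseteq> \<phi> ` B" if "A \<in> slice_idx I v h" "B \<in> slice_idx I v h" for A B
    using \<phi> sub[OF that(1)] sub[OF that(2)] unfolding bij_betw_def
    by (metis inj_on_image_subset_iff)
qed

section \<open>Transfer of slice types between polytopes\<close>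

lemma hyperplane_not_superset:
  fixes P :: "'a::euclidean_space set"
  assumes "full_dim_polytope P" "a \<noteq> 0"
  shows "\<exists>x\<in>P. a \<bullet> x \<noteq> b"
proof -
  have "\<not> P \<subseteq> {x. a \<bullet> x = b}"
  proof
    assume "P \<subseteq> {x. a \<bullet> x = b}"
    then have "aff_dim P \<le> aff_dim {x. a \<bullet> x = b}" by (rule aff_dim_subset)
    then show False using assms by (simp add: full_dim_polytope_def)
  qed
  then show ?thesis by blast
qed

lemma bounded_missed_by_hyperplane:
  fixes Q :: "'a::euclidean_space set"
  assumes "bounded Q"
  obtains H where "affine_hyperplane H" "Q \<inter> H = {}"
proof -
  obtain B where B: "\<And>x. x \<in> Q \<Longrightarrow> norm x \<le> B" using assms bounded_iff by metis
  obtain e :: 'a where e: "e \<in> Basis" using nonempty_Basis by blast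
  have "e \<bullet> x \<noteq> B + 1" if "x \<in> Q" for x
    using B[OF that] Basis_le_norm[OF e, of x] by (auto simp: inner_commute)
  then have "Q \<inter> {x. e \<bullet> x = B + 1} = {}" by blast
  moreover have "affine_hyperplane {x. e \<bullet> x = B + 1}"
    using e nonzero_Basis unfolding affine_hyperplane_def by blast
  ultimately show ?thesis using that by blast
qed

lemma slice_types_transfer:
  fixes v :: "'i \<Rightarrow> 'a::euclidean_space" and w :: "'j \<Rightarrow> 'a"
  assumes I: "finite I" and J: "finite J"
    and P: "full_dim_polytope (convex hull (v ` I))"
    and \<phi>: "bij_betw \<phi> I J"
    and faces: "\<And>A. A \<subseteq> I \<Longrightarrow> A \<in> idx_faces I v \<longleftrightarrow> \<phi> ` A \<in> idx_faces J w"
    and a: "a \<noteq> 0"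
    and sgn: "\<And>i. i \<in> I \<Longrightarrow> sgn (a \<bullet> v i - b) = sgn (a' \<bullet> w (\<phi> i) - b')"
  shows "comb_type (convex hull (v ` I) \<inter> {x. a \<bullet> x = b}) \<in> slice_types (convex hull (w ` J))"
proof -
  have iso: "order_iso (slice_idx I v (\<lambda>i. a \<bullet> v i - b)) (slice_idx J w (\<lambda>i. a' \<bullet> w i - b'))"
    using \<phi> faces sgn by (rule idx_faces_transfer_iso)
  have "comb_equiv (convex hull (v ` I) \<inter> {x. a \<bullet> x = b}) (convex hull (w ` J) \<inter> {x. a' \<bullet> x = b'})"
    unfolding comb_equiv_iff
    using order_iso_trans[OF order_iso_sym[OF face_lattice_slice[OF I]]
        order_iso_trans[OF iso face_lattice_slice[OF J]]] .
  then have eq: "comb_type (convex hull (v ` I) \<inter> {x. a \<bullet> x = b}) =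
      comb_type (convex hull (w ` J) \<inter> {x. a' \<bullet> x = b'})"
    by (rule comb_type_cong)
  obtain H where H: "affine_hyperplane H"
      "convex hull (w ` J) \<inter> H = convex hull (w ` J) \<inter> {x. a' \<bullet> x = b'}"
  proof (cases "a' = 0")
    case False
    then show ?thesis using that unfolding affine_hyperplane_def by blast
  next
    \<comment> \<open>With \<open>a' = 0\<close> the signs are constant. They cannot all be zero,
      since the first polytope is full-dimensional; hence both slices are empty, and a genuine
      hyperplane far away from the second polytope does the same.\<close>
    case True
    have "b' \<noteq> 0"
    proof
      assume "b' = 0"
      then have "a \<bullet> v i = b" if "i \<in> I" for i
        using sgn[OF that] True by (simp add: sgn_if split: if_splits)
      then have "convex hull (v ` I) \<subseteq> {x. a \<bullet> x = b}"
        by (intro hull_minimal) (auto simp: convex_hyperplane)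
      then show False using hyperplane_not_superset[OF P a, of b] by auto
    qed
    then have "convex hull (w ` J) \<inter> {x. a' \<bullet> x = b'} = {}" using True by auto
    moreover have "bounded (convex hull (w ` J))"
      using J by (simp add: bounded_convex_hull finite_imp_bounded)
    then obtain H where "affine_hyperplane H" "convex hull (w ` J) \<inter> H = {}"
      by (rule bounded_missed_by_hyperplane)
    ultimately show ?thesis using that by simp
  qed
  show ?thesis
    unfolding slice_types_def by (rule CollectI, rule exI[of _ H]) (simp add: eq H)
qed

section \<open>Duality between vectors and covectors\<close>

text \<open>One half of the orthogonality of sign vectors: the products are not all nonnegative with
  one of them positive. The other half is this condition for the negative of \<open>X\<close>, and
  the sets of vectors considered are closed under negation.\<close>

definition sign_orth :: "real list \<Rightarrow> real list \<Rightarrow> bool" where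
  "sign_orth X Y \<longleftrightarrow> (\<forall>i<length X. 0 \<le> X ! i * Y ! i) \<longrightarrow> (\<forall>i<length X. X ! i * Y ! i = 0)"

lemma sgn_in_signs: "sgn (x::real) \<in> {-1, 0, 1}"
  by (simp add: sgn_if)

lemma sgn_of_sign: "s \<in> {-1, 0, 1} \<Longrightarrow> sgn s = (s::real)"
  by auto

text \<open>Homogenization: affine dependencies of the points are linear dependencies of the lifted
  points, the normals of the arrangement.\<close>

lemma OM_points_alt:
  "OM_points vs = {map sgn c | c. length c = length vs \<and>
     (\<Sum>i<length vs. c ! i *\<^sub>R (vs ! i, 1::real)) = 0}"
proof -
  have "(\<Sum>i<length vs. c ! i *\<^sub>R (vs ! i, 1::real)) =
      (\<Sum>i<length vs. c ! i *\<^sub>R vs ! i, \<Sum>i<length vs. c ! i)" for c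
    by (simp add: prod_eq_iff fst_sum snd_sum)
  then show ?thesis unfolding OM_points_def by (auto simp: zero_prod_def)
qed

lemma OM_points_signs:
  "X \<in> OM_points vs \<Longrightarrow> length X = length vs \<and> (\<forall>i<length vs. X ! i \<in> {-1, 0, 1})"
  using sgn_in_signs by (fastforce simp: OM_points_def simp del: insert_iff)

lemma OM_lifted_signs:
  "Y \<in> OM_lifted_arrangement vs \<Longrightarrow> length Y = length vs \<and> (\<forall>i<length vs. Y ! i \<in> {-1, 0, 1})"
  using sgn_in_signs by (fastforce simp: OM_lifted_arrangement_def simp del: insert_iff inner_Pair)

text \<open>Pairing a dependency with \<open>y\<close> gives a sum of value zero; if its terms are
  all nonnegative, then each of them vanishes.\<close>

lemma vector_orth_covector:
  fixes vs :: "'a::euclidean_space list"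
  assumes "X \<in> OM_points vs" "Y \<in> OM_lifted_arrangement vs"
  shows "sign_orth X Y"
proof -
  let ?n = "length vs"
  obtain c where c: "X = map sgn c" "length c = ?n" "(\<Sum>i<?n. c ! i *\<^sub>R (vs ! i, 1::real)) = 0"
    using assms(1) unfolding OM_points_alt by blast
  obtain y :: "'a \<times> real" where y: "Y = map (\<lambda>v. sgn (y \<bullet> (v, 1))) vs"
    using assms(2) unfolding OM_lifted_arrangement_def by blast
  have prod: "X ! i * Y ! i = sgn (c ! i * (y \<bullet> (vs ! i, 1)))" if "i < ?n" for i
    using that c by (simp add: y sgn_mult)
  have "(\<Sum>i<?n. c ! i * (y \<bullet> (vs ! i, 1))) = y \<bullet> (\<Sum>i<?n. c ! i *\<^sub>R (vs ! i, 1))"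
    by (simp add: inner_sum_right del: scaleR_Pair)
  then have 0: "(\<Sum>i<?n. c ! i * (y \<bullet> (vs ! i, 1))) = 0" using c(3) by simp
  show ?thesis unfolding sign_orth_def
  proof
    assume "\<forall>i<length X. 0 \<le> X ! i * Y ! i"
    then have "\<forall>i\<in>{..<?n}. 0 \<le> c ! i * (y \<bullet> (vs ! i, 1))"
      using prod c(1,2) by (auto simp: sgn_if split: if_splits)
    then have "\<forall>i\<in>{..<?n}. c ! i * (y \<bullet> (vs ! i, 1)) = 0"
      using 0 sum_nonneg_eq_0_iff[of "{..<?n}" "\<lambda>i. c ! i * (y \<bullet> (vs ! i, 1))"] by blast
    then show "\<forall>i<length X. X ! i * Y ! i = 0"
      using prod c(1,2) by (metis lessThan_iff length_map sgn_zero_iff)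
  qed
qed

text \<open>If 0 is outside \<open>K\<close>, separate strictly; if it is on the relative boundary,
  a supporting hyperplane is strict on the relative interior. Properness of the separation is what
  contradicts orthogonality later.\<close>

lemma zero_in_rel_interior_or_separated:
  fixes K :: "'a::euclidean_space set"
  assumes "convex K" "closed K" "K \<noteq> {}"
  shows "0 \<in> rel_interior K \<or> (\<exists>y. (\<forall>x\<in>K. 0 \<le> y \<bullet> x) \<and> (\<exists>x\<in>K. 0 < y \<bullet> x))"
proof (cases "0 \<in> K")
  case False
  then obtain a b where ab: "0 < b" "\<forall>x\<in>K. a \<bullet> x > b"
    using separating_hyperplane_closed_0[OF assms(1,2)] by auto
  then have "\<forall>x\<in>K. 0 < a \<bullet> x" by fastforce
  then show ?thesis using assms(3) by (intro disjI2 exI[of _ a]) (auto simp: less_imp_le)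
next
  case True
  show ?thesis
  proof (cases "0 \<in> rel_interior K")
    case False
    then obtain a where a: "\<And>y. y \<in> K \<Longrightarrow> a \<bullet> 0 \<le> a \<bullet> y"
        "\<And>y. y \<in> rel_interior K \<Longrightarrow> a \<bullet> 0 < a \<bullet> y"
      using supporting_hyperplane_rel_boundary[OF assms(1) True False] by metis
    obtain x where x: "x \<in> rel_interior K"
      using assms(1,3) rel_interior_eq_empty by blast
    have "0 < a \<bullet> x" using a(2)[OF x] by simp
    moreover have "x \<in> K" using x rel_interior_subset by blast
    ultimately show ?thesis using a(1) by (intro disjI2 exI[of _ a]) auto
  qed auto
qed

text \<open>Multiply each lifted point by its sign in \<open>X\<close>. A dependency with signs
  \<open>X\<close> is a strictly positive relation among the resulting \<open>t i\<close>, that is,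
  0 lies in the relative interior of their hull. Otherwise a separating \<open>y\<close> yields a
  covector that is not orthogonal to \<open>X\<close>.\<close>

lemma vector_if_orth:
  fixes vs :: "'a::euclidean_space list"
  assumes len: "length X = length vs" and signs: "\<forall>i<length vs. X ! i \<in> {-1, 0, 1}"
    and orth: "\<forall>Y\<in>OM_lifted_arrangement vs. sign_orth X Y"
  shows "X \<in> OM_points vs"
proof -
  let ?n = "length vs"
  let ?S = "{i. i < ?n \<and> X ! i \<noteq> 0}"
  define u where "u i = (vs ! i, 1::real)" for i
  define t where "t i = X ! i *\<^sub>R u i" for i
  have "\<exists>c. (\<forall>i<?n. sgn (c i) = X ! i) \<and> (\<Sum>i<?n. c i *\<^sub>R u i) = 0"
  proof (cases "?S = {}")
    case True
    then show ?thesis by (intro exI[of _ "\<lambda>_. 0"]) auto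
  next
    case False
    define K where "K = convex hull (\<Union>i\<in>?S. {t i})"
    have tK: "t i \<in> K" if "i \<in> ?S" for i
      unfolding K_def using that by (intro hull_inc) auto
    have K: "convex K" "closed K" "K \<noteq> {}"
      using False tK unfolding K_def
      by (auto simp: finite_imp_compact_convex_hull compact_imp_closed)
    have "\<not> (\<exists>y. (\<forall>x\<in>K. 0 \<le> y \<bullet> x) \<and> (\<exists>x\<in>K. 0 < y \<bullet> x))"
    proof
      assume "\<exists>y. (\<forall>x\<in>K. 0 \<le> y \<bullet> x) \<and> (\<exists>x\<in>K. 0 < y \<bullet> x)"
      then obtain y where y: "\<forall>x\<in>K. 0 \<le> y \<bullet> x" "\<exists>x\<in>K. 0 < y \<bullet> x" by blast
      let ?Y = "map (\<lambda>v. sgn (y \<bullet> (v, 1))) vs"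
      have prod: "X ! i * ?Y ! i = sgn (y \<bullet> t i)" if "i < ?n" for i
        using that signs by (auto simp: t_def u_def sgn_mult sgn_of_sign simp del: scaleR_Pair)
      have "sign_orth X ?Y"
        using orth unfolding OM_lifted_arrangement_def by blast
      moreover have "0 \<le> X ! i * ?Y ! i" if "i < ?n" for i
      proof (cases "X ! i = 0")
        case False
        then have "0 \<le> y \<bullet> t i" using y(1) tK that by blast
        then show ?thesis using prod[OF that] by (simp add: sgn_if)
      qed auto
      ultimately have "\<forall>i<?n. X ! i * ?Y ! i = 0"
        unfolding sign_orth_def using len by auto
      then have "y \<bullet> t i = 0" if "i \<in> ?S" for i
        using prod[of i] that by (metis (mono_tags, lifting) mem_Collect_eq sgn_zero_iff)
      then have "K \<subseteq> {x. y \<bullet> x = 0}"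
        unfolding K_def by (intro hull_minimal) (auto simp: convex_hyperplane)
      then show False using y(2) by auto
    qed
    then have "0 \<in> rel_interior K"
      using zero_in_rel_interior_or_separated[OF K] by blast
    \<comment> \<open>Relative interior points are combinations with all coefficients positive, so
      no sign of \<open>X\<close> degenerates to zero. The hull was written as a union of singletons
      for this formula.\<close>
    also have "rel_interior K = {\<Sum>i\<in>?S. c i *\<^sub>R s i | c s. (\<forall>i\<in>?S. c i > 0) \<and> sum c ?S = 1 \<and>
        (\<forall>i\<in>?S. s i \<in> rel_interior {t i})}"
      unfolding K_def by (rule rel_interior_convex_hull_union) auto
    finally obtain c s where cs: "\<forall>i\<in>?S. c i > 0" "\<forall>i\<in>?S. s i = t i" "0 = (\<Sum>i\<in>?S. c i *\<^sub>R s i)"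
      by auto
    define d where "d i = (if X ! i \<noteq> 0 then c i * X ! i else 0)" for i
    have "(\<Sum>i<?n. d i *\<^sub>R u i) = (\<Sum>i\<in>?S. d i *\<^sub>R u i)"
      by (rule sum.mono_neutral_right) (auto simp: d_def)
    also have "\<dots> = (\<Sum>i\<in>?S. c i *\<^sub>R s i)"
      using cs(2) by (intro sum.cong) (auto simp: d_def t_def)
    finally have "(\<Sum>i<?n. d i *\<^sub>R u i) = 0" using cs(3) by simp
    moreover have "\<forall>i<?n. sgn (d i) = X ! i"
      using cs(1) signs by (auto simp: d_def sgn_mult sgn_of_sign)
    ultimately show ?thesis by blast
  qed
  then obtain c where c: "\<forall>i<?n. sgn (c i) = X ! i" "(\<Sum>i<?n. c i *\<^sub>R u i) = 0" by blast
  have "map sgn (map c [0..<?n]) = X"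
    using c(1) len by (intro nth_equalityI) auto
  moreover have "(\<Sum>i<?n. (map c [0..<?n]) ! i *\<^sub>R (vs ! i, 1::real)) = 0"
    using c(2) by (simp add: u_def)
  ultimately show ?thesis
    unfolding OM_points_alt by (intro CollectI exI[of _ "map c [0..<?n]"]) auto
qed

text \<open>A linear functional that is bounded below on a subspace vanishes on it, since otherwise
  scaling a vector would attain the bound.\<close>

lemma separation_from_subspace:
  fixes K :: "'a::euclidean_space set"
  assumes "convex K" "compact K" "K \<noteq> {}" "subspace L" "K \<inter> L = {}"
  shows "\<exists>y. (\<forall>x\<in>K. 0 < y \<bullet> x) \<and> (\<forall>x\<in>L. y \<bullet> x = 0)"
proof -
  obtain a b where ab: "\<forall>x\<in>K. a \<bullet> x < b" "\<forall>x\<in>L. a \<bullet> x > b"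
    using separating_hyperplane_compact_closed[OF assms(1-3) subspace_imp_convex[OF assms(4)]
        closed_subspace[OF assms(4)] assms(5)] by blast
  have "b < 0" using ab(2) subspace_0[OF assms(4)] by force
  have "a \<bullet> x = 0" if "x \<in> L" for x
  proof (rule ccontr)
    assume "a \<bullet> x \<noteq> 0"
    then have "a \<bullet> ((b / (a \<bullet> x)) *\<^sub>R x) = b" by simp
    moreover have "(b / (a \<bullet> x)) *\<^sub>R x \<in> L" using that assms(4) by (simp add: subspace_scale)
    ultimately show False using ab(2) by force
  qed
  then show ?thesis
    using ab(1) \<open>b < 0\<close> by (intro exI[of _ "-a"]) force
qed

text \<open>The sought functional is positive on the points \<open>t i\<close> with nonzero sign and
  zero on the \<open>u i\<close> with zero sign. It exists if the hull of the former misses the span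
  of the latter, and a common point would be a dependency violating orthogonality.\<close>

lemma covector_if_orth:
  fixes vs :: "'a::euclidean_space list"
  assumes dist: "distinct vs"
    and len: "length Y = length vs" and signs: "\<forall>i<length vs. Y ! i \<in> {-1, 0, 1}"
    and orth: "\<forall>X\<in>OM_points vs. sign_orth X Y"
  shows "Y \<in> OM_lifted_arrangement vs"
proof -
  let ?n = "length vs"
  let ?S = "{i. i < ?n \<and> Y ! i \<noteq> 0}" and ?Z = "{i. i < ?n \<and> Y ! i = 0}"
  define u where "u i = (vs ! i, 1::real)" for i
  define t where "t i = Y ! i *\<^sub>R u i" for i
  have inj_u: "inj_on u ?Z"
    using dist by (auto simp: inj_on_def u_def nth_eq_iff_index_eq)
  have inj_t: "inj_on t ?S"
    using dist by (auto simp: inj_on_def t_def u_def nth_eq_iff_index_eq)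
  have "\<exists>y. \<forall>i<?n. sgn (y \<bullet> u i) = Y ! i"
  proof (cases "?S = {}")
    case True
    then show ?thesis by (intro exI[of _ 0]) auto
  next
    case False
    let ?K = "convex hull (t ` ?S)" and ?L = "span (u ` ?Z)"
    have disj: "?K \<inter> ?L = {}"
    proof (rule ccontr)
      assume "?K \<inter> ?L \<noteq> {}"
      then obtain p where p: "p \<in> ?K" "p \<in> ?L" by blast
      obtain l where l: "\<forall>x\<in>t ` ?S. 0 \<le> l x" "sum l (t ` ?S) = 1" "(\<Sum>x\<in>t ` ?S. l x *\<^sub>R x) = p"
        using p(1) by (auto simp: convex_hull_finite)
      obtain m where m: "p = (\<Sum>x\<in>u ` ?Z. m x *\<^sub>R x)"
        using p(2) by (auto simp: span_finite)
      \<comment> \<open>The two expressions for the common point \<open>p\<close> are subtracted;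
        the factor \<open>Y ! i\<close> undoes the sign change contained in
        \<open>t i\<close>.\<close>
      define c where "c i = (if Y ! i = 0 then - m (u i) else l (t i) * Y ! i)" for i
      have "(\<Sum>i<?n. c i *\<^sub>R u i) = (\<Sum>i\<in>?S \<union> ?Z. c i *\<^sub>R u i)"
        by (intro sum.cong) auto
      also have "\<dots> = (\<Sum>i\<in>?S. c i *\<^sub>R u i) + (\<Sum>i\<in>?Z. c i *\<^sub>R u i)"
        by (intro sum.union_disjoint) auto
      also have "(\<Sum>i\<in>?S. c i *\<^sub>R u i) = (\<Sum>i\<in>?S. l (t i) *\<^sub>R t i)"
        by (intro sum.cong) (auto simp: c_def t_def)
      also have "\<dots> = p"
        using l(3) by (simp add: sum.reindex[OF inj_t])
      also have "(\<Sum>i\<in>?Z. c i *\<^sub>R u i) = - p"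
        using m by (simp add: c_def sum.reindex[OF inj_u] sum_negf)
      finally have dep: "(\<Sum>i<?n. c i *\<^sub>R u i) = 0" by simp
      let ?X = "map sgn (map c [0..<?n])"
      have "?X \<in> OM_points vs"
        unfolding OM_points_alt using dep by (intro CollectI exI[of _ "map c [0..<?n]"]) (auto simp: u_def)
      then have "sign_orth ?X Y" using orth by blast
      moreover have prod: "?X ! i * Y ! i = (if Y ! i = 0 then 0 else sgn (l (t i)))" if "i < ?n" for i
        using that signs by (auto simp: c_def sgn_mult sgn_of_sign)
      moreover have "0 \<le> l (t i)" if "i \<in> ?S" for i using l(1) that by blast
      ultimately have *: "\<forall>i<?n. ?X ! i * Y ! i = 0"
        unfolding sign_orth_def length_map length_upt minus_nat.diff_0
        by (smt (verit) mem_Collect_eq sgn_if)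
      have "l (t i) = 0" if "i \<in> ?S" for i
        using prod[of i] * that by (metis (mono_tags, lifting) mem_Collect_eq sgn_zero_iff)
      then have "sum l (t ` ?S) = 0" by (intro sum.neutral) auto
      then show False using l(2) by simp
    qed
    have K: "convex ?K" "compact ?K" "?K \<noteq> {}"
      using False by (auto simp: finite_imp_compact_convex_hull)
    obtain y where y: "\<forall>x\<in>?K. 0 < y \<bullet> x" "\<forall>x\<in>?L. y \<bullet> x = 0"
      using separation_from_subspace[OF K subspace_span disj] by blast
    have "sgn (y \<bullet> u i) = Y ! i" if "i < ?n" for i
    proof (cases "Y ! i = 0")
      case True
      then have "u i \<in> ?L" using that by (auto intro: span_base)
      then show ?thesis using y(2) True by simp
    next
      case False
      then have "t i \<in> ?K" using that by (auto intro: hull_inc)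
      then have "0 < Y ! i * (y \<bullet> u i)" using y(1) by (auto simp: t_def)
      moreover have "Y ! i = -1 \<or> Y ! i = 1" using signs that False by auto
      ultimately show ?thesis by auto
    qed
    then show ?thesis by blast
  qed
  then obtain y where y: "\<forall>i<?n. sgn (y \<bullet> u i) = Y ! i" by blast
  have "Y = map (\<lambda>v. sgn (y \<bullet> (v, 1))) vs"
    using y len by (intro nth_equalityI) (auto simp: u_def)
  then show ?thesis unfolding OM_lifted_arrangement_def by blast
qed

lemma OM_points_nonempty: "OM_points vs \<noteq> {}"
proof -
  have "map sgn (replicate (length vs) 0) \<in> OM_points vs"
    unfolding OM_points_def by (intro CollectI exI[of _ "replicate (length vs) 0"]) auto
  then show ?thesis by blast
qed

lemma OM_lifted_nonempty: "OM_lifted_arrangement vs \<noteq> {}"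
  unfolding OM_lifted_arrangement_def by blast

lemma OM_points_iff_orth:
  fixes vs :: "'a::euclidean_space list"
  shows "X \<in> OM_points vs \<longleftrightarrow> length X = length vs \<and> (\<forall>i<length vs. X ! i \<in> {-1, 0, 1}) \<and>
    (\<forall>Y\<in>OM_lifted_arrangement vs. sign_orth X Y)"
  using OM_points_signs vector_orth_covector vector_if_orth by blast

lemma OM_lifted_iff_orth:
  fixes vs :: "'a::euclidean_space list"
  assumes "distinct vs"
  shows "Y \<in> OM_lifted_arrangement vs \<longleftrightarrow> length Y = length vs \<and> (\<forall>i<length vs. Y ! i \<in> {-1, 0, 1}) \<and>
    (\<forall>X\<in>OM_points vs. sign_orth X Y)"
  using OM_lifted_signs vector_orth_covector covector_if_orth[OF assms] by blast

text \<open>Among sign lists of the right length, each of the two sets is the orthogonal complement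
  of the other. The length can be read off any member, and both sets are nonempty.\<close>

lemma OM_points_eq_iff_OM_lifted_eq:
  fixes vs ws :: "'a::euclidean_space list"
  assumes "distinct vs" "distinct ws"
  shows "OM_points vs = OM_points ws \<longleftrightarrow> OM_lifted_arrangement vs = OM_lifted_arrangement ws"
proof
  assume eq: "OM_points vs = OM_points ws"
  then have "length vs = length ws"
    using OM_points_nonempty[of vs] OM_points_signs by (metis all_not_in_conv)
  then show "OM_lifted_arrangement vs = OM_lifted_arrangement ws"
    using eq by (intro set_eqI) (simp add: OM_lifted_iff_orth[OF assms(1)] OM_lifted_iff_orth[OF assms(2)])
next
  assume eq: "OM_lifted_arrangement vs = OM_lifted_arrangement ws"
  then have "length vs = length ws"
    using OM_lifted_nonempty[of vs] OM_lifted_signs by (metis all_not_in_conv)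
  then show "OM_points vs = OM_points ws"
    using eq by (intro set_eqI) (simp add: OM_points_iff_orth)
qed

lemma same_OM_iff_same_arrangement_OM:
  fixes P Q :: "'a::euclidean_space set"
  shows "same_OM P Q \<longleftrightarrow> same_arrangement_OM P Q"
  unfolding same_OM_def same_arrangement_OM_def
  using OM_points_eq_iff_OM_lifted_eq by (metis vertex_ordering_def)

section \<open>Consequences of equal oriented matroids\<close>

lemma polytope_eq_hull_vertices:
  fixes P :: "'a::euclidean_space set"
  shows "polytope P \<Longrightarrow> P = convex hull {v. v extreme_point_of P}"
  by (intro Krein_Milman_Minkowski polytope_imp_compact polytope_imp_convex)

lemma vertex_ordering_hull:
  fixes P :: "'a::euclidean_space set"
  assumes "polytope P" "vertex_ordering P vs"
  shows "convex hull ((!) vs ` {..<length vs}) = P"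
proof -
  have "(!) vs ` {..<length vs} = {v. v extreme_point_of P}"
    using assms(2) by (auto simp: vertex_ordering_def set_conv_nth)
  then show ?thesis using polytope_eq_hull_vertices[OF assms(1)] by simp
qed

text \<open>The affine function with normal \<open>a\<close> and level \<open>b\<close> is the
  pairing of the lifted points with \<open>(a, -b)\<close>, so its signs form a covector.\<close>

lemma OM_lifted_transfer_functional:
  fixes vs ws :: "'a::euclidean_space list"
  assumes "OM_lifted_arrangement vs \<subseteq> OM_lifted_arrangement ws"
  obtains a' b' where "\<And>i. i < length vs \<Longrightarrow> sgn (a \<bullet> vs ! i - b) = sgn (a' \<bullet> ws ! i - b')"
proof -
  have "map (\<lambda>v. sgn ((a, -b) \<bullet> (v, 1))) vs \<in> OM_lifted_arrangement vs"
    unfolding OM_lifted_arrangement_def by blast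
  then have "map (\<lambda>v. sgn ((a, -b) \<bullet> (v, 1))) vs \<in> OM_lifted_arrangement ws"
    using assms by blast
  then obtain y :: "'a \<times> real" where y: "map (\<lambda>v. sgn ((a, -b) \<bullet> (v, 1))) vs = map (\<lambda>v. sgn (y \<bullet> (v, 1))) ws"
    unfolding OM_lifted_arrangement_def by blast
  have len: "length vs = length ws" using y by (rule map_eq_imp_length_eq)
  have "sgn (a \<bullet> vs ! i - b) = sgn (fst y \<bullet> ws ! i - (- snd y))" if "i < length vs" for i
  proof -
    have "map (\<lambda>v. sgn ((a, -b) \<bullet> (v, 1))) vs ! i = map (\<lambda>v. sgn (y \<bullet> (v, 1))) ws ! i"
      by (simp only: y)
    then show ?thesis using that len by (simp add: inner_prod_def)
  qed
  then show ?thesis by (rule that)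
qed

text \<open>Faces are the zero sets of the covectors without positive entries.\<close>

lemma idx_faces_mono_OM_lifted:
  fixes vs ws :: "'a::euclidean_space list"
  assumes len: "length vs = length ws"
    and sub: "OM_lifted_arrangement vs \<subseteq> OM_lifted_arrangement ws"
  shows "idx_faces {..<length vs} ((!) vs) \<subseteq> idx_faces {..<length ws} ((!) ws)"
proof
  fix A assume "A \<in> idx_faces {..<length vs} ((!) vs)"
  then obtain a b where ab: "\<forall>i\<in>{..<length vs}. a \<bullet> vs ! i \<le> b"
      "A = {i\<in>{..<length vs}. a \<bullet> vs ! i = b}"
    unfolding idx_faces_def by blast
  obtain a' b' where s: "\<And>i. i < length vs \<Longrightarrow> sgn (a \<bullet> vs ! i - b) = sgn (a' \<bullet> ws ! i - b')"
    using OM_lifted_transfer_functional[OF sub] by blast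
  have "(a \<bullet> vs ! i \<le> b \<longleftrightarrow> a' \<bullet> ws ! i \<le> b') \<and> (a \<bullet> vs ! i = b \<longleftrightarrow> a' \<bullet> ws ! i = b')"
    if "i < length vs" for i
    using s[OF that] by (auto simp: sgn_if split: if_splits)
  then show "A \<in> idx_faces {..<length ws} ((!) ws)"
    unfolding idx_faces_def using ab len by (intro CollectI exI[of _ a'] exI[of _ b']) auto
qed

lemma same_OM_obtain:
  fixes P Q :: "'a::euclidean_space set"
  assumes "same_OM P Q" "polytope P" "polytope Q"
  obtains vs ws where "length vs = length ws"
    "P = convex hull ((!) vs ` {..<length vs})" "Q = convex hull ((!) ws ` {..<length vs})"
    "OM_lifted_arrangement vs = OM_lifted_arrangement ws"
    "idx_faces {..<length vs} ((!) vs) = idx_faces {..<length vs} ((!) ws)"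
proof -
  obtain vs ws where o: "vertex_ordering P vs" "vertex_ordering Q ws"
      "OM_lifted_arrangement vs = OM_lifted_arrangement ws"
    using assms(1) unfolding same_OM_iff_same_arrangement_OM same_arrangement_OM_def by blast
  have len: "length vs = length ws"
    using o(3) OM_lifted_nonempty[of vs] OM_lifted_signs by (metis all_not_in_conv)
  show ?thesis
  proof (rule that[OF len])
    show "P = convex hull ((!) vs ` {..<length vs})"
      using vertex_ordering_hull[OF assms(2) o(1)] by simp
    show "Q = convex hull ((!) ws ` {..<length vs})"
      using vertex_ordering_hull[OF assms(3) o(2)] len by simp
    show "idx_faces {..<length vs} ((!) vs) = idx_faces {..<length vs} ((!) ws)"
      using idx_faces_mono_OM_lifted[of vs ws] idx_faces_mono_OM_lifted[of ws vs] len o(3)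
      by (metis order_refl subset_antisym)
  qed (rule o(3))
qed

lemma same_OM_imp_comb_equiv:
  fixes P Q :: "'a::euclidean_space set"
  assumes "same_OM P Q" "polytope P" "polytope Q"
  shows "comb_equiv P Q"
proof -
  obtain vs ws where o: "P = convex hull ((!) vs ` {..<length vs})"
      "Q = convex hull ((!) ws ` {..<length vs})"
      "idx_faces {..<length vs} ((!) vs) = idx_faces {..<length vs} ((!) ws)"
    using same_OM_obtain[OF assms] by metis
  show ?thesis
    unfolding comb_equiv_iff
    using order_iso_trans[OF order_iso_sym[OF face_lattice_idx_faces[of "{..<length vs}" "(!) vs"]]]
      face_lattice_idx_faces[of "{..<length vs}" "(!) ws"] o by simp
qed

lemma same_OM_sym: "same_OM P Q \<Longrightarrow> same_OM Q P"
  unfolding same_OM_def by metis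

lemma same_OM_imp_slice_types_subset:
  fixes P Q :: "'a::euclidean_space set"
  assumes "same_OM P Q" "full_dim_polytope P" "full_dim_polytope Q"
  shows "slice_types P \<subseteq> slice_types Q"
proof
  fix T assume "T \<in> slice_types P"
  then obtain a b where ab: "a \<noteq> 0" "T = comb_type (P \<inter> {x. a \<bullet> x = b})"
    unfolding slice_types_def affine_hyperplane_def by blast
  have poly: "polytope P" "polytope Q" using assms(2,3) by (auto simp: full_dim_polytope_def)
  obtain vs ws where o: "length vs = length ws" "P = convex hull ((!) vs ` {..<length vs})"
      "Q = convex hull ((!) ws ` {..<length vs})"
      "OM_lifted_arrangement vs = OM_lifted_arrangement ws"
      "idx_faces {..<length vs} ((!) vs) = idx_faces {..<length vs} ((!) ws)"
    using same_OM_obtain[OF assms(1) poly] by metis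
  have "OM_lifted_arrangement vs \<subseteq> OM_lifted_arrangement ws" using o(4) by simp
  then obtain a' b' where s: "\<And>i. i < length vs \<Longrightarrow> sgn (a \<bullet> vs ! i - b) = sgn (a' \<bullet> ws ! i - b')"
    using OM_lifted_transfer_functional by blast
  have "comb_type (convex hull ((!) vs ` {..<length vs}) \<inter> {x. a \<bullet> x = b}) \<in>
      slice_types (convex hull ((!) ws ` {..<length vs}))"
    using s o(2,5) assms(2) ab(1)
    by (intro slice_types_transfer[where \<phi> = id and a' = a' and b' = b']) auto
  then show "T \<in> slice_types Q" using o(2,3) ab(2) by simp
qed

lemma same_OM_imp_setwise_slice_equiv:
  fixes P Q :: "'a::euclidean_space set"
  assumes "same_OM P Q" "full_dim_polytope P" "full_dim_polytope Q"
  shows "setwise_slice_equiv P Q"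
  unfolding setwise_slice_equiv_def
  using same_OM_imp_slice_types_subset assms same_OM_sym by (intro subset_antisym) auto

section \<open>Pointwise slice equivalence and the arrangement\<close>

text \<open>A nonempty convex set has at least two faces, the empty one and itself, whereas the
  empty set has a single face.\<close>

lemma comb_equiv_empty:
  assumes "comb_equiv P {}" "convex P"
  shows "P = {}"
proof -
  have "face_lattice ({}::'b set) = {{}}" by (auto simp: face_lattice_def)
  then obtain f where f: "bij_betw f (face_lattice P) {{}::'b set}"
    using assms(1) unfolding comb_equiv_def by auto
  have "P \<in> face_lattice P" "{} \<in> face_lattice P"
    using assms(2) by (auto simp: face_lattice_def face_of_refl)
  then show ?thesis
    using f unfolding bij_betw_def inj_on_def by (metis imageI singletonD)
qed

lemma pointwise_slice_equiv_sym: "pointwise_slice_equiv P Q \<Longrightarrow> pointwise_slice_equiv Q P"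
  unfolding pointwise_slice_equiv_def using comb_equiv_sym by blast

text \<open>Through a point of \<open>P\<close> outside \<open>Q\<close> there is a hyperplane,
  parallel to a separating one, that misses \<open>Q\<close>. The two slices would then be a
  nonempty and an empty one.\<close>

lemma pointwise_slice_equiv_subset:
  fixes P Q :: "'a::euclidean_space set"
  assumes "pointwise_slice_equiv P Q" "polytope P" "polytope Q" "Q \<noteq> {}"
  shows "P \<subseteq> Q"
proof
  fix x assume x: "x \<in> P"
  show "x \<in> Q"
  proof (rule ccontr)
    assume "x \<notin> Q"
    then obtain a b where ab: "a \<bullet> x < b" "\<forall>y\<in>Q. b < a \<bullet> y"
      using separating_hyperplane_closed_point[of Q x] assms(3)
      by (auto simp: polytope_imp_convex polytope_imp_closed)
    let ?H = "{y. a \<bullet> y = a \<bullet> x}"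
    have "a \<noteq> 0" using ab assms(4) by auto
    then have "affine_hyperplane ?H" unfolding affine_hyperplane_def by blast
    then have "comb_equiv (P \<inter> ?H) (Q \<inter> ?H)"
      using assms(1) unfolding pointwise_slice_equiv_def by blast
    moreover have "Q \<inter> ?H = {}" using ab by force
    moreover have "convex (P \<inter> ?H)"
      using assms(2) by (simp add: polytope_imp_convex convex_Int convex_hyperplane)
    ultimately have "P \<inter> ?H = {}" using comb_equiv_empty by metis
    then show False using x by auto
  qed
qed

lemma full_dim_polytope_nonempty:
  fixes P :: "'a::euclidean_space set"
  shows "full_dim_polytope P \<Longrightarrow> P \<noteq> {}"
  by (auto simp: full_dim_polytope_def)

lemma eq_iff_pointwise_slice_equiv:
  fixes P Q :: "'a::euclidean_space set"
  assumes "full_dim_polytope P" "full_dim_polytope Q"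
  shows "P = Q \<longleftrightarrow> pointwise_slice_equiv P Q"
proof
  assume "P = Q"
  then show "pointwise_slice_equiv P Q"
    by (simp add: pointwise_slice_equiv_def comb_equiv_refl)
next
  assume *: "pointwise_slice_equiv P Q"
  have poly: "polytope P" "polytope Q" using assms by (auto simp: full_dim_polytope_def)
  show "P = Q"
    using pointwise_slice_equiv_subset[OF * poly full_dim_polytope_nonempty[OF assms(2)]]
      pointwise_slice_equiv_subset[OF pointwise_slice_equiv_sym[OF *] poly(2,1)
        full_dim_polytope_nonempty[OF assms(1)]]
    by (rule subset_antisym)
qed

lemma lifted_hyperplane_inj:
  fixes v w :: "'a::euclidean_space"
  assumes "{y. y \<bullet> (v, 1::real) = 0} = {y. y \<bullet> (w, 1) = 0}"
  shows "v = w"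
proof -
  \<comment> \<open>The last entry is chosen to make this vector orthogonal to
    \<open>(v, 1)\<close>; its product with \<open>(w, 1)\<close> is minus the squared norm of
    \<open>v - w\<close>.\<close>
  have "(v - w, - ((v - w) \<bullet> v)) \<in> {y. y \<bullet> (v, 1::real) = 0}"
    by (simp add: inner_prod_def)
  then have "(v - w, - ((v - w) \<bullet> v)) \<in> {y. y \<bullet> (w, 1::real) = 0}"
    unfolding assms .
  then have "(v - w) \<bullet> (v - w) = 0" by (simp add: inner_prod_def inner_diff_right)
  then show ?thesis by simp
qed

lemma lifted_arrangement_subset_vertices:
  fixes P Q :: "'a::euclidean_space set"
  assumes "lifted_arrangement P \<subseteq> lifted_arrangement Q"
  shows "{v. v extreme_point_of P} \<subseteq> {v. v extreme_point_of Q}"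
proof
  fix v assume "v \<in> {v. v extreme_point_of P}"
  then have "{y. y \<bullet> (v, 1::real) = 0} \<in> lifted_arrangement P"
    unfolding lifted_arrangement_def by blast
  then have "{y. y \<bullet> (v, 1::real) = 0} \<in> lifted_arrangement Q" using assms by blast
  then obtain w where "w extreme_point_of Q" "{y. y \<bullet> (v, 1::real) = 0} = {y. y \<bullet> (w, 1) = 0}"
    unfolding lifted_arrangement_def by blast
  then show "v \<in> {v. v extreme_point_of Q}" using lifted_hyperplane_inj[of v w] by simp
qed

lemma eq_iff_lifted_arrangement_eq:
  fixes P Q :: "'a::euclidean_space set"
  assumes "polytope P" "polytope Q"
  shows "P = Q \<longleftrightarrow> lifted_arrangement P = lifted_arrangement Q"
proof
  assume "lifted_arrangement P = lifted_arrangement Q"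
  then have "{v. v extreme_point_of P} = {v. v extreme_point_of Q}"
    using lifted_arrangement_subset_vertices by (metis order_refl subset_antisym)
  then show "P = Q"
    using polytope_eq_hull_vertices[OF assms(1)] polytope_eq_hull_vertices[OF assms(2)] by simp
qed simp

section \<open>Reflexivity and translates\<close>

lemma polytope_vertex_ordering:
  fixes P :: "'a::euclidean_space set"
  assumes "polytope P"
  obtains vs where "vertex_ordering P vs"
proof -
  have "finite {v. v extreme_point_of P}"
    using assms finite_polyhedron_extreme_points polytope_imp_polyhedron by blast
  then show ?thesis
    using finite_distinct_list[of "{v. v extreme_point_of P}"] that
    by (auto simp: vertex_ordering_def)
qed

lemma same_OM_refl:
  fixes P :: "'a::euclidean_space set"
  shows "polytope P \<Longrightarrow> same_OM P P"
  using polytope_vertex_ordering[of P] unfolding same_OM_def by metis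

text \<open>The coefficients of an affine dependency sum to zero, so the translation vector drops
  out.\<close>

lemma same_OM_translation:
  fixes P :: "'a::euclidean_space set"
  assumes "polytope P"
  shows "same_OM P ((+) c ` P)"
proof -
  obtain vs where vs: "vertex_ordering P vs" using polytope_vertex_ordering[OF assms] .
  have ord: "vertex_ordering ((+) c ` P) (map ((+) c) vs)"
    using vs by (auto simp: vertex_ordering_def distinct_map extreme_points_of_translation)
  have "(\<Sum>i<length vs. d ! i *\<^sub>R (map ((+) c) vs) ! i) =
      (\<Sum>i<length vs. d ! i) *\<^sub>R c + (\<Sum>i<length vs. d ! i *\<^sub>R vs ! i)" for d
    by (simp add: scaleR_add_right sum.distrib scaleR_sum_left)
  then have "OM_points vs = OM_points (map ((+) c) vs)"
    unfolding OM_points_def by (intro Collect_cong ex_cong) auto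
  then show ?thesis
    unfolding same_OM_def using vs ord by blast
qed

lemma same_OM_not_imp_eq:
  "\<exists>P Q :: 'a::euclidean_space set. full_dim_polytope P \<and> full_dim_polytope Q \<and> same_OM P Q \<and> P \<noteq> Q"
proof -
  let ?P = "cbox 0 One :: 'a set"
  let ?Q = "(+) One ` ?P"
  have "box (0::'a) One \<noteq> {}" by (simp add: box_ne_empty)
  then have "aff_dim ?P = int DIM('a)"
    by (intro aff_dim_nonempty_interior) (simp add: interior_cbox)
  then have P: "full_dim_polytope ?P"
    by (simp add: full_dim_polytope_def polytope_interval)
  then have Q: "full_dim_polytope ?Q"
    by (simp add: full_dim_polytope_def polytope_translation_eq aff_dim_translation_eq)
  have "0 \<notin> ?Q"
  proof
    assume "0 \<in> ?Q"
    then obtain x :: 'a where x: "x \<in> ?P" "0 = One + x" by auto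
    obtain e :: 'a where e: "e \<in> Basis" using nonempty_Basis by blast
    have "0 = 1 + x \<bullet> e" using arg_cong[OF x(2), of "\<lambda>z. z \<bullet> e"] e by (simp add: inner_add_left)
    then show False using x(1) e by (auto simp: mem_box)
  qed
  moreover have "0 \<in> ?P" by (simp add: mem_box)
  ultimately have "?P \<noteq> ?Q" by metis
  then show ?thesis using P Q same_OM_translation[of ?P] by (metis full_dim_polytope_def)
qed

section \<open>Skew cross-polytopes\<close>

definition sg :: "bool \<Rightarrow> real" where
  "sg \<sigma> = (if \<sigma> then 1 else -1)"

lemma sg_simps [simp]: "sg True = 1" "sg False = -1"
  by (simp_all add: sg_def)

text \<open>The cross-polytope whose \<open>k\<close>-th diagonal is moved from the origin to \<open>z\<close>.\<close>

definition skew_vert :: "'n::finite \<Rightarrow> real ^ 'n \<Rightarrow> 'n \<times> bool \<Rightarrow> real ^ 'n" where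
  "skew_vert k z x = (if fst x = k then z else 0) + sg (snd x) *\<^sub>R axis (fst x) 1"

definition skew_cross :: "'n::finite \<Rightarrow> real ^ 'n \<Rightarrow> (real ^ 'n) set" where
  "skew_cross k z = convex hull (range (skew_vert k z))"

text \<open>The coordinates being nonnegative, their sum is the l1 norm: \<open>z\<close> is
  interior to the cross-polytope spanned by the diagonals other than \<open>k\<close>. Hence the
  moved diagonal still crosses that equatorial cross-polytope.\<close>

definition skew_shift :: "'n::finite \<Rightarrow> real ^ 'n \<Rightarrow> bool" where
  "skew_shift k z \<longleftrightarrow> z $ k = 0 \<and> (\<forall>l. 0 \<le> z $ l) \<and> (\<Sum>l\<in>UNIV. z $ l) < 1"

definition no_antipodal :: "('n \<times> bool) set \<Rightarrow> bool" where
  "no_antipodal A \<longleftrightarrow> (\<forall>l. \<not> ((l, True) \<in> A \<and> (l, False) \<in> A))"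

lemma inner_skew_vert:
  "a \<bullet> skew_vert k z (l, \<sigma>) = (if l = k then a \<bullet> z else 0) + sg \<sigma> * a $ l"
  by (simp add: skew_vert_def inner_add_right inner_axis)

text \<open>This is the Hoelder inequality for the l1 and the maximum norm; the coordinate
  \<open>k\<close> of \<open>a\<close> is unrestricted because \<open>z\<close> vanishes
  there.\<close>

lemma skew_shift_inner_bound:
  assumes "skew_shift k z" "\<And>l. l \<noteq> k \<Longrightarrow> \<bar>a $ l\<bar> \<le> B"
  shows "\<bar>a \<bullet> z\<bar> \<le> (\<Sum>l\<in>UNIV. z $ l) * B"
proof -
  have "\<bar>a \<bullet> z\<bar> \<le> (\<Sum>l\<in>UNIV. \<bar>a $ l * z $ l\<bar>)"
    unfolding inner_vec_def by (simp add: sum_abs)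
  also have "\<dots> \<le> (\<Sum>l\<in>UNIV. z $ l * B)"
  proof (rule sum_mono)
    fix l
    show "\<bar>a $ l * z $ l\<bar> \<le> z $ l * B"
    proof (cases "l = k")
      case True
      then show ?thesis using assms(1) by (simp add: skew_shift_def)
    next
      case False
      then have "\<bar>a $ l\<bar> * z $ l \<le> B * z $ l"
        using assms by (intro mult_right_mono) (auto simp: skew_shift_def)
      then show ?thesis using assms(1) by (simp add: skew_shift_def abs_mult mult.commute)
    qed
  qed
  finally show ?thesis by (simp add: sum_distrib_right)
qed

text \<open>In the regular case the functional with coefficients 1, -1 and 0 supports the face at
  level 1. The shift adds \<open>g\<close> at both ends of diagonal \<open>k\<close>, so coefficient
  \<open>k\<close> is corrected to bring the chosen end back to 1. The other end gets
  \<open>2 * g - 1\<close>, or both get \<open>g\<close> if none is chosen; these are below 1 as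
  \<open>\<bar>g\<bar> < 1\<close>.\<close>

lemma skew_faces_no_antipodal:
  assumes z: "skew_shift k z" and A: "no_antipodal A"
  shows "A \<in> idx_faces UNIV (skew_vert k z)"
proof -
  define f where "f l = (if (l, True) \<in> A then 1 else if (l, False) \<in> A then -1 else (0::real))" for l
  define g where "g = (\<chi> l. f l) \<bullet> z"
  define q where "q = (if (k, True) \<in> A then 1 - g else if (k, False) \<in> A then g - 1 else 0)"
  define a where "a = (\<chi> l. if l = k then q else f l)"
  have zk: "z $ k = 0" using z by (simp add: skew_shift_def)
  have az: "a \<bullet> z = g"
    unfolding g_def inner_vec_def by (rule sum.cong) (auto simp: a_def zk)
  have "\<bar>g\<bar> \<le> (\<Sum>l\<in>UNIV. z $ l) * 1"
    unfolding g_def using z by (rule skew_shift_inner_bound) (auto simp: f_def)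
  then have g: "\<bar>g\<bar> < 1" using z by (simp add: skew_shift_def)
  have "a \<bullet> skew_vert k z (l, \<sigma>) \<le> 1 \<and> (a \<bullet> skew_vert k z (l, \<sigma>) = 1 \<longleftrightarrow> (l, \<sigma>) \<in> A)" for l \<sigma>
    using A g unfolding inner_skew_vert az no_antipodal_def
    by (cases \<sigma>) (auto simp: a_def q_def f_def)
  then show ?thesis
    unfolding idx_faces_def
    by (intro CollectI exI[of _ a] exI[of _ 1]) (auto simp: prod_eq_iff)
qed

text \<open>A supporting functional attaining its maximum \<open>b\<close> at both ends attains it
  at their midpoint, the origin or \<open>z\<close>. At the origin this means \<open>b = 0\<close>;
  at \<open>z\<close> the norm bound with a factor below 1 gives the same. Then all coefficients
  vanish.\<close>

lemma skew_faces_antipodal: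
  assumes z: "skew_shift k z" and A: "A \<in> idx_faces UNIV (skew_vert k z)"
    and l: "(l, True) \<in> A" "(l, False) \<in> A"
  shows "A = UNIV"
proof -
  obtain a b where ab: "\<And>x. a \<bullet> skew_vert k z x \<le> b" "A = {x. a \<bullet> skew_vert k z x = b}"
    using A unfolding idx_faces_def by auto
  have le: "(if i = k then a \<bullet> z else 0) + \<bar>a $ i\<bar> \<le> b" for i
    using ab(1)[of "(i, True)"] ab(1)[of "(i, False)"] by (simp add: inner_skew_vert)
  have eq: "a $ l = 0" "(if l = k then a \<bullet> z else 0) = b"
    using l ab(2) by (auto simp: inner_skew_vert)
  have small: "\<bar>a $ i\<bar> \<le> b" if "i \<noteq> k" for i using le[of i] that by simp
  have bound: "\<bar>a \<bullet> z\<bar> \<le> (\<Sum>l\<in>UNIV. z $ l) * b"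
    using skew_shift_inner_bound[OF z small] by blast
  have "b = 0"
  proof (cases "l = k")
    case True
    then have "a \<bullet> z = b" using eq(2) by simp
    then have "b * (1 - (\<Sum>l\<in>UNIV. z $ l)) \<le> 0" "\<bar>b\<bar> \<le> (\<Sum>l\<in>UNIV. z $ l) * b"
      using bound by (auto simp: algebra_simps)
    moreover have "0 \<le> (\<Sum>l\<in>UNIV. z $ l)" using z by (simp add: skew_shift_def sum_nonneg)
    moreover have "0 < 1 - (\<Sum>l\<in>UNIV. z $ l)" using z by (simp add: skew_shift_def)
    ultimately show ?thesis
      by (smt (verit) mult_nonneg_nonpos mult_pos_pos)
  next
    case False
    then show ?thesis using eq(2) by simp
  qed
  then have "a \<bullet> z = 0" using bound by simp
  then have "a $ i = 0" for i using le[of i] \<open>b = 0\<close> by (auto split: if_splits)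
  then have "a \<bullet> skew_vert k z (i, \<sigma>) = b" for i \<sigma>
    using \<open>a \<bullet> z = 0\<close> \<open>b = 0\<close> by (simp add: inner_skew_vert)
  then show ?thesis using ab(2) by auto
qed

lemma skew_faces:
  assumes "skew_shift k z"
  shows "A \<in> idx_faces UNIV (skew_vert k z) \<longleftrightarrow> A = UNIV \<or> no_antipodal A"
proof
  assume A: "A \<in> idx_faces UNIV (skew_vert k z)"
  show "A = UNIV \<or> no_antipodal A"
  proof (cases "no_antipodal A")
    case False
    then obtain l where "(l, True) \<in> A" "(l, False) \<in> A" unfolding no_antipodal_def by blast
    then show ?thesis using skew_faces_antipodal[OF assms A] by blast
  qed simp
next
  assume "A = UNIV \<or> no_antipodal A"
  then show "A \<in> idx_faces UNIV (skew_vert k z)"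
    using skew_faces_no_antipodal[OF assms] idx_faces_top by blast
qed

text \<open>The functional exposing \<open>{i}\<close> shows both that \<open>v i\<close> is extreme
  and that no other index has the same point.\<close>

lemma vertices_if_singleton_faces:
  fixes v :: "'i \<Rightarrow> 'a::euclidean_space"
  assumes I: "finite I" and sing: "\<And>i. i \<in> I \<Longrightarrow> {i} \<in> idx_faces I v"
  shows "{x. x extreme_point_of convex hull (v ` I)} = v ` I" "inj_on v I"
proof
  show "{x. x extreme_point_of convex hull (v ` I)} \<subseteq> v ` I"
    using extreme_point_of_convex_hull by blast
  show "v ` I \<subseteq> {x. x extreme_point_of convex hull (v ` I)}"
  proof
    fix x assume "x \<in> v ` I"
    then obtain i where i: "i \<in> I" "x = v i" by blast
    then have "convex hull (v ` {i}) face_of convex hull (v ` I)"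
      using idx_face_is_face[OF I sing] by blast
    then show "x \<in> {x. x extreme_point_of convex hull (v ` I)}"
      using i(2) by (simp add: face_of_singleton)
  qed
next
  show "inj_on v I"
  proof (rule inj_onI)
    fix i j assume ij: "i \<in> I" "j \<in> I" "v i = v j"
    obtain a b where "{i} = {i\<in>I. a \<bullet> v i = b}"
      using sing[OF ij(1)] unfolding idx_faces_def by blast
    then show "i = j" using ij by (metis (mono_tags, lifting) mem_Collect_eq singletonD singletonI)
  qed
qed

lemma skew_singleton_faces:
  assumes "skew_shift k z"
  shows "{x} \<in> idx_faces UNIV (skew_vert k z)"
  using skew_faces[OF assms] by (auto simp: no_antipodal_def)

lemma skew_cross_vertices:
  assumes "skew_shift k z"
  shows "{x. x extreme_point_of skew_cross k z} = range (skew_vert k z)" "inj (skew_vert k z)"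
  using vertices_if_singleton_faces[of UNIV "skew_vert k z"] skew_singleton_faces[OF assms]
  by (simp_all add: skew_cross_def)

lemma full_dim_skew_cross: "full_dim_polytope (skew_cross k z)"
proof -
  have poly: "polytope (skew_cross k z)"
    unfolding skew_cross_def polytope_def by (intro exI[of _ "range (skew_vert k z)"]) simp
  have "\<not> aff_dim (skew_cross k z) < int DIM(real ^ 'a)"
  proof
    assume "aff_dim (skew_cross k z) < int DIM(real ^ 'a)"
    then obtain a b where ab: "a \<noteq> 0" "skew_cross k z \<subseteq> {x. a \<bullet> x = b}"
      using aff_lowdim_subset_hyperplane by metis
    have val: "a \<bullet> skew_vert k z x = b" for x
      using ab(2) hull_subset[of "range (skew_vert k z)" convex] unfolding skew_cross_def by blast
    have "a $ l = 0" for l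
      using val[of "(l, True)"] val[of "(l, False)"] by (simp add: inner_skew_vert)
    then show False using ab(1) by (simp add: vec_eq_iff)
  qed
  then show ?thesis
    using poly aff_dim_le_DIM[of "skew_cross k z"] by (simp add: full_dim_polytope_def)
qed

lemma comb_equiv_skew_cross:
  assumes "skew_shift k z" "skew_shift k z'"
  shows "comb_equiv (skew_cross k z) (skew_cross k z')"
proof -
  have "idx_faces UNIV (skew_vert k z) = idx_faces UNIV (skew_vert k z')"
    using skew_faces[OF assms(1)] skew_faces[OF assms(2)] by blast
  then show ?thesis
    unfolding comb_equiv_iff skew_cross_def
    using order_iso_trans[OF order_iso_sym[OF face_lattice_idx_faces[of UNIV "skew_vert k z"]]]
      face_lattice_idx_faces[of UNIV "skew_vert k z'"] by simp
qed

subsection \<open>Slices of skew cross-polytopes\<close>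

text \<open>The two vertices of a diagonal with midpoint value \<open>c\<close> and half difference \<open>p\<close> have the
  values \<open>c + \<bar>p\<bar>\<close> and \<open>c - \<bar>p\<bar>\<close>.\<close>

definition sgn_match :: "real \<Rightarrow> real \<Rightarrow> real \<Rightarrow> real \<Rightarrow> bool" where
  "sgn_match c p c' p' \<longleftrightarrow>
     sgn (c + \<bar>p\<bar>) = sgn (c' + \<bar>p'\<bar>) \<and> sgn (c - \<bar>p\<bar>) = sgn (c' - \<bar>p'\<bar>)"

text \<open>The value of the affine function with constant term \<open>m\<close> and gradient
  \<open>p\<close> at the midpoint of diagonal \<open>l\<close>.\<close>

definition mid_value :: "'n::finite \<Rightarrow> real ^ 'n \<Rightarrow> real \<Rightarrow> real ^ 'n \<Rightarrow> 'n \<Rightarrow> real" where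
  "mid_value k z m p l = (if l = k then m + p \<bullet> z else m)"

lemma sgn_match_refl: "sgn_match c p c p"
  by (simp add: sgn_match_def)

lemma sgn_match_abs: "sgn_match c p c \<bar>p\<bar>"
  by (simp add: sgn_match_def)

lemma sgn_match_uminus: "sgn_match (- c) p (- c') p' \<longleftrightarrow> sgn_match c p c' p'"
proof -
  have "sgn (- c + \<bar>p\<bar>) = - sgn (c - \<bar>p\<bar>)" "sgn (- c - \<bar>p\<bar>) = - sgn (c + \<bar>p\<bar>)" for c p :: real
    using sgn_minus[of "c - \<bar>p\<bar>"] sgn_minus[of "c + \<bar>p\<bar>"] by simp_all
  then show ?thesis unfolding sgn_match_def by auto
qed

lemma sgn_match_crossing: "\<bar>c\<bar> < \<bar>p\<bar> \<Longrightarrow> \<bar>c'\<bar> < \<bar>p'\<bar> \<Longrightarrow> sgn_match c p c' p'"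
  by (auto simp: sgn_match_def sgn_if)

lemma sgn_match_scale: "0 < t \<Longrightarrow> sgn_match c p (t * c) (t * p)"
proof -
  assume t: "0 < t"
  have "t * c + \<bar>t * p\<bar> = t * (c + \<bar>p\<bar>)" "t * c - \<bar>t * p\<bar> = t * (c - \<bar>p\<bar>)"
    using t by (simp_all add: abs_mult algebra_simps)
  then show ?thesis using t by (simp add: sgn_match_def sgn_mult)
qed

text \<open>Scaling midpoint value and half difference by the same positive factor preserves both
  signs, so only the sign of the new midpoint value has to be arranged.\<close>

lemma sgn_match_ex:
  assumes "sgn g = sgn (c::real)"
  shows "\<exists>q. sgn_match c p g q"
proof (cases "c = 0")
  case True
  then have "g = 0" using assms by (simp add: sgn_zero_iff)
  then show ?thesis using True sgn_match_refl by blast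
next
  case False
  then have "0 < g / c" using assms by (auto simp: sgn_if zero_less_divide_iff split: if_splits)
  then have "sgn_match c p (g / c * c) (g / c * p)" by (rule sgn_match_scale)
  then show ?thesis using False by auto
qed

text \<open>The signs of \<open>(m, p)\<close> at the vertices for shift \<open>z\<close> also occur
  for \<open>z'\<close> after permuting the diagonals by \<open>\<pi>\<close>. As
  \<open>sgn_match\<close> uses absolute values, the ends of a diagonal may be exchanged
  too.\<close>

definition sign_realized :: "'n::finite \<Rightarrow> real ^ 'n \<Rightarrow> real \<Rightarrow> real ^ 'n \<Rightarrow> real ^ 'n \<Rightarrow> bool" where
  "sign_realized k z m p z' \<longleftrightarrow> (\<exists>m' p' \<pi>. bij \<pi> \<and>
     (\<forall>l. sgn_match (mid_value k z m p l) (p $ l) (mid_value k z' m' p' (\<pi> l)) (p' $ \<pi> l)))"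

text \<open>Since \<open>z'\<close> vanishes at \<open>k\<close>, the entry \<open>q\<close> there
  does not influence the value at \<open>z'\<close> and can be chosen after that value is
  known.\<close>

lemma sign_realizedI:
  assumes zk: "z' $ k = 0" and \<pi>: "bij \<pi>"
    and match: "\<And>l. sgn_match (mid_value k z m p l) (p $ l)
      (if \<pi> l = k then m' + f \<bullet> z' else m') (if \<pi> l = k then q else f $ \<pi> l)"
  shows "sign_realized k z m p z'"
proof -
  define p' where "p' = (\<chi> l. if l = k then q else f $ l)"
  have inner: "p' \<bullet> z' = f \<bullet> z'"
    unfolding inner_vec_def by (rule sum.cong) (auto simp: p'_def zk)
  have "mid_value k z' m' p' (\<pi> l) = (if \<pi> l = k then m' + f \<bullet> z' else m')"
    "p' $ \<pi> l = (if \<pi> l = k then q else f $ \<pi> l)" for l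
    by (simp add: mid_value_def inner) (simp add: p'_def)
  then have "sgn_match (mid_value k z m p l) (p $ l) (mid_value k z' m' p' (\<pi> l)) (p' $ \<pi> l)" for l
    using match[of l] by (simp only:)
  then show ?thesis
    unfolding sign_realized_def using \<pi> by blast
qed

lemma transpose_eq_iff_fixed: "x \<noteq> k \<Longrightarrow> y \<noteq> k \<Longrightarrow> Transposition.transpose x y l = k \<longleftrightarrow> l = k"
  by (auto simp: Transposition.transpose_def)

text \<open>If no coefficient off \<open>k\<close> exceeds \<open>m\<close> in absolute value, then
  the function is positive at both shifts and only entry \<open>k\<close> is adjusted. Otherwise a
  diagonal \<open>l0\<close> has ends of opposite sign, and its coefficient may be any
  \<open>N\<close> with \<open>m < \<bar>N\<bar>\<close>. It is moved to \<open>i\<close>, where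
  \<open>N\<close> controls the value at \<open>z'\<close>.\<close>

lemma sign_realized_pos:
  fixes z z' :: "real ^ 'n::finite"
  assumes z: "skew_shift k z" and z': "skew_shift k z'" and i: "0 < z' $ i" and m: "0 < m"
  shows "sign_realized k z m p z'"
proof (cases "\<forall>l. l \<noteq> k \<longrightarrow> \<bar>p $ l\<bar> \<le> m")
  case True
  have pos: "0 < m + p \<bullet> y" if "skew_shift k y" for y
  proof -
    have "\<bar>p \<bullet> y\<bar> \<le> (\<Sum>l\<in>UNIV. y $ l) * m"
      using that True by (intro skew_shift_inner_bound) auto
    also have "\<dots> < 1 * m"
      using that m by (intro mult_strict_right_mono) (auto simp: skew_shift_def)
    finally show ?thesis by simp
  qed
  have "sgn (m + p \<bullet> z') = sgn (m + p \<bullet> z)" using pos[OF z] pos[OF z'] by simp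
  then obtain q where q: "sgn_match (m + p \<bullet> z) (p $ k) (m + p \<bullet> z') q"
    using sgn_match_ex by blast
  show ?thesis
    using z' q
    by (intro sign_realizedI[of z' k id z m p m p q]) (auto simp: skew_shift_def mid_value_def sgn_match_refl)
next
  case False
  then obtain l0 where l0: "l0 \<noteq> k" "m < \<bar>p $ l0\<bar>" by auto
  have ik: "i \<noteq> k" using i z' by (auto simp: skew_shift_def)
  let ?\<pi> = "Transposition.transpose l0 i"
  \<comment> \<open>Absolute values make the contributions of the other diagonals nonnegative, hence
    \<open>m \<le> B\<close>.\<close>
  define F where "F N = (\<chi> l. if l = i then N else \<bar>p $ ?\<pi> l\<bar>)" for N :: real
  define B where "B = m + (\<Sum>l\<in>UNIV - {i}. \<bar>p $ ?\<pi> l\<bar> * z' $ l)"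
  have inner: "m + F N \<bullet> z' = B + N * z' $ i" for N
  proof -
    have "F N \<bullet> z' = F N $ i * z' $ i + (\<Sum>l\<in>UNIV - {i}. F N $ l * z' $ l)"
      unfolding inner_vec_def by (simp add: sum.remove[of UNIV i])
    also have "(\<Sum>l\<in>UNIV - {i}. F N $ l * z' $ l) = (\<Sum>l\<in>UNIV - {i}. \<bar>p $ ?\<pi> l\<bar> * z' $ l)"
      by (rule sum.cong) (auto simp: F_def)
    finally show ?thesis by (simp add: B_def F_def)
  qed
  have B: "m \<le> B"
    unfolding B_def using z' by (auto simp: skew_shift_def intro!: sum_nonneg)
  have "z' $ i \<le> (\<Sum>l\<in>UNIV. z' $ l)"
    using z' by (intro member_le_sum) (auto simp: skew_shift_def)
  then have zi: "z' $ i < 1" using z' by (simp add: skew_shift_def)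
  \<comment> \<open>The value \<open>B + N * z' $ i\<close> changes sign at
    \<open>- (B / z' $ i)\<close>, whose absolute value exceeds \<open>m\<close> because
    \<open>m \<le> B\<close> and \<open>z' $ i < 1\<close>. So all three signs are available within
    the admissible range.\<close>
  have "\<exists>N. m < \<bar>N\<bar> \<and> sgn (B + N * z' $ i) = sgn (m + p \<bullet> z)"
  proof -
    have absB: "\<bar>B\<bar> = B" using B m by simp
    have Bz: "m < B / z' $ i"
      using B m i zi by (smt (verit) divide_less_eq_1_pos less_divide_eq mult_less_cancel_left2)
    consider "0 < m + p \<bullet> z" | "m + p \<bullet> z = 0" | "m + p \<bullet> z < 0" by linarith
    then show ?thesis
    proof cases
      case 1
      have "0 < B + (m + 1) * z' $ i" using B m i by (simp add: add_pos_pos)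
      then show ?thesis using 1 m by (intro exI[of _ "m + 1"]) simp
    next
      case 2
      then show ?thesis using Bz i m by (intro exI[of _ "- (B / z' $ i)"]) (simp add: absB)
    next
      case 3
      have "B + (- (2 * (B / z' $ i))) * z' $ i = - B" using i by simp
      then show ?thesis
        using Bz B m i 3 by (intro exI[of _ "- (2 * (B / z' $ i))"]) (simp add: absB)
    qed
  qed
  then obtain N where N: "m < \<bar>N\<bar>" "sgn (B + N * z' $ i) = sgn (m + p \<bullet> z)" by blast
  then have "sgn (m + F N \<bullet> z') = sgn (m + p \<bullet> z)" by (simp add: inner)
  then obtain q where q: "sgn_match (m + p \<bullet> z) (p $ k) (m + F N \<bullet> z') q"
    using sgn_match_ex by blast
  have fixk: "?\<pi> l = k \<longleftrightarrow> l = k" for l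
    using l0(1) ik by (rule transpose_eq_iff_fixed)
  show ?thesis
  proof (rule sign_realizedI[of z' k ?\<pi> z m p m "F N" q])
    fix l
    consider "l = k" | "l = l0" | "l \<noteq> k" "l \<noteq> l0" by blast
    then show "sgn_match (mid_value k z m p l) (p $ l)
      (if ?\<pi> l = k then m + F N \<bullet> z' else m) (if ?\<pi> l = k then q else F N $ ?\<pi> l)"
    proof cases
      case 1
      then show ?thesis using q fixk by (simp add: mid_value_def)
    next
      case 2
      then show ?thesis using l0 ik N(1) m
        by (auto simp: mid_value_def fixk F_def intro!: sgn_match_crossing)
    next
      case 3
      then have "?\<pi> l \<noteq> i" by (auto simp: Transposition.transpose_def)
      then show ?thesis using 3 by (simp add: mid_value_def fixk F_def sgn_match_abs)
    qed
  qed (use z' in \<open>auto simp: skew_shift_def\<close>)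
qed

text \<open>Now every diagonal except \<open>k\<close> has midpoint value 0. If diagonal
  \<open>k\<close> has ends of opposite sign, a large entry \<open>q\<close> recreates this. If it
  lies in the hyperplane, it is exchanged with a diagonal that does not. If the value at
  \<open>z\<close> is nonzero, a coordinate responsible for it is moved to \<open>i\<close> and all
  coefficients get the sign of that value.\<close>

lemma sign_realized_zero:
  fixes z z' :: "real ^ 'n::finite"
  assumes z: "skew_shift k z" and z': "skew_shift k z'" and i: "0 < z' $ i"
  shows "sign_realized k z 0 p z'"
proof -
  have zk: "z' $ k = 0" "z $ k = 0" using z z' by (auto simp: skew_shift_def)
  have ik: "i \<noteq> k" using i z' by (auto simp: skew_shift_def)
  consider (cross) "\<bar>p \<bullet> z\<bar> < \<bar>p $ k\<bar>" | (zero) "p $ k = 0" "p \<bullet> z = 0"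
    | (other) "p \<bullet> z \<noteq> 0" by force
  then show ?thesis
  proof cases
    case cross
    then have "sgn_match (p \<bullet> z) (p $ k) (p \<bullet> z') (\<bar>p \<bullet> z'\<bar> + 1)"
      by (intro sgn_match_crossing) auto
    then show ?thesis
      using zk by (intro sign_realizedI[of z' k id z 0 p 0 p "\<bar>p \<bullet> z'\<bar> + 1"])
        (auto simp: mid_value_def sgn_match_refl)
  next
    case zero
    show ?thesis
    proof (cases "p = 0")
      case True
      then show ?thesis
        using zk by (intro sign_realizedI[of z' k id z 0 p 0 p 0]) (auto simp: mid_value_def sgn_match_refl)
    next
      case False
      then obtain l0 where l0: "p $ l0 \<noteq> 0" by (auto simp: vec_eq_iff)
      let ?\<pi> = "Transposition.transpose k l0"
      let ?f = "\<chi> l. p $ ?\<pi> l"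
      show ?thesis
      proof (rule sign_realizedI[of z' k ?\<pi> z 0 p 0 ?f "\<bar>?f \<bullet> z'\<bar> + 1"])
        fix l
        have lk: "l0 \<noteq> k" using l0 zero(1) by auto
        consider "l = k" | "l = l0" | "l \<noteq> k" "l \<noteq> l0" by blast
        then show "sgn_match (mid_value k z 0 p l) (p $ l)
          (if ?\<pi> l = k then 0 + ?f \<bullet> z' else 0) (if ?\<pi> l = k then \<bar>?f \<bullet> z'\<bar> + 1 else ?f $ ?\<pi> l)"
        proof cases
          case 1
          then show ?thesis using zero lk by (simp add: mid_value_def sgn_match_refl)
        next
          case 2
          then show ?thesis using lk l0 by (auto simp: mid_value_def intro!: sgn_match_crossing)
        next
          case 3
          then show ?thesis by (simp add: mid_value_def sgn_match_refl)
        qed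
      qed (use zk in auto)
    qed
  next
    case other
    have "\<exists>l0. p $ l0 * z $ l0 \<noteq> 0"
    proof (rule ccontr)
      assume "\<not> ?thesis"
      then have "p \<bullet> z = 0" unfolding inner_vec_def by (intro sum.neutral) auto
      then show False using other by simp
    qed
    then obtain l0 where l0: "p $ l0 \<noteq> 0" "l0 \<noteq> k" using zk by auto
    let ?\<pi> = "Transposition.transpose l0 i"
    define s where "s = sgn (p \<bullet> z)"
    have s: "\<bar>s\<bar> = 1" using other by (simp add: s_def sgn_if)
    define f where "f = (\<chi> l. s * \<bar>p $ ?\<pi> l\<bar>)"
    have fixk: "?\<pi> l = k \<longleftrightarrow> l = k" for l
      using l0(2) ik by (rule transpose_eq_iff_fixed)
    have "0 < \<bar>p $ ?\<pi> i\<bar> * z' $ i" using l0 i by simp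
    also have "\<dots> \<le> (\<Sum>l\<in>UNIV. \<bar>p $ ?\<pi> l\<bar> * z' $ l)"
      using z' by (intro member_le_sum[of i UNIV "\<lambda>l. \<bar>p $ ?\<pi> l\<bar> * z' $ l"]) (auto simp: skew_shift_def)
    finally have pos: "0 < (\<Sum>l\<in>UNIV. \<bar>p $ ?\<pi> l\<bar> * z' $ l)" .
    have "f \<bullet> z' = s * (\<Sum>l\<in>UNIV. \<bar>p $ ?\<pi> l\<bar> * z' $ l)"
      unfolding inner_vec_def by (simp add: f_def sum_distrib_left mult.assoc)
    then have "sgn (f \<bullet> z') = sgn (p \<bullet> z)"
      using pos by (simp add: sgn_mult s_def)
    then obtain q where q: "sgn_match (p \<bullet> z) (p $ k) (f \<bullet> z') q"
      using sgn_match_ex by blast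
    show ?thesis
    proof (rule sign_realizedI[of z' k ?\<pi> z 0 p 0 f q])
      fix l
      have "\<bar>f $ ?\<pi> l\<bar> = \<bar>p $ l\<bar>" using s by (simp add: f_def abs_mult)
      then show "sgn_match (mid_value k z 0 p l) (p $ l)
        (if ?\<pi> l = k then 0 + f \<bullet> z' else 0) (if ?\<pi> l = k then q else f $ ?\<pi> l)"
        using q by (auto simp: fixk mid_value_def sgn_match_def)
    qed (use zk in auto)
  qed
qed

lemma sign_realized_nonzero_shift:
  fixes z z' :: "real ^ 'n::finite"
  assumes z: "skew_shift k z" and z': "skew_shift k z'" and i: "0 < z' $ i"
  shows "sign_realized k z m p z'"
proof -
  consider "m < 0" | "m = 0" | "0 < m" by linarith
  then show ?thesis
  proof cases
    case 1
    then have "0 < - m" by simp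
    then have "sign_realized k z (- m) (- p) z'" by (rule sign_realized_pos[OF z z' i])
    then obtain m' p' \<pi> where *: "bij \<pi>" "\<And>l. sgn_match (mid_value k z (- m) (- p) l) ((- p) $ l)
        (mid_value k z' m' p' (\<pi> l)) (p' $ \<pi> l)"
      unfolding sign_realized_def by blast
    have neg: "mid_value k z (- m) (- p) l = - mid_value k z m p l"
      "mid_value k z' m' p' l = - mid_value k z' (- m') (- p') l" for l
      by (simp_all add: mid_value_def)
    have abs: "sgn_match c ((- p) $ l) d (p' $ l') \<longleftrightarrow> sgn_match c (p $ l) d ((- p') $ l')" for c d l l'
      by (simp add: sgn_match_def)
    have "sgn_match (mid_value k z m p l) (p $ l) (mid_value k z' (- m') (- p') (\<pi> l)) ((- p') $ \<pi> l)" for l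
      using *(2)[of l] unfolding neg abs sgn_match_uminus .
    then show ?thesis
      unfolding sign_realized_def using *(1) by blast
  next
    case 2
    then show ?thesis using sign_realized_zero[OF z z' i] by simp
  next
    case 3
    then show ?thesis using sign_realized_pos[OF z z' i] by simp
  qed
qed

lemma no_antipodal_image:
  assumes "bij \<pi>" "\<And>l \<sigma>. \<phi> (l, \<sigma>) = (\<pi> l, if fl l then \<not> \<sigma> else \<sigma>)"
  shows "no_antipodal (\<phi> ` A) \<longleftrightarrow> no_antipodal A"
proof -
  have inj: "\<pi> l = \<pi> l' \<longleftrightarrow> l = l'" for l l' using assms(1) by (metis bij_pointE)
  have mem: "(\<pi> l, \<tau>) \<in> \<phi> ` A \<longleftrightarrow> (l, if fl l then \<not> \<tau> else \<tau>) \<in> A" for l \<tau>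
    unfolding image_iff using assms(2) inj by (force simp: Bex_def)
  have "no_antipodal (\<phi> ` A) \<longleftrightarrow> (\<forall>l. \<not> ((\<pi> l, True) \<in> \<phi> ` A \<and> (\<pi> l, False) \<in> \<phi> ` A))"
    unfolding no_antipodal_def using assms(1) by (metis bij_pointE)
  also have "\<dots> \<longleftrightarrow> no_antipodal A"
    unfolding mem no_antipodal_def by auto
  finally show ?thesis .
qed

lemma slice_types_skew_cross_subset:
  assumes z: "skew_shift k z" and z': "skew_shift k z'" and i: "0 < z' $ i"
  shows "slice_types (skew_cross k z) \<subseteq> slice_types (skew_cross k z')"
proof
  fix T assume "T \<in> slice_types (skew_cross k z)"
  then obtain a b where ab: "a \<noteq> 0" "T = comb_type (skew_cross k z \<inter> {x. a \<bullet> x = b})"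
    unfolding slice_types_def affine_hyperplane_def by blast
  obtain m' p' \<pi> where \<pi>: "bij \<pi>" and match: "\<And>l. sgn_match (mid_value k z (- b) a l) (a $ l)
      (mid_value k z' m' p' (\<pi> l)) (p' $ \<pi> l)"
    using sign_realized_nonzero_shift[OF z z' i, of "- b" a] unfolding sign_realized_def by blast
  \<comment> \<open>\<open>sgn_match\<close> pairs the end with the larger value with the end with
    the larger value, so the ends are swapped when the two coefficients have different
    signs.\<close>
  define fl where "fl l \<longleftrightarrow> (0 \<le> a $ l) \<noteq> (0 \<le> p' $ \<pi> l)" for l
  define \<phi> where "\<phi> x = (\<pi> (fst x), if fl (fst x) then \<not> snd x else snd x)" for x :: "'a \<times> bool"
  have "inj \<phi>"
    using \<pi> unfolding inj_on_def \<phi>_def by (auto simp: bij_def inj_eq prod_eq_iff split: if_splits)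
  then have bij: "bij \<phi>" by (simp add: finite_UNIV_inj_surj bij_def)
  have "\<phi> ` A = UNIV \<longleftrightarrow> A = UNIV" for A
    using bij by (metis bij_def inj_image_eq_iff)
  moreover have "no_antipodal (\<phi> ` A) \<longleftrightarrow> no_antipodal A" for A
    using \<pi> by (rule no_antipodal_image[where fl = fl]) (simp add: \<phi>_def)
  ultimately have faces: "A \<in> idx_faces UNIV (skew_vert k z) \<longleftrightarrow> \<phi> ` A \<in> idx_faces UNIV (skew_vert k z')" for A
    by (simp add: skew_faces[OF z] skew_faces[OF z'])
  have val: "a \<bullet> skew_vert k z (l, \<sigma>) - b = mid_value k z (- b) a l + sg \<sigma> * a $ l"
    "p' \<bullet> skew_vert k z' (l, \<sigma>) - (- m') = mid_value k z' m' p' l + sg \<sigma> * p' $ l" for l \<sigma>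
    by (simp_all add: inner_skew_vert mid_value_def)
  have "sgn (a \<bullet> skew_vert k z (l, \<sigma>) - b) = sgn (p' \<bullet> skew_vert k z' (\<phi> (l, \<sigma>)) - (- m'))" for l \<sigma>
    using match[of l] unfolding \<phi>_def fst_conv snd_conv val sgn_match_def
    by (cases \<sigma>; cases "0 \<le> a $ l"; cases "0 \<le> p' $ \<pi> l") (simp_all add: fl_def)
  then have sgn: "sgn (a \<bullet> skew_vert k z x - b) = sgn (p' \<bullet> skew_vert k z' (\<phi> x) - (- m'))" for x
    by (cases x) simp
  have full: "full_dim_polytope (convex hull (skew_vert k z ` UNIV))"
    using full_dim_skew_cross unfolding skew_cross_def .
  show "T \<in> slice_types (skew_cross k z')"
    unfolding ab(2) skew_cross_def
    by (rule slice_types_transfer[OF _ _ full bij faces ab(1) sgn]) auto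
qed

subsection \<open>Dependencies with four vertices\<close>

definition affine_dep :: "('i::finite \<Rightarrow> 'a::real_vector) \<Rightarrow> ('i \<Rightarrow> real) \<Rightarrow> bool" where
  "affine_dep v c \<longleftrightarrow> (\<Sum>x\<in>UNIV. c x) = 0 \<and> (\<Sum>x\<in>UNIV. c x *\<^sub>R v x) = 0"

text \<open>Each position lies in the support of a vector with exactly four nonzero entries. Being
  stated for sign lists alone, this passes between equal oriented matroids; \<open>X\<close> only
  supplies the common length.\<close>

definition covered_by_quadruples :: "real list set \<Rightarrow> bool" where
  "covered_by_quadruples S \<longleftrightarrow> (\<forall>X\<in>S. \<forall>t<length X. \<exists>Y\<in>S.
     card {s. s < length X \<and> Y ! s \<noteq> 0} = 4 \<and> Y ! t \<noteq> 0)"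

text \<open>The bijection \<open>e\<close> from list positions to vertex indices turns coefficient
  lists into coefficient functions, which removes the ordering of the vertices.\<close>

lemma covered_by_quadruples_OM_points:
  fixes v :: "'i::finite \<Rightarrow> 'a::euclidean_space"
  assumes vs: "vertex_ordering P vs" and v: "{x. x extreme_point_of P} = range v" "inj v"
  shows "covered_by_quadruples (OM_points vs) \<longleftrightarrow>
    (\<forall>x. \<exists>c. affine_dep v c \<and> card {y. c y \<noteq> 0} = 4 \<and> c x \<noteq> 0)"
proof -
  let ?n = "length vs"
  define e where "e t = inv v (vs ! t)" for t
  have nth: "bij_betw ((!) vs) {..<?n} (range v)"
    using vs v(1) by (intro bij_betw_nth) (auto simp: vertex_ordering_def)
  have "bij_betw (inv v) (range v) UNIV"
    using v(2) by (simp add: bij_betw_inv_into inj_imp_bij_betw_inv)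
  then have e: "bij_betw e {..<?n} UNIV"
    unfolding e_def using nth bij_betw_trans[of "(!) vs" _ _ "inv v"] by (simp add: comp_def)
  have ve: "v (e t) = vs ! t" if "t < ?n" for t
    using that nth unfolding e_def bij_betw_def by (intro f_inv_into_f) blast
  have dep: "affine_dep v c \<longleftrightarrow> (\<Sum>t<?n. c (e t)) = 0 \<and> (\<Sum>t<?n. c (e t) *\<^sub>R vs ! t) = 0" for c
    unfolding affine_dep_def sum.reindex_bij_betw[OF e, symmetric] using ve by simp
  have supp: "card {s. s < ?n \<and> c (e s) \<noteq> 0} = card {y. c y \<noteq> (0::real)}" for c
  proof -
    have "bij_betw e {s. s < ?n \<and> c (e s) \<noteq> 0} {y. c y \<noteq> 0}"
      using e by (auto simp: bij_betw_def inj_on_def)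
    then show ?thesis by (rule bij_betw_same_card)
  qed
  have OM: "OM_points vs = {map (\<lambda>t. sgn (c (e t))) [0..<?n] | c. affine_dep v c}"
  proof
    show "{map (\<lambda>t. sgn (c (e t))) [0..<?n] | c. affine_dep v c} \<subseteq> OM_points vs"
    proof
      fix X assume "X \<in> {map (\<lambda>t. sgn (c (e t))) [0..<?n] | c. affine_dep v c}"
      then obtain c where c: "X = map (\<lambda>t. sgn (c (e t))) [0..<?n]" "affine_dep v c" by blast
      show "X \<in> OM_points vs"
        unfolding OM_points_def
        using c(2) by (intro CollectI exI[of _ "map (\<lambda>t. c (e t)) [0..<?n]"]) (simp add: c(1) dep)
    qed
    show "OM_points vs \<subseteq> {map (\<lambda>t. sgn (c (e t))) [0..<?n] | c. affine_dep v c}"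
    proof
      fix X assume "X \<in> OM_points vs"
      then obtain d where d: "X = map sgn d" "length d = ?n" "(\<Sum>t<?n. d ! t) = 0"
          "(\<Sum>t<?n. d ! t *\<^sub>R vs ! t) = 0"
        unfolding OM_points_def by blast
      define c where "c x = d ! inv_into {..<?n} e x" for x
      have ce: "c (e t) = d ! t" if "t < ?n" for t
        using e that by (simp add: c_def bij_betw_def)
      have "X = map (\<lambda>t. sgn (c (e t))) [0..<?n]"
        using d(1,2) ce by (intro nth_equalityI) auto
      moreover have "affine_dep v c"
        unfolding dep using d(3,4) ce by simp
      ultimately show "X \<in> {map (\<lambda>t. sgn (c (e t))) [0..<?n] | c. affine_dep v c}" by blast
    qed
  qed
  have card: "card {s. s < ?n \<and> map (\<lambda>t. sgn (c (e t))) [0..<?n] ! s \<noteq> 0} = card {y. c y \<noteq> (0::real)}" for c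
  proof -
    have "{s. s < ?n \<and> map (\<lambda>t. sgn (c (e t))) [0..<?n] ! s \<noteq> 0} = {s. s < ?n \<and> c (e s) \<noteq> 0}"
      by (auto simp: sgn_zero_iff)
    then show ?thesis using supp by simp
  qed
  have "covered_by_quadruples (OM_points vs) \<longleftrightarrow>
      (\<forall>t<?n. \<exists>c. affine_dep v c \<and> card {y. c y \<noteq> 0} = 4 \<and> c (e t) \<noteq> 0)"
  proof
    assume cov: "covered_by_quadruples (OM_points vs)"
    show "\<forall>t<?n. \<exists>c. affine_dep v c \<and> card {y. c y \<noteq> 0} = 4 \<and> c (e t) \<noteq> 0"
    proof (intro allI impI)
      fix t assume t: "t < ?n"
      obtain X where X: "X \<in> OM_points vs" using OM_points_nonempty by blast
      then have len: "length X = ?n" using OM_points_signs by blast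
      have "\<exists>Y\<in>OM_points vs. card {s. s < ?n \<and> Y ! s \<noteq> 0} = 4 \<and> Y ! t \<noteq> 0"
        using cov X t unfolding covered_by_quadruples_def len[symmetric] by blast
      then obtain Y where Y: "Y \<in> OM_points vs" "card {s. s < ?n \<and> Y ! s \<noteq> 0} = 4" "Y ! t \<noteq> 0"
        by blast
      then obtain c where c: "Y = map (\<lambda>t. sgn (c (e t))) [0..<?n]" "affine_dep v c"
        unfolding OM by blast
      have "c (e t) \<noteq> 0" using Y(3) t by (simp add: c(1) sgn_zero_iff)
      then show "\<exists>c. affine_dep v c \<and> card {y. c y \<noteq> 0} = 4 \<and> c (e t) \<noteq> 0"
        using c(2) Y(2) unfolding c(1) card by blast
    qed
  next
    assume R: "\<forall>t<?n. \<exists>c. affine_dep v c \<and> card {y. c y \<noteq> 0} = 4 \<and> c (e t) \<noteq> 0"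
    show "covered_by_quadruples (OM_points vs)"
      unfolding covered_by_quadruples_def
    proof (intro ballI allI impI)
      fix X t assume X: "X \<in> OM_points vs" "t < length X"
      then have len: "length X = ?n" using OM_points_signs by blast
      then obtain c where c: "affine_dep v c" "card {y. c y \<noteq> 0} = 4" "c (e t) \<noteq> 0"
        using R X(2) by auto
      show "\<exists>Y\<in>OM_points vs. card {s. s < length X \<and> Y ! s \<noteq> 0} = 4 \<and> Y ! t \<noteq> 0"
      proof (intro bexI conjI)
        show "map (\<lambda>t. sgn (c (e t))) [0..<?n] \<in> OM_points vs" unfolding OM using c(1) by blast
        show "card {s. s < length X \<and> map (\<lambda>t. sgn (c (e t))) [0..<?n] ! s \<noteq> 0} = 4"
          unfolding len card by (rule c(2))
        show "map (\<lambda>t. sgn (c (e t))) [0..<?n] ! t \<noteq> 0"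
          using c(3) X(2) len by (simp add: sgn_zero_iff)
      qed
    qed
  qed
  also have "\<dots> \<longleftrightarrow> (\<forall>x. \<exists>c. affine_dep v c \<and> card {y. c y \<noteq> 0} = 4 \<and> c x \<noteq> 0)"
    (is "(\<forall>t<?n. ?Q (e t)) \<longleftrightarrow> (\<forall>x. ?Q x)")
  proof (intro iffI allI impI)
    fix x assume *: "\<forall>t<?n. ?Q (e t)"
    obtain t where "t < ?n" "x = e t" using e unfolding bij_betw_def by blast
    then show "?Q x" using * by blast
  qed blast
  finally show ?thesis .
qed

lemma same_OM_quadruples:
  fixes v w :: "'i::finite \<Rightarrow> 'a::euclidean_space"
  assumes "same_OM P Q" "{x. x extreme_point_of P} = range v" "inj v"
    "{x. x extreme_point_of Q} = range w" "inj w"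
  shows "(\<forall>x. \<exists>c. affine_dep v c \<and> card {y. c y \<noteq> 0} = 4 \<and> c x \<noteq> 0) \<longleftrightarrow>
    (\<forall>x. \<exists>c. affine_dep w c \<and> card {y. c y \<noteq> 0} = 4 \<and> c x \<noteq> 0)"
proof -
  obtain vs ws where o: "vertex_ordering P vs" "vertex_ordering Q ws" "OM_points vs = OM_points ws"
    using assms(1) unfolding same_OM_def by blast
  show ?thesis
    using covered_by_quadruples_OM_points[OF o(1) assms(2,3)]
      covered_by_quadruples_OM_points[OF o(2) assms(4,5)] unfolding o(3) by simp
qed

lemma sum_pairs: "(\<Sum>x\<in>UNIV. f x) = (\<Sum>l\<in>UNIV. f (l, True) + f (l, False))"
  for f :: "'n::finite \<times> bool \<Rightarrow> 'b::comm_monoid_add"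
proof -
  have "(\<Sum>x\<in>UNIV. f x) = (\<Sum>l\<in>UNIV. \<Sum>\<sigma>\<in>UNIV. f (l, \<sigma>))"
    by (simp add: sum.cartesian_product case_prod_unfold flip: UNIV_Times_UNIV)
  then show ?thesis by (simp add: UNIV_bool add.commute)
qed

lemma affine_dep_skew_vert:
  "affine_dep (skew_vert k z) c \<longleftrightarrow> (\<Sum>l\<in>UNIV. c (l, True) + c (l, False)) = 0 \<and>
    (\<forall>l. (c (k, True) + c (k, False)) * z $ l + (c (l, True) - c (l, False)) = 0)"
proof -
  have "(\<Sum>x\<in>UNIV. c x *\<^sub>R skew_vert k z x) $ l =
      (c (k, True) + c (k, False)) * z $ l + (c (l, True) - c (l, False))" for l
  proof -
    have "(\<Sum>x\<in>UNIV. c x *\<^sub>R skew_vert k z x) $ l =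
        (\<Sum>i\<in>UNIV. (if i = k then (c (i, True) + c (i, False)) * z $ l else 0) +
          (if i = l then c (i, True) - c (i, False) else 0))"
      unfolding sum_pairs sum_component
      by (intro sum.cong) (auto simp: skew_vert_def axis_def algebra_simps)
    then show ?thesis by (simp add: sum.distrib)
  qed
  then show ?thesis unfolding affine_dep_def by (simp add: vec_eq_iff sum_pairs)
qed

lemma quadruple_support:
  fixes c :: "'n \<times> bool \<Rightarrow> real"
  assumes "l \<noteq> i" "\<And>x. c x \<noteq> 0 \<longleftrightarrow> fst x = l \<or> fst x = i"
  shows "card {y. c y \<noteq> 0} = 4"
proof -
  have "{y. c y \<noteq> 0} = {(l, True), (l, False), (i, True), (i, False)}"
  proof -
    have "x \<in> {y. c y \<noteq> 0} \<longleftrightarrow> x \<in> {(l, True), (l, False), (i, True), (i, False)}" for x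
      using assms(2)[of x] by (cases x; cases "snd x") auto
    then show ?thesis by blast
  qed
  then show ?thesis using assms(1) by simp
qed

lemma skew_axis_quadruples:
  fixes i k :: "'n::finite"
  assumes ik: "i \<noteq> k"
  shows "\<exists>c. affine_dep (skew_vert k (axis i (1/4))) c \<and> card {y. c y \<noteq> 0} = 4 \<and> c x \<noteq> 0"
proof -
  have *: "\<exists>c. affine_dep (skew_vert k (axis i (1/4))) c \<and> card {y. c y \<noteq> 0} = 4 \<and>
      (\<forall>x. c x \<noteq> 0 \<longleftrightarrow> fst x = l \<or> fst x = i)" if l: "l \<noteq> i" for l
  proof -
    \<comment> \<open>Diagonals \<open>l\<close> and \<open>i\<close> meet, and the dependency
      equates two expressions of twice their common point. For \<open>l = k\<close> that point is
      \<open>axis i (1/4)\<close>, which is 5/8 of one end of diagonal \<open>i\<close> plus 3/8 of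
      the other; otherwise it is the origin.\<close>
    define c where "c x = (if fst x = l then 1 else if fst x \<noteq> i then 0
        else if l \<noteq> k then -1 else if snd x then -5/4 else -3/(4::real))" for x
    have supp: "c x \<noteq> 0 \<longleftrightarrow> fst x = l \<or> fst x = i" for x
      by (auto simp: c_def)
    have "(\<Sum>m\<in>UNIV. c (m, True) + c (m, False)) =
        (\<Sum>m\<in>UNIV. (if m = l then 2 else 0) + (if m = i then -2 else 0))"
      using l by (intro sum.cong) (auto simp: c_def)
    then have "(\<Sum>m\<in>UNIV. c (m, True) + c (m, False)) = 0"
      by (simp add: sum.distrib)
    moreover have "(c (k, True) + c (k, False)) * axis i (1/4) $ m + (c (m, True) - c (m, False)) = 0" for m
      using l ik by (auto simp: c_def axis_def)
    ultimately have "affine_dep (skew_vert k (axis i (1/4))) c"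
      by (simp add: affine_dep_skew_vert)
    then show ?thesis using quadruple_support[OF l supp] supp by blast
  qed
  show ?thesis
  proof (cases "fst x = i")
    case True
    then show ?thesis using *[of k] ik by blast
  next
    case False
    then show ?thesis using *[of "fst x"] by blast
  qed
qed

text \<open>Coordinate \<open>k\<close> forces equal weights w at both ends of diagonal
  \<open>k\<close>, and coordinates \<open>i\<close> and \<open>j\<close> force a nonzero weight on
  each of their diagonals. This exhausts the four elements, so the latter weights are w/2 up to
  sign, and the total cannot vanish.\<close>

lemma skew_two_axes_no_quadruple:
  fixes i j k :: "'n::finite"
  assumes ij: "i \<noteq> j" "i \<noteq> k" "j \<noteq> k"
    and c: "affine_dep (skew_vert k (axis i (1/4) + axis j (1/4))) c" "card {y. c y \<noteq> 0} = 4"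
  shows "c (k, True) = 0"
proof (rule ccontr)
  assume w: "c (k, True) \<noteq> 0"
  have comp: "(c (k, True) + c (k, False)) * (axis i (1/4) + axis j (1/4)) $ l + (c (l, True) - c (l, False)) = 0"
    and sum: "(\<Sum>l\<in>UNIV. c (l, True) + c (l, False)) = 0" for l
    using c(1) unfolding affine_dep_skew_vert by blast+
  have kF: "c (k, False) = c (k, True)" using comp[of k] ij by (simp add: axis_def)
  have ci: "c (i, True) - c (i, False) = - c (k, True) / 2"
    using comp[of i] ij kF by (simp add: axis_def)
  have cj: "c (j, True) - c (j, False) = - c (k, True) / 2"
    using comp[of j] ij kF by (simp add: axis_def)
  obtain \<sigma> where \<sigma>: "c (i, \<sigma>) \<noteq> 0" using ci w by (metis diff_0_right divide_eq_0_iff neg_equal_0_iff_equal zero_neq_numeral)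
  obtain \<tau> where \<tau>: "c (j, \<tau>) \<noteq> 0" using cj w by (metis diff_0_right divide_eq_0_iff neg_equal_0_iff_equal zero_neq_numeral)
  let ?S = "{(k, True), (k, False), (i, \<sigma>), (j, \<tau>)}"
  have card4: "card ?S = 4" using ij by simp
  have "?S \<subseteq> {y. c y \<noteq> 0}" using w kF \<sigma> \<tau> by auto
  then have S: "{y. c y \<noteq> 0} = ?S"
    using card4 c(2) by (metis card_subset_eq finite)
  have off: "c (i, \<not> \<sigma>) = 0" "c (j, \<not> \<tau>) = 0"
  proof -
    have "(i, \<not> \<sigma>) \<notin> ?S" "(j, \<not> \<tau>) \<notin> ?S" using ij by auto
    then show "c (i, \<not> \<sigma>) = 0" "c (j, \<not> \<tau>) = 0" unfolding S[symmetric] by auto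
  qed
  have "c x = 0" if "x \<notin> ?S" for x
    using that unfolding S[symmetric] by simp
  then have UNIV_S: "(\<Sum>x\<in>UNIV. c x) = (\<Sum>x\<in>?S. c x)"
    by (intro sum.mono_neutral_right) auto
  have "(\<Sum>x\<in>?S. c x) = c (k, True) + c (k, False) + c (i, \<sigma>) + c (j, \<tau>)"
    using ij by (simp add: add.assoc)
  then have "2 * c (k, True) + c (i, \<sigma>) + c (j, \<tau>) = 0"
    using sum kF UNIV_S unfolding sum_pairs by linarith
  moreover have "2 * c (i, \<sigma>) = c (k, True) \<or> 2 * c (i, \<sigma>) = - c (k, True)"
    using off(1) ci by (cases \<sigma>) auto
  moreover have "2 * c (j, \<tau>) = c (k, True) \<or> 2 * c (j, \<tau>) = - c (k, True)"
    using off(2) cj by (cases \<tau>) auto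
  ultimately show False using w by linarith
qed

lemma skew_shift_axis: "i \<noteq> k \<Longrightarrow> skew_shift k (axis i (1/4))"
  by (auto simp: skew_shift_def axis_def)

lemma skew_shift_two_axes:
  "i \<noteq> k \<Longrightarrow> j \<noteq> k \<Longrightarrow> skew_shift k (axis i (1/4) + axis j (1/4))"
  by (auto simp: skew_shift_def axis_def sum.distrib)

lemma skew_shift_0: "skew_shift k 0"
  by (simp add: skew_shift_def)

lemma three_distinct:
  assumes "3 \<le> CARD('n)"
  obtains i j k :: "'n::finite" where "i \<noteq> j" "i \<noteq> k" "j \<noteq> k"
proof -
  obtain S :: "'n set" where "card S = 3"
    using obtain_subset_with_card_n[OF assms] by metis
  then show ?thesis using that by (auto simp: card_3_iff)
qed

lemma setwise_slice_equiv_not_imp_same_OM: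
  assumes "3 \<le> CARD('n)"
  shows "\<exists>P Q :: (real ^ 'n::finite) set. full_dim_polytope P \<and> full_dim_polytope Q \<and>
    setwise_slice_equiv P Q \<and> \<not> same_OM P Q"
proof -
  obtain i j k :: 'n where ij: "i \<noteq> j" "i \<noteq> k" "j \<noteq> k" using three_distinct[OF assms] .
  let ?z = "axis i (1/4) :: real ^ 'n" and ?z' = "axis i (1/4) + axis j (1/4) :: real ^ 'n"
  have sh: "skew_shift k ?z" "skew_shift k ?z'"
    using ij by (auto intro: skew_shift_axis skew_shift_two_axes)
  have "0 < ?z $ i" "0 < ?z' $ i" using ij by (auto simp: axis_def)
  then have "setwise_slice_equiv (skew_cross k ?z) (skew_cross k ?z')"
    unfolding setwise_slice_equiv_def using sh slice_types_skew_cross_subset by (metis subset_antisym)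
  moreover have "\<not> same_OM (skew_cross k ?z) (skew_cross k ?z')"
  proof
    assume "same_OM (skew_cross k ?z) (skew_cross k ?z')"
    then have "(\<forall>x. \<exists>c. affine_dep (skew_vert k ?z) c \<and> card {y. c y \<noteq> 0} = 4 \<and> c x \<noteq> 0) \<longleftrightarrow>
        (\<forall>x. \<exists>c. affine_dep (skew_vert k ?z') c \<and> card {y. c y \<noteq> 0} = 4 \<and> c x \<noteq> 0)"
      using sh skew_cross_vertices by (intro same_OM_quadruples) auto
    then obtain c where "affine_dep (skew_vert k ?z') c" "card {y. c y \<noteq> 0} = 4" "c (k, True) \<noteq> 0"
      using skew_axis_quadruples[OF ij(2)] by blast
    then show False using skew_two_axes_no_quadruple[OF ij] by blast
  qed
  ultimately show ?thesis using full_dim_skew_cross by blast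
qed

subsection \<open>Counting the facets of slices\<close>

text \<open>The two supersets counted are \<open>A\<close> and one more, in a face lattice the top;
  in dimension at least 1 these are the facets. Counting supersets makes the notion invariant under
  order isomorphisms.\<close>

definition coatoms :: "'a set set \<Rightarrow> 'a set set" where
  "coatoms \<F> = {A \<in> \<F>. card {B \<in> \<F>. A \<subseteq> B} = 2}"

lemma image_coatoms:
  assumes f: "bij_betw f \<F> \<G>" "\<forall>A\<in>\<F>. \<forall>B\<in>\<F>. A \<subseteq> B \<longleftrightarrow> f A \<subseteq> f B"
  shows "f ` coatoms \<F> = coatoms \<G>"
proof
  have img: "f ` {B \<in> \<F>. A \<subseteq> B} = {B \<in> \<G>. f A \<subseteq> B}" if "A \<in> \<F>" for A
    using f that unfolding bij_betw_def by blast
  have eq: "card {B \<in> \<F>. A \<subseteq> B} = card {B \<in> \<G>. f A \<subseteq> B}" if "A \<in> \<F>" for A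
  proof -
    have "inj_on f {B \<in> \<F>. A \<subseteq> B}"
      using f(1) by (auto simp: bij_betw_def intro: inj_on_subset)
    then show ?thesis using card_image[of f "{B \<in> \<F>. A \<subseteq> B}"] img[OF that] by simp
  qed
  show "f ` coatoms \<F> \<subseteq> coatoms \<G>"
  proof
    fix B assume "B \<in> f ` coatoms \<F>"
    then obtain A where A: "A \<in> \<F>" "card {C \<in> \<F>. A \<subseteq> C} = 2" "B = f A"
      unfolding coatoms_def by blast
    have "f A \<in> \<G>" using A(1) f(1) by (auto simp: bij_betw_def)
    then show "B \<in> coatoms \<G>"
      using A(2) unfolding coatoms_def eq[OF A(1)] A(3) by simp
  qed
  show "coatoms \<G> \<subseteq> f ` coatoms \<F>"
  proof
    fix B assume B: "B \<in> coatoms \<G>"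
    then obtain A where A: "A \<in> \<F>" "B = f A"
      using f(1) by (auto simp: coatoms_def bij_betw_def)
    have "card {C \<in> \<F>. A \<subseteq> C} = 2"
      using B unfolding eq[OF A(1)] A(2) coatoms_def by blast
    then show "B \<in> f ` coatoms \<F>" using A by (simp add: coatoms_def)
  qed
qed

lemma card_coatoms_order_iso:
  assumes "order_iso \<F> \<G>"
  shows "card (coatoms \<F>) = card (coatoms \<G>)"
proof -
  obtain f where f: "bij_betw f \<F> \<G>" "\<forall>A\<in>\<F>. \<forall>B\<in>\<F>. A \<subseteq> B \<longleftrightarrow> f A \<subseteq> f B"
    using assms unfolding order_iso_def by blast
  have "inj_on f (coatoms \<F>)"
    using f(1) by (auto simp: bij_betw_def coatoms_def intro: inj_on_subset)
  then show ?thesis using image_coatoms[OF f] card_image[of f "coatoms \<F>"] by simp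
qed

text \<open>These are the vertex sets of the facets of a cross-polytope: one end of each
  diagonal.\<close>

definition transversal :: "('n \<Rightarrow> bool) \<Rightarrow> ('n \<times> bool) set" where
  "transversal s = {(l, s l) | l. True}"

lemma mem_transversal: "(l, \<sigma>) \<in> transversal s \<longleftrightarrow> \<sigma> = s l"
  by (auto simp: transversal_def)

lemma inj_transversal: "inj transversal"
  by (rule injI, rule ext) (metis mem_transversal)

lemma no_antipodal_transversal: "no_antipodal (transversal s)"
  by (auto simp: no_antipodal_def mem_transversal)

lemma no_antipodal_subset: "no_antipodal B \<Longrightarrow> A \<subseteq> B \<Longrightarrow> no_antipodal A"
  by (auto simp: no_antipodal_def)

lemma no_antipodal_extend:
  assumes "no_antipodal A"
  shows "A \<subseteq> transversal (\<lambda>l. (l, True) \<in> A)"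
proof
  fix x assume x: "x \<in> A"
  obtain l \<sigma> where l: "x = (l, \<sigma>)" by (cases x)
  have "\<sigma> \<longleftrightarrow> (l, True) \<in> A"
    using assms x unfolding l no_antipodal_def by (cases \<sigma>) auto
  then show "x \<in> transversal (\<lambda>l. (l, True) \<in> A)" by (simp add: l mem_transversal)
qed

lemma transversal_maximal:
  assumes "no_antipodal B" "transversal s \<subseteq> B"
  shows "B = transversal s"
proof
  show "B \<subseteq> transversal s"
  proof
    fix x assume x: "x \<in> B"
    obtain l \<sigma> where l: "x = (l, \<sigma>)" by (cases x)
    have "(l, s l) \<in> B" using assms(2) by (auto simp: mem_transversal)
    then have "\<sigma> = s l" using assms(1) x l unfolding no_antipodal_def by (metis (full_types))
    then show "x \<in> transversal s" using l by (simp add: mem_transversal)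
  qed
qed (rule assms(2))

lemma not_no_antipodal_UNIV: "\<not> no_antipodal UNIV"
  by (simp add: no_antipodal_def)

lemma skew_slice_all_facets:
  fixes k :: "'n::finite"
  assumes z: "skew_shift k z" and cross: "\<And>s. crossing h (transversal s)"
  shows "CARD('n \<Rightarrow> bool) \<le> card (coatoms (slice_idx UNIV (skew_vert k z) h))"
proof -
  let ?\<S> = "slice_idx UNIV (skew_vert k z) h"
  have "transversal s \<in> coatoms ?\<S>" for s
  proof -
    \<comment> \<open>Every vertex off the hyperplane lies in some transversal, and that transversal
      has vertices on both sides.\<close>
    have "crossing h UNIV"
    proof (cases "\<forall>x. h x = 0")
      case False
      then obtain l \<sigma> where l: "h (l, \<sigma>) \<noteq> 0" by auto
      have "(l, \<sigma>) \<in> transversal (\<lambda>_. \<sigma>)" by (simp add: mem_transversal)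
      then show ?thesis using cross[of "\<lambda>_. \<sigma>"] l unfolding crossing_def by blast
    qed (simp add: crossing_def)
    then have "{B \<in> ?\<S>. transversal s \<subseteq> B} = {transversal s, UNIV}"
      using transversal_maximal cross by (auto simp: slice_idx_def skew_faces[OF z] no_antipodal_transversal)
    moreover have "transversal s \<noteq> UNIV"
      using no_antipodal_transversal not_no_antipodal_UNIV by metis
    ultimately have "card {B \<in> ?\<S>. transversal s \<subseteq> B} = 2" by simp
    then show ?thesis
      using cross by (simp add: coatoms_def slice_idx_def skew_faces[OF z] no_antipodal_transversal)
  qed
  then have "transversal ` UNIV \<subseteq> coatoms ?\<S>" by blast
  then have "card (transversal ` (UNIV :: ('n \<Rightarrow> bool) set)) \<le> card (coatoms ?\<S>)"
    by (rule card_mono[rotated]) simp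
  then show ?thesis by (simp add: card_image inj_transversal)
qed

text \<open>A facet of the slice comes from a transversal or from the zero set of one. Since the values on
  opposite transversals are symmetric about \<open>m\<close>, some transversal gives the empty set (if \<open>m \<noteq> 0\<close>)
  or the same zero set as another one (if \<open>m = 0\<close>).\<close>

lemma regular_slice_few_facets:
  fixes k :: "'n::finite"
  assumes a: "a \<noteq> 0" and h: "\<And>l \<sigma>. h (l, \<sigma>) = m + sg \<sigma> * a $ l"
  shows "card (coatoms (slice_idx UNIV (skew_vert k 0) h)) < CARD('n \<Rightarrow> bool)"
proof -
  let ?\<S> = "slice_idx UNIV (skew_vert k 0) h"
  have S: "A \<in> ?\<S> \<longleftrightarrow> (A = UNIV \<or> no_antipodal A) \<and> crossing h A" for A
    by (simp add: slice_idx_def skew_faces[OF skew_shift_0])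
  obtain l0 where l0: "a $ l0 \<noteq> 0" using a by (auto simp: vec_eq_iff)
  have nz: "h (l0, True) \<noteq> h (l0, False)" using l0 by (simp add: h)
  have large: "CARD('n) < CARD('n \<Rightarrow> bool)" by (simp add: card_fun)
  have coatD: "A \<subseteq> B \<Longrightarrow> B \<in> ?\<S> \<Longrightarrow> B = A \<or> (\<forall>C\<in>?\<S>. A \<subseteq> C \<longrightarrow> C = A \<or> C = B)"
    if "A \<in> coatoms ?\<S>" for A B
  proof -
    assume AB: "A \<subseteq> B" "B \<in> ?\<S>"
    show "B = A \<or> (\<forall>C\<in>?\<S>. A \<subseteq> C \<longrightarrow> C = A \<or> C = B)"
    proof (cases "B = A")
      case False
      have "{A, B} \<subseteq> {C \<in> ?\<S>. A \<subseteq> C}" "card {C \<in> ?\<S>. A \<subseteq> C} = 2"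
        using AB that by (auto simp: coatoms_def)
      then have "{A, B} = {C \<in> ?\<S>. A \<subseteq> C}"
        using False by (intro card_subset_eq) auto
      then show ?thesis by blast
    qed simp
  qed
  show ?thesis
  proof (cases "UNIV \<in> ?\<S>")
    \<comment> \<open>The hyperplane has no vertices strictly on both sides, so the slice is a
      proper face: a simplex with vertex set \<open>Z\<close>. It has at most as many facets as
      there are coordinates.\<close>
    case False
    define Z where "Z = {x. h x = 0}"
    have one_sided: "\<not> (\<exists>x y. h x < 0 \<and> 0 < h y)" using False by (auto simp: S crossing_def)
    have "no_antipodal Z"
    proof (rule ccontr)
      assume "\<not> no_antipodal Z"
      then obtain l where l: "h (l, True) = 0" "h (l, False) = 0"
        by (auto simp: no_antipodal_def Z_def)
      then have "m = 0" by (simp add: h)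
      then have "h (l0, True) = - h (l0, False)" by (simp add: h)
      then show False using one_sided nz
        by (metis linorder_neqE_linordered_idom neg_0_less_iff_less neg_less_0_iff_less)
    qed
    then have Zc: "card Z \<le> CARD('n)"
    proof -
      have "Z \<subseteq> (\<lambda>l. (l, (l, True) \<in> Z)) ` UNIV"
        using no_antipodal_extend[OF \<open>no_antipodal Z\<close>] by (auto simp: transversal_def)
      then have "card Z \<le> card ((\<lambda>l. (l, (l, True) \<in> Z)) ` (UNIV :: 'n set))"
        by (intro card_mono) auto
      also have "\<dots> \<le> CARD('n)" by (rule card_image_le) simp
      finally show ?thesis .
    qed
    have SZ: "A \<in> ?\<S> \<longleftrightarrow> A \<subseteq> Z" for A
      using one_sided False \<open>no_antipodal Z\<close> no_antipodal_subset
      by (auto simp: S crossing_def Z_def)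
    have "coatoms ?\<S> \<subseteq> (\<lambda>x. Z - {x}) ` Z"
    proof
      fix A assume A: "A \<in> coatoms ?\<S>"
      have AZ: "A \<subseteq> Z" using A SZ by (auto simp: coatoms_def)
      have "A \<noteq> Z"
      proof
        assume "A = Z"
        then have "{B \<in> ?\<S>. A \<subseteq> B} = {Z}" using SZ by auto
        then show False using A by (auto simp: coatoms_def)
      qed
      then obtain x where x: "x \<in> Z" "x \<notin> A" using AZ by blast
      then have "insert x A \<in> ?\<S>" "Z \<in> ?\<S>" using AZ SZ by auto
      then have "Z = insert x A" using coatD[OF A, of "insert x A"] AZ \<open>A \<noteq> Z\<close> x by blast
      then show "A \<in> (\<lambda>x. Z - {x}) ` Z" using x by blast
    qed
    then have "card (coatoms ?\<S>) \<le> card ((\<lambda>x. Z - {x}) ` Z)" by (intro card_mono) auto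
    also have "\<dots> \<le> card Z" by (rule card_image_le) simp
    finally show ?thesis using Zc large by linarith
  next
    case True
    \<comment> \<open>The vertex set of the face of the slice that facet \<open>s\<close>
      contributes: the whole transversal if it is cut inside, else its part on the
      hyperplane.\<close>
    define g where "g s = (if crossing h (transversal s) then transversal s else {x \<in> transversal s. h x = 0})" for s
    have g: "A \<in> g ` UNIV \<and> (A = {} \<or> {} \<notin> coatoms ?\<S>)" if A: "A \<in> coatoms ?\<S>" for A
    proof
      have A\<S>: "A \<in> ?\<S>" using A by (simp add: coatoms_def)
      have AU: "A \<noteq> UNIV"
      proof
        assume "A = UNIV"
        then have "{B \<in> ?\<S>. A \<subseteq> B} = {UNIV}" using True by auto
        then show False using A by (auto simp: coatoms_def)
      qed
      then have nA: "no_antipodal A" using A\<S> S by blast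
      define s where "s l \<longleftrightarrow> (l, True) \<in> A" for l
      have sub: "A \<subseteq> transversal s" using no_antipodal_extend[OF nA] by (simp add: s_def[abs_def])
      have TU: "transversal s \<noteq> UNIV"
        using no_antipodal_transversal not_no_antipodal_UNIV by metis
      have max: "B = A" if "A \<subseteq> B" "B \<in> ?\<S>" "B \<noteq> UNIV" for B
        using coatD[OF A that(1,2)] True AU that(3) by blast
      show "A \<in> g ` UNIV"
      proof (cases "crossing h (transversal s)")
        case True
        then have "transversal s = A" using max sub TU S no_antipodal_transversal by blast
        then show ?thesis using True g_def by (metis rangeI)
      next
        case False
        have "\<forall>x\<in>A. h x = 0"
          using A\<S> False sub unfolding S crossing_def by blast
        then have "A \<subseteq> g s" using sub False by (auto simp: g_def)
        moreover have "g s \<in> ?\<S>" "g s \<noteq> UNIV"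
          using False no_antipodal_subset[OF no_antipodal_transversal, of "g s" s] TU
          by (auto simp: S g_def crossing_def)
        ultimately show ?thesis using max by blast
      qed
      show "A = {} \<or> {} \<notin> coatoms ?\<S>"
        using coatD[of "{}" A] A\<S> AU True by blast
    qed
    have coat_g: "coatoms ?\<S> \<subseteq> range g" using g by blast
    \<comment> \<open>The second alternative covers a slice that is a single point, where the empty
      face is the only coatom.\<close>
    have "\<exists>s. coatoms ?\<S> \<subseteq> g ` (UNIV - {s}) \<or> coatoms ?\<S> \<subseteq> {{}}"
    proof (cases "m = 0")
      case True
      define s where "s l \<longleftrightarrow> 0 \<le> a $ l" for l
      define s' where "s' l \<longleftrightarrow> a $ l \<le> 0" for l
      have hs: "h (l, s l) = \<bar>a $ l\<bar>" "h (l, s' l) = - \<bar>a $ l\<bar>" for l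
        using True by (auto simp: h s_def s'_def sg_def)
      have "\<not> crossing h (transversal s)" "\<not> crossing h (transversal s')"
        using l0 hs by (auto simp: crossing_def transversal_def)
      moreover have "{x \<in> transversal s. h x = 0} = {x \<in> transversal s'. h x = 0}"
        using hs by (auto simp: transversal_def s_def s'_def)
      ultimately have "g s = g s'" by (simp add: g_def)
      have "s l0 \<noteq> s' l0" using l0 by (auto simp: s_def s'_def)
      then have "s' \<in> UNIV - {s}" by auto
      then have "g t \<in> g ` (UNIV - {s})" for t
        using \<open>g s = g s'\<close> by (cases "t = s") auto
      then show ?thesis using coat_g by (intro exI[of _ s] disjI1) blast
    next
      case False
      define s where "s l \<longleftrightarrow> (0 < m \<longleftrightarrow> 0 \<le> a $ l)" for l
      have hs: "if 0 < m then 0 < h (l, s l) else h (l, s l) < 0" for l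
        using False by (cases "0 < m"; cases "0 \<le> a $ l") (simp_all add: h s_def)
      have hx: "if 0 < m then 0 < h x else h x < 0" if "x \<in> transversal s" for x
        using hs that unfolding transversal_def by blast
      have nz: "h x \<noteq> 0" if "x \<in> transversal s" for x
        using hx[OF that] by (auto split: if_splits)
      have "\<not> crossing h (transversal s)"
      proof
        assume "crossing h (transversal s)"
        moreover have "(l0, s l0) \<in> transversal s" by (simp add: mem_transversal)
        ultimately obtain x y where "x \<in> transversal s" "y \<in> transversal s" "h x < 0" "0 < h y"
          using nz unfolding crossing_def by blast
        then show False using hx[of x] hx[of y] by (auto split: if_splits)
      qed
      moreover have "{x \<in> transversal s. h x = 0} = {}" using nz by blast
      ultimately have gs: "g s = {}" by (simp add: g_def)
      have "coatoms ?\<S> \<subseteq> g ` (UNIV - {s})" if "{} \<notin> coatoms ?\<S>"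
      proof
        fix A assume A: "A \<in> coatoms ?\<S>"
        then obtain s1 where s1: "A = g s1" using coat_g by blast
        then have "s1 \<noteq> s" using gs A that by auto
        then show "A \<in> g ` (UNIV - {s})" using s1 by blast
      qed
      moreover have "coatoms ?\<S> \<subseteq> {{}}" if "{} \<in> coatoms ?\<S>" using g that by blast
      ultimately show ?thesis by blast
    qed
    then obtain s where "coatoms ?\<S> \<subseteq> g ` (UNIV - {s}) \<or> coatoms ?\<S> \<subseteq> {{}}" by blast
    moreover have "card (g ` (UNIV - {s})) < CARD('n \<Rightarrow> bool)"
    proof -
      have "card (g ` (UNIV - {s})) \<le> card (UNIV - {s})" by (rule card_image_le) simp
      also have "\<dots> < CARD('n \<Rightarrow> bool)" by (intro psubset_card_mono) auto
      finally show ?thesis .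
    qed
    moreover have "card {{} :: ('n \<times> bool) set} < CARD('n \<Rightarrow> bool)"
    proof -
      have "0 < CARD('n)" by (rule zero_less_card_finite)
      then have "1 < CARD('n \<Rightarrow> bool)" using large by linarith
      then show ?thesis by simp
    qed
    moreover have "card (coatoms ?\<S>) \<le> card B" if "coatoms ?\<S> \<subseteq> B" for B
      using that by (intro card_mono) auto
    ultimately show ?thesis by (meson le_less_trans)
  qed
qed

text \<open>The hyperplane is where coordinate \<open>i\<close> equals 1/8, halfway between the
  origin and the midpoint of diagonal \<open>k\<close>. Both ends of diagonal \<open>k\<close> are
  on one side and both ends of diagonal \<open>j\<close> on the other, so every transversal is
  crossing.\<close>

lemma skew_slice_not_regular_slice:
  fixes i j k :: "'n::finite"
  assumes ij: "i \<noteq> j" "i \<noteq> k" "j \<noteq> k"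
  shows "comb_type (skew_cross k (axis i (1/4)) \<inter> {x. axis i (-8) \<bullet> x = -1})
    \<notin> slice_types (skew_cross k 0)"
proof
  let ?z = "axis i (1/4) :: real ^ 'n"
  assume "comb_type (skew_cross k ?z \<inter> {x. axis i (-8) \<bullet> x = -1}) \<in> slice_types (skew_cross k 0)"
  then obtain a b where ab: "a \<noteq> 0" "comb_type (skew_cross k ?z \<inter> {x. axis i (-8) \<bullet> x = -1}) =
      comb_type (skew_cross k 0 \<inter> {x. a \<bullet> x = b})"
    unfolding slice_types_def affine_hyperplane_def by blast
  have "polytope (skew_cross k ?z \<inter> {x. axis i (-8) \<bullet> x = -1})"
    using full_dim_skew_cross
    by (intro polytope_Int_polyhedron polyhedron_hyperplane) (auto simp: full_dim_polytope_def)
  then have "comb_equiv (skew_cross k ?z \<inter> {x. axis i (-8) \<bullet> x = -1}) (skew_cross k 0 \<inter> {x. a \<bullet> x = b})"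
    using ab(2) comb_type_eqD by blast
  then have iso: "order_iso (slice_idx UNIV (skew_vert k ?z) (\<lambda>x. axis i (-8) \<bullet> skew_vert k ?z x - (-1)))
      (slice_idx UNIV (skew_vert k 0) (\<lambda>x. a \<bullet> skew_vert k 0 x - b))"
    using order_iso_trans[OF face_lattice_slice[of UNIV "skew_vert k ?z" "axis i (-8)" "-1"]]
      order_iso_trans[OF _ order_iso_sym[OF face_lattice_slice[of UNIV "skew_vert k 0" a b]]]
    unfolding comb_equiv_iff skew_cross_def by auto
  have "crossing (\<lambda>x. axis i (-8) \<bullet> skew_vert k ?z x - (-1)) (transversal s)" for s
  proof -
    have "axis i (-8) \<bullet> skew_vert k ?z (k, s k) - (-1) < 0" "0 < axis i (-8) \<bullet> skew_vert k ?z (j, s j) - (-1)"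
    proof -
      have "(axis i (-8) :: real ^ 'n) $ k = 0" "(axis i (-8) :: real ^ 'n) $ j = 0"
        using ij by (auto simp: axis_def)
      then show "axis i (-8) \<bullet> skew_vert k ?z (k, s k) - (-1) < 0"
        "0 < axis i (-8) \<bullet> skew_vert k ?z (j, s j) - (-1)"
        using ij by (simp_all add: inner_skew_vert inner_axis_axis)
    qed
    moreover have "(k, s k) \<in> transversal s" "(j, s j) \<in> transversal s"
      by (simp_all add: mem_transversal)
    ultimately show ?thesis unfolding crossing_def by (metis (no_types, lifting))
  qed
  then have "CARD('n \<Rightarrow> bool) \<le>
      card (coatoms (slice_idx UNIV (skew_vert k ?z) (\<lambda>x. axis i (-8) \<bullet> skew_vert k ?z x - (-1))))"
    using ij by (intro skew_slice_all_facets skew_shift_axis) auto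
  also have "\<dots> = card (coatoms (slice_idx UNIV (skew_vert k 0) (\<lambda>x. a \<bullet> skew_vert k 0 x - b)))"
    by (rule card_coatoms_order_iso[OF iso])
  also have "\<dots> < CARD('n \<Rightarrow> bool)"
    by (rule regular_slice_few_facets[OF ab(1), where m = "- b"]) (simp add: inner_skew_vert)
  finally show False by simp
qed

lemma comb_equiv_not_imp_setwise_slice_equiv:
  assumes "3 \<le> CARD('n)"
  shows "\<exists>P Q :: (real ^ 'n::finite) set. full_dim_polytope P \<and> full_dim_polytope Q \<and>
    comb_equiv P Q \<and> \<not> setwise_slice_equiv P Q"
proof -
  obtain i j k :: 'n where ij: "i \<noteq> j" "i \<noteq> k" "j \<noteq> k" using three_distinct[OF assms] .
  let ?z = "axis i (1/4) :: real ^ 'n"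
  have "affine_hyperplane {x :: real ^ 'n. axis i (-8) \<bullet> x = -1}"
    unfolding affine_hyperplane_def by (intro exI[of _ "axis i (-8)"] exI[of _ "-1"]) (simp add: axis_eq_0_iff)
  then have "comb_type (skew_cross k ?z \<inter> {x. axis i (-8) \<bullet> x = -1}) \<in> slice_types (skew_cross k ?z)"
    unfolding slice_types_def by blast
  then have "\<not> setwise_slice_equiv (skew_cross k ?z) (skew_cross k 0)"
    using skew_slice_not_regular_slice[OF ij] unfolding setwise_slice_equiv_def by metis
  moreover have "comb_equiv (skew_cross k ?z) (skew_cross k 0)"
    using ij by (intro comb_equiv_skew_cross skew_shift_axis skew_shift_0) auto
  ultimately show ?thesis using full_dim_skew_cross by blast
qed

lemma comb_equiv_not_imp_same_OM:
  assumes "3 \<le> CARD('n)"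
  shows "\<exists>P Q :: (real ^ 'n::finite) set. full_dim_polytope P \<and> full_dim_polytope Q \<and>
    comb_equiv P Q \<and> \<not> same_OM P Q"
  using comb_equiv_not_imp_setwise_slice_equiv[OF assms] same_OM_imp_setwise_slice_equiv by blast

section \<open>Polygons\<close>

definition vertices :: "'a::real_vector set \<Rightarrow> 'a set" where
  "vertices S = {v. v extreme_point_of S}"

definition vertex_sets :: "'a::real_vector set \<Rightarrow> 'a set set" where
  "vertex_sets S = vertices ` face_lattice S"

text \<open>The condition \<open>F \<noteq> S\<close> keeps a segment from being its own edge; as
  the top face it is already listed by its vertex set.\<close>

definition edges :: "'a::euclidean_space set \<Rightarrow> 'a set set" where
  "edges S = vertices ` {F. F face_of S \<and> F \<noteq> S \<and> aff_dim F = 1}"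

lemma vertices_face: "F face_of S \<Longrightarrow> vertices F = vertices S \<inter> F"
  by (auto simp: vertices_def extreme_point_of_face)

lemma finite_vertices:
  fixes S :: "'a::euclidean_space set"
  shows "polytope S \<Longrightarrow> finite (vertices S)"
  unfolding vertices_def using finite_polyhedron_extreme_points polytope_imp_polyhedron by blast

lemma hull_vertices:
  fixes S :: "'a::euclidean_space set"
  shows "polytope S \<Longrightarrow> convex hull (vertices S) = S"
  unfolding vertices_def using polytope_eq_hull_vertices by blast

lemma face_lattice_vertex_sets:
  fixes S :: "'a::euclidean_space set"
  assumes S: "polytope S"
  shows "order_iso (face_lattice S) (vertex_sets S)"
proof (rule order_isoI_embedding[of vertices])
  show "vertices ` face_lattice S = vertex_sets S" by (simp add: vertex_sets_def)
  fix F G assume "F \<in> face_lattice S" "G \<in> face_lattice S"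
  then have FG: "F face_of S" "G face_of S" by (auto simp: face_lattice_def)
  show "F \<subseteq> G \<longleftrightarrow> vertices F \<subseteq> vertices G"
  proof
    assume "F \<subseteq> G"
    then show "vertices F \<subseteq> vertices G" using vertices_face[OF FG(1)] vertices_face[OF FG(2)] by blast
  next
    assume "vertices F \<subseteq> vertices G"
    then have "convex hull (vertices F) \<subseteq> convex hull (vertices G)" by (rule hull_mono)
    then show "F \<subseteq> G"
      using FG S face_of_polytope_polytope hull_vertices by metis
  qed
qed

lemma vertices_one_dim:
  fixes S :: "'a::euclidean_space set"
  assumes "polytope S" "aff_dim S = 1"
  obtains a b where "a \<noteq> b" "S = closed_segment a b" "vertices S = {a, b}"
proof -
  have "collinear S" "S \<noteq> {}" using assms(2) by (auto simp: collinear_aff_dim)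
  then obtain a b where ab: "S = closed_segment a b"
    using compact_convex_collinear_segment[of S] assms(1)
    by (metis polytope_imp_compact polytope_imp_convex)
  have "a \<noteq> b" using ab assms(2) by auto
  moreover have "vertices S = {a, b}" using ab by (auto simp: vertices_def extreme_point_of_segment)
  ultimately show ?thesis using that ab by blast
qed

lemma card_edge:
  fixes S :: "'a::euclidean_space set"
  assumes "e \<in> edges S" "polytope S"
  shows "card e = 2"
proof -
  obtain F where F: "F face_of S" "aff_dim F = 1" "e = vertices F"
    using assms(1) by (auto simp: edges_def)
  have "polytope F" using assms(2) F(1) by (rule face_of_polytope_polytope)
  then obtain a b where "a \<noteq> b" "vertices F = {a, b}" using vertices_one_dim F(2) by metis
  then show ?thesis by (simp add: F(3))
qed

lemma edge_subset: "e \<in> edges S \<Longrightarrow> e \<subseteq> vertices S"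
  by (auto simp: edges_def vertices_face)

text \<open>A proper nonempty face has dimension 0 or 1.\<close>

lemma vertex_sets_polygon:
  fixes S :: "'a::euclidean_space set"
  assumes S: "polytope S" and dim: "aff_dim S \<le> 2"
  shows "vertex_sets S = {{}, vertices S} \<union> (\<lambda>v. {v}) ` vertices S \<union> edges S"
proof
  show "vertex_sets S \<subseteq> {{}, vertices S} \<union> (\<lambda>v. {v}) ` vertices S \<union> edges S"
  proof
    fix A assume "A \<in> vertex_sets S"
    then obtain F where F: "F face_of S" "A = vertices F"
      by (auto simp: vertex_sets_def face_lattice_def)
    show "A \<in> {{}, vertices S} \<union> (\<lambda>v. {v}) ` vertices S \<union> edges S"
    proof (cases "F = S \<or> F = {}")
      case True
      then show ?thesis using F(2) by (auto simp: vertices_def)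
    next
      case False
      then have "aff_dim F < aff_dim S"
        using F(1) S by (intro face_of_aff_dim_lt) (auto simp: polytope_imp_convex)
      moreover have "0 \<le> aff_dim F" using False aff_dim_negative_iff[of F] by linarith
      ultimately consider "aff_dim F = 0" | "aff_dim F = 1" using dim by linarith
      then show ?thesis
      proof cases
        case 1
        then obtain a where a: "F = {a}" by (auto simp: aff_dim_eq_0)
        then have "A = {a}" "a \<in> vertices S"
          using F by (auto simp: vertices_def face_of_singleton)
        then show ?thesis by blast
      next
        case 2
        then show ?thesis using F False by (auto simp: edges_def)
      qed
    qed
  qed
next
  have "{} \<in> vertex_sets S" "vertices S \<in> vertex_sets S"
  proof -
    have "vertices ({} :: 'a set) = {}" by (simp add: vertices_def)
    then show "{} \<in> vertex_sets S"
      unfolding vertex_sets_def face_lattice_def using empty_face_of by (metis (mono_tags) imageI mem_Collect_eq)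
    show "vertices S \<in> vertex_sets S"
      unfolding vertex_sets_def face_lattice_def using S face_of_refl polytope_imp_convex by blast
  qed
  moreover have "{v} \<in> vertex_sets S" if "v \<in> vertices S" for v
  proof -
    have "{v} face_of S" using that by (simp add: vertices_def face_of_singleton)
    moreover have "vertices {v} = {v}" by (auto simp: vertices_def)
    ultimately show ?thesis
      unfolding vertex_sets_def face_lattice_def by (metis (mono_tags) imageI mem_Collect_eq)
  qed
  moreover have "edges S \<subseteq> vertex_sets S"
    by (auto simp: edges_def vertex_sets_def face_lattice_def)
  ultimately show "{{}, vertices S} \<union> (\<lambda>v. {v}) ` vertices S \<union> edges S \<subseteq> vertex_sets S"
    by blast
qed

lemma edges_low_dim:
  assumes "polytope S" "aff_dim S \<le> 1"
  shows "edges S = {}"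
proof -
  have False if "F face_of S" "F \<noteq> S" "aff_dim F = 1" for F
    using face_of_aff_dim_lt[of S F] that assms by (simp add: polytope_imp_convex)
  then show ?thesis unfolding edges_def by blast
qed

lemma card_vertices_low_dim:
  fixes S :: "'a::euclidean_space set"
  assumes S: "polytope S" and dim: "aff_dim S \<le> 1"
  shows "card (vertices S) \<le> 2"
proof -
  have "-1 \<le> aff_dim S" by (rule aff_dim_geq)
  then consider "aff_dim S = -1" | "aff_dim S = 0" | "aff_dim S = 1" using dim by linarith
  then show ?thesis
  proof cases
    case 1
    then have "S = {}" using aff_dim_empty by blast
    then show ?thesis by (simp add: vertices_def)
  next
    case 2
    then obtain a where "S = {a}" by (auto simp: aff_dim_eq_0)
    then show ?thesis by (simp add: vertices_def)
  next
    case 3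
    then obtain a b where "vertices S = {a, b}" using vertices_one_dim[OF S] by metis
    then show ?thesis by (simp add: card_insert_if)
  qed
qed

lemma card_vertices_ge:
  fixes S :: "'a::euclidean_space set"
  assumes "polytope S"
  shows "aff_dim S + 1 \<le> int (card (vertices S))"
proof -
  have "aff_dim S = aff_dim (vertices S)"
    using hull_vertices[OF assms] aff_dim_convex_hull by metis
  then show ?thesis using aff_dim_le_card[OF finite_vertices[OF assms]] by simp
qed

section \<open>Incidences of vertices and edges in a polygon\<close>

lemma polygon_facets:
  assumes "polytope S" "aff_dim S = 2"
  shows "edges S = vertices ` {F. F facet_of S}" "inj_on vertices {F. F facet_of S}"
proof -
  have "F face_of S \<and> F \<noteq> S \<and> aff_dim F = 1 \<longleftrightarrow> F facet_of S" for F
    using assms(2) by (auto simp: facet_of_def)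
  then show "edges S = vertices ` {F. F facet_of S}" by (simp add: edges_def)
  show "inj_on vertices {F. F facet_of S}"
    by (rule inj_onI)
      (metis assms(1) face_of_polytope_polytope facet_of_imp_face_of hull_vertices mem_Collect_eq)
qed

text \<open>Each edge at \<open>v\<close> has an outer normal that is negative on the directions \<open>u\<close> of the other edges;
  a linear relation between three directions in the plane then has coefficients of pairwise opposite
  signs, which is impossible.\<close>

lemma three_directions_independent:
  fixes u1 u2 u3 :: "'a::real_inner"
  assumes a1: "a1 \<bullet> u1 = 0" "a1 \<bullet> u2 < 0" "a1 \<bullet> u3 < 0"
    and a2: "a2 \<bullet> u1 < 0" "a2 \<bullet> u2 = 0" "a2 \<bullet> u3 < 0"
    and a3: "a3 \<bullet> u1 < 0" "a3 \<bullet> u2 < 0" "a3 \<bullet> u3 = 0"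
    and dep: "c1 *\<^sub>R u1 + c2 *\<^sub>R u2 + c3 *\<^sub>R u3 = 0"
  shows "c1 = 0 \<and> c2 = 0 \<and> c3 = 0"
proof -
  have opp: "(0 < x \<longrightarrow> y < 0) \<and> (x < 0 \<longrightarrow> 0 < y) \<and> (x = 0 \<longrightarrow> y = 0)"
    if "x * s + y * t = 0" "s < 0" "t < 0" for x y s t :: real
  proof -
    have "y = - (x * s) / t" using that by (simp add: field_simps)
    then show ?thesis
      using that(2,3) by (auto simp: zero_less_divide_iff divide_less_0_iff mult_less_0_iff zero_less_mult_iff)
  qed
  have e: "c1 * (a \<bullet> u1) + c2 * (a \<bullet> u2) + c3 * (a \<bullet> u3) = 0" for a
    using arg_cong[OF dep, of "\<lambda>x. a \<bullet> x"] by (simp add: inner_add_right)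
  have "c2 * (a1 \<bullet> u2) + c3 * (a1 \<bullet> u3) = 0" using e[of a1] a1 by simp
  from opp[OF this a1(2,3)] have 1: "(0 < c2 \<longrightarrow> c3 < 0) \<and> (c2 < 0 \<longrightarrow> 0 < c3) \<and> (c2 = 0 \<longrightarrow> c3 = 0)" .
  have "c1 * (a2 \<bullet> u1) + c3 * (a2 \<bullet> u3) = 0" using e[of a2] a2 by simp
  from opp[OF this a2(1,3)] have 2: "(0 < c1 \<longrightarrow> c3 < 0) \<and> (c1 < 0 \<longrightarrow> 0 < c3) \<and> (c1 = 0 \<longrightarrow> c3 = 0)" .
  have "c1 * (a3 \<bullet> u1) + c2 * (a3 \<bullet> u2) = 0" using e[of a3] a3 by simp
  from opp[OF this a3(1,2)] have 3: "(0 < c1 \<longrightarrow> c2 < 0) \<and> (c1 < 0 \<longrightarrow> 0 < c2) \<and> (c1 = 0 \<longrightarrow> c2 = 0)" .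
  show ?thesis using 1 2 3 by linarith
qed

lemma facet_at_vertex:
  fixes S :: "'a::euclidean_space set"
  assumes S: "polytope S" and dim: "aff_dim S = 2" and F: "F facet_of S" and v: "v \<in> vertices S" "v \<in> F"
  shows "\<exists>w a. vertices F = {v, w} \<and> w \<in> S \<and> a \<bullet> (w - v) = 0 \<and>
    (\<forall>x\<in>vertices S. x \<noteq> v \<longrightarrow> x \<noteq> w \<longrightarrow> a \<bullet> (x - v) < 0)"
proof -
  have face: "F face_of S" using F by (rule facet_of_imp_face_of)
  have poly: "polytope F" using S face by (rule face_of_polytope_polytope)
  have "aff_dim F = 1" using F dim by (simp add: facet_of_def)
  then obtain p q where pq: "vertices F = {p, q}" using vertices_one_dim[OF poly] by metis
  have "v \<in> vertices F" using v vertices_face[OF face] by blast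
  then have w: "vertices F = {v, w}" if "w = (if v = p then q else p)" for w
    using pq that by auto
  define w where "w = (if v = p then q else p)"
  note w = w[OF w_def]
  have "F exposed_face_of S"
    using face exposed_face_of_polyhedron polytope_imp_polyhedron[OF S] by blast
  then obtain a b where ab: "S \<subseteq> {x. a \<bullet> x \<le> b}" "F = S \<inter> {x. a \<bullet> x = b}"
    unfolding exposed_face_of_def by blast
  have wF: "w \<in> F" "w \<in> vertices S" using w vertices_face[OF face] by auto
  show ?thesis
  proof (intro exI conjI ballI impI)
    show "vertices F = {v, w}" by (rule w)
    show "w \<in> S" using wF(1) ab(2) by blast
    show "a \<bullet> (w - v) = 0" using wF(1) v(2) ab(2) by (auto simp: inner_diff_right)
    fix x assume x: "x \<in> vertices S" "x \<noteq> v" "x \<noteq> w"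
    then have "x \<notin> F" using w vertices_face[OF face] by blast
    moreover have "x \<in> S" using x(1) by (simp add: vertices_def extreme_point_of_def)
    ultimately show "a \<bullet> (x - v) < 0" using ab v(2) by (auto simp: inner_diff_right)
  qed
qed

text \<open>The directions of three edges at \<open>v\<close>, with their outer normals, would be
  linearly independent, which exceeds the dimension 2.\<close>

lemma no_three_facets_at_vertex:
  fixes S :: "'a::euclidean_space set"
  assumes S: "polytope S" and dim: "aff_dim S = 2" and v: "v \<in> vertices S"
    and F: "F1 facet_of S" "F2 facet_of S" "F3 facet_of S" "v \<in> F1" "v \<in> F2" "v \<in> F3"
    and ne: "F1 \<noteq> F2" "F1 \<noteq> F3" "F2 \<noteq> F3"
  shows False
proof -
  have card2: "card (vertices F) = 2" if "F facet_of S" for F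
    using that polygon_facets(1)[OF S dim] card_edge[OF _ S] by blast
  obtain w1 a1 where 1: "vertices F1 = {v, w1}" "w1 \<in> S" "a1 \<bullet> (w1 - v) = 0"
    "\<forall>x\<in>vertices S. x \<noteq> v \<longrightarrow> x \<noteq> w1 \<longrightarrow> a1 \<bullet> (x - v) < 0"
    using facet_at_vertex[OF S dim F(1) v F(4)] by blast
  obtain w2 a2 where 2: "vertices F2 = {v, w2}" "w2 \<in> S" "a2 \<bullet> (w2 - v) = 0"
    "\<forall>x\<in>vertices S. x \<noteq> v \<longrightarrow> x \<noteq> w2 \<longrightarrow> a2 \<bullet> (x - v) < 0"
    using facet_at_vertex[OF S dim F(2) v F(5)] by blast
  obtain w3 a3 where 3: "vertices F3 = {v, w3}" "w3 \<in> S" "a3 \<bullet> (w3 - v) = 0"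
    "\<forall>x\<in>vertices S. x \<noteq> v \<longrightarrow> x \<noteq> w3 \<longrightarrow> a3 \<bullet> (x - v) < 0"
    using facet_at_vertex[OF S dim F(3) v F(6)] by blast
  have inj: "vertices F \<noteq> vertices G" if "F facet_of S" "G facet_of S" "F \<noteq> G" for F G
    using polygon_facets(2)[OF S dim] that unfolding inj_on_def by blast
  have wne: "w1 \<noteq> w2" "w1 \<noteq> w3" "w2 \<noteq> w3"
    using inj[OF F(1,2) ne(1)] inj[OF F(1,3) ne(2)] inj[OF F(2,3) ne(3)] 1(1) 2(1) 3(1) by auto
  have wv: "w1 \<noteq> v" "w2 \<noteq> v" "w3 \<noteq> v"
    using card2[OF F(1)] card2[OF F(2)] card2[OF F(3)] 1(1) 2(1) 3(1) by auto
  have wS: "w1 \<in> vertices S" "w2 \<in> vertices S" "w3 \<in> vertices S"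
    using 1(1) 2(1) 3(1) F(1-3) facet_of_imp_face_of vertices_face by blast+
  let ?U = "{w1 - v, w2 - v, w3 - v}"
  have U: "card ?U = 3" using wne by simp
  have dep0: "c1 = 0 \<and> c2 = 0 \<and> c3 = 0"
    if "c1 *\<^sub>R (w1 - v) + c2 *\<^sub>R (w2 - v) + c3 *\<^sub>R (w3 - v) = 0" for c1 c2 c3
    using that 1(3,4) 2(3,4) 3(3,4) wS wne wv
    by (intro three_directions_independent[of a1 _ _ _ a2 a3]) auto
  have "independent ?U"
  proof
    assume "dependent ?U"
    then obtain c where c: "\<exists>x\<in>?U. c x \<noteq> 0" "(\<Sum>x\<in>?U. c x *\<^sub>R x) = 0"
      using dependent_finite[of ?U] by auto
    have "(\<Sum>x\<in>?U. c x *\<^sub>R x) =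
        c (w1 - v) *\<^sub>R (w1 - v) + c (w2 - v) *\<^sub>R (w2 - v) + c (w3 - v) *\<^sub>R (w3 - v)"
      using wne by (simp add: add.assoc)
    then show False using dep0 c by auto
  qed
  moreover have "?U \<subseteq> (\<lambda>x. x - v) ` S" using 1(2) 2(2) 3(2) by blast
  ultimately have "card ?U \<le> dim ((\<lambda>x. x - v) ` S)" by (intro independent_card_le_dim)
  moreover have "v \<in> affine hull S" using v by (simp add: vertices_def extreme_point_of_def hull_inc)
  ultimately have "3 \<le> aff_dim S" using U aff_dim_eq_dim_subtract by fastforce
  then show False using dim by simp
qed

text \<open>A proper face of a polyhedron is the intersection of the facets containing it. For
  \<open>{v}\<close>, no facets would give everything, and a single one would be a segment.\<close>

lemma two_facets_at_vertex:
  fixes S :: "'a::euclidean_space set"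
  assumes S: "polytope S" and dim: "aff_dim S = 2" and v: "v \<in> vertices S"
  obtains F G where "F \<noteq> G" "F facet_of S" "G facet_of S" "v \<in> F" "v \<in> G"
proof -
  have vS: "{v} face_of S" using v by (simp add: vertices_def face_of_singleton)
  have "{v} \<noteq> S" using dim by auto
  then have eq: "{v} = \<Inter>{F. F facet_of S \<and> {v} \<subseteq> F}"
    using face_of_polyhedron[OF polytope_imp_polyhedron[OF S] vS] by blast
  have "S \<subseteq> {v}" if "{F. F facet_of S \<and> {v} \<subseteq> F} = {}"
    using eq that by auto
  then have "{F. F facet_of S \<and> {v} \<subseteq> F} \<noteq> {}"
    using vS \<open>{v} \<noteq> S\<close> face_of_imp_subset by blast
  then obtain F where F: "F facet_of S" "v \<in> F" by blast
  have "aff_dim F = 1" using F dim by (simp add: facet_of_def)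
  then have "F \<noteq> {v}" by auto
  then obtain G where "G facet_of S" "v \<in> G" "G \<noteq> F"
    using eq F by blast
  then show ?thesis using that F by blast
qed

lemma vertex_in_two_edges:
  fixes S :: "'a::euclidean_space set"
  assumes S: "polytope S" and dim: "aff_dim S = 2" and v: "v \<in> vertices S"
  shows "card {e \<in> edges S. v \<in> e} = 2"
proof -
  obtain F G where FG: "F \<noteq> G" "F facet_of S" "G facet_of S" "v \<in> F" "v \<in> G"
    using two_facets_at_vertex[OF assms] .
  have mem: "v \<in> vertices H \<longleftrightarrow> v \<in> H" if "H facet_of S" for H
    using v vertices_face[OF facet_of_imp_face_of[OF that]] by blast
  have "{e \<in> edges S. v \<in> e} = {vertices F, vertices G}"
  proof
    show "{vertices F, vertices G} \<subseteq> {e \<in> edges S. v \<in> e}"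
      using FG mem polygon_facets(1)[OF S dim] by blast
    show "{e \<in> edges S. v \<in> e} \<subseteq> {vertices F, vertices G}"
    proof
      fix e assume "e \<in> {e \<in> edges S. v \<in> e}"
      then obtain H where H: "H facet_of S" "e = vertices H" "v \<in> H"
        using mem polygon_facets(1)[OF S dim] by blast
      then have "H = F \<or> H = G"
        using no_three_facets_at_vertex[OF S dim v FG(2,3) H(1) FG(4,5) H(3) FG(1)] by blast
      then show "e \<in> {vertices F, vertices G}" using H(2) by blast
    qed
  qed
  moreover have "vertices F \<noteq> vertices G"
    using polygon_facets(2)[OF S dim] FG unfolding inj_on_def by blast
  ultimately show ?thesis by simp
qed

text \<open>Double counting of incidences: each vertex is on two edges and each edge has two
  vertices.\<close>

lemma card_facets_polygon:
  fixes S :: "'a::euclidean_space set"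
  assumes S: "polytope S" and dim: "aff_dim S = 2"
  shows "card (vertices S) = card {F. F facet_of S}"
proof -
  have fin: "finite (vertices S)" "finite (edges S)"
    using finite_vertices[OF S] edge_subset by (auto intro: finite_subset[of _ "Pow (vertices S)"])
  have "(\<Sum>v\<in>vertices S. card {e \<in> edges S. v \<in> e}) = (\<Sum>e\<in>edges S. 2)"
  proof (rule sum_multicount_gen[OF fin], rule ballI)
    fix e assume e: "e \<in> edges S"
    then have "{v \<in> vertices S. v \<in> e} = e" using edge_subset by blast
    then show "card {v \<in> vertices S. v \<in> e} = 2" using card_edge[OF e S] by simp
  qed
  then have "card (vertices S) = card (edges S)"
    using vertex_in_two_edges[OF S dim] by simp
  then show ?thesis using polygon_facets[OF S dim] by (simp add: card_image)
qed

subsection \<open>Cyclic structure of polygons with at most five vertices\<close>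

text \<open>A simple graph with all degrees 2. Its components are cycles with at least three
  vertices, so on at most five vertices there is only one component.\<close>

definition two_regular :: "'a set \<Rightarrow> 'a set set \<Rightarrow> bool" where
  "two_regular V E \<longleftrightarrow> (\<forall>e\<in>E. e \<subseteq> V \<and> card e = 2) \<and> (\<forall>v\<in>V. card {e \<in> E. v \<in> e} = 2)"

definition cycle_edges :: "'a list \<Rightarrow> 'a set set" where
  "cycle_edges xs = (\<lambda>i. {xs ! i, xs ! (Suc i mod length xs)}) ` {..<length xs}"

lemma two_regular_neighbours:
  assumes "two_regular V E" "v \<in> V"
  shows "\<exists>x y. x \<noteq> y \<and> x \<noteq> v \<and> y \<noteq> v \<and> x \<in> V \<and> y \<in> V \<and>
    (\<forall>w. {v, w} \<in> E \<longleftrightarrow> w = x \<or> w = y)"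
proof -
  obtain e f where ef: "{e \<in> E. v \<in> e} = {e, f}" "e \<noteq> f"
    using assms unfolding two_regular_def card_2_iff by metis
  have *: "\<exists>w. g = {v, w} \<and> w \<noteq> v \<and> w \<in> V" if g: "g \<in> E" "v \<in> g" for g
  proof -
    obtain p q where "g = {p, q}" "p \<noteq> q" using assms(1) g(1) unfolding two_regular_def card_2_iff by metis
    moreover have "g \<subseteq> V" using assms(1) g(1) unfolding two_regular_def by blast
    ultimately show ?thesis using g(2) by blast
  qed
  have "e \<in> E" "v \<in> e" "f \<in> E" "v \<in> f" using ef(1) by blast+
  then obtain x y where xy: "e = {v, x}" "f = {v, y}" "x \<noteq> v" "y \<noteq> v" "x \<in> V" "y \<in> V"
    using *[of e] *[of f] by blast
  have nb: "{v, w} \<in> E \<longleftrightarrow> w = x \<or> w = y" for w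
  proof -
    have "{v, w} \<in> E \<longleftrightarrow> {v, w} \<in> {e, f}" unfolding ef(1)[symmetric] by blast
    then show ?thesis using xy(1,2) by (auto simp: doubleton_eq_iff)
  qed
  have "x \<noteq> y" using xy(1,2) ef(2) by blast
  then show ?thesis using xy(3-6) nb by blast
qed

lemma two_regular_eqI:
  assumes E: "two_regular V E" and E': "\<And>e. e \<in> E' \<Longrightarrow> e \<subseteq> V \<and> card e = 2"
    and eq: "\<And>x y. x \<in> V \<Longrightarrow> y \<in> V \<Longrightarrow> x \<noteq> y \<Longrightarrow> {x, y} \<in> E \<longleftrightarrow> {x, y} \<in> E'"
  shows "E = E'"
proof -
  have key: "e \<in> E \<longleftrightarrow> e \<in> E'" if e: "e \<subseteq> V" "card e = 2" for e
  proof -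
    obtain x y where "e = {x, y}" "x \<noteq> y" using e(2) card_2_iff by metis
    then show ?thesis using eq e(1) by simp
  qed
  have EV: "e \<subseteq> V \<and> card e = 2" if "e \<in> E" for e
    using E that by (simp add: two_regular_def)
  show ?thesis
  proof (intro set_eqI iffI)
    fix e assume "e \<in> E"
    then show "e \<in> E'" using EV[of e] key[of e] by simp
  next
    fix e assume "e \<in> E'"
    then show "e \<in> E" using E'[of e] key[of e] by simp
  qed
qed

lemma two_regular_other_neighbour:
  assumes "two_regular V E" "{v, x} \<in> E"
  shows "\<exists>y. y \<in> V \<and> y \<noteq> v \<and> y \<noteq> x \<and> (\<forall>w. {x, w} \<in> E \<longleftrightarrow> w = v \<or> w = y)"
proof -
  have x: "x \<in> V" using assms unfolding two_regular_def by blast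
  obtain p q where pq: "p \<noteq> q" "p \<noteq> x" "q \<noteq> x" "p \<in> V" "q \<in> V"
      "\<forall>w. {x, w} \<in> E \<longleftrightarrow> w = p \<or> w = q"
    using two_regular_neighbours[OF assms(1) x] by blast
  have "{x, v} \<in> E" using assms(2) by (simp add: insert_commute)
  then have "v = p \<or> v = q" using pq(6) by blast
  then show ?thesis
  proof
    assume "v = p"
    then show ?thesis using pq by (intro exI[of _ q]) auto
  next
    assume "v = q"
    then show ?thesis using pq by (intro exI[of _ p]) auto
  qed
qed

lemma cycle_edges_mem:
  assumes "distinct xs" "2 \<le> length xs" "e \<in> cycle_edges xs"
  shows "e \<subseteq> set xs \<and> card e = 2"
proof -
  let ?n = "length xs"
  obtain i where i: "i < ?n" "e = {xs ! i, xs ! (Suc i mod ?n)}"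
    using assms(3) by (auto simp: cycle_edges_def)
  have j: "Suc i mod ?n < ?n" using i(1) by (intro mod_less_divisor) linarith
  have "Suc i mod ?n \<noteq> i"
    using i(1) assms(2) by (cases "Suc i = ?n") auto
  then have "xs ! i \<noteq> xs ! (Suc i mod ?n)"
    using assms(1) i(1) j by (simp add: nth_eq_iff_index_eq)
  then show ?thesis using i j by (auto intro: nth_mem)
qed

lemma cycle_edges_3: "cycle_edges [a, b, c] = {{a, b}, {b, c}, {c, a}}"
  by (auto simp: cycle_edges_def lessThan_Suc)

lemma cycle_edges_4: "cycle_edges [a, b, c, d] = {{a, b}, {b, c}, {c, d}, {d, a}}"
  by (auto simp: cycle_edges_def lessThan_Suc)

lemma cycle_edges_5: "cycle_edges [a, b, c, d, e] = {{a, b}, {b, c}, {c, d}, {d, e}, {e, a}}"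
  by (auto simp: cycle_edges_def lessThan_Suc)

lemma two_regular_is_cycle_edges:
  assumes E: "two_regular V E" and xs: "distinct xs" "set xs = V" "2 \<le> length xs"
    and adj: "\<And>x y. x \<in> V \<Longrightarrow> y \<in> V \<Longrightarrow> x \<noteq> y \<Longrightarrow> {x, y} \<in> E \<longleftrightarrow> {x, y} \<in> cycle_edges xs"
  shows "E = cycle_edges xs"
  using E
proof (rule two_regular_eqI)
  show "e \<subseteq> V \<and> card e = 2" if "e \<in> cycle_edges xs" for e
    using cycle_edges_mem[OF xs(1,3) that] xs(2) by simp
qed (rule adj)

lemma two_regular_cycle_3:
  assumes E: "two_regular V E" and V: "finite V" "card V = 3"
  shows "\<exists>xs. distinct xs \<and> set xs = V \<and> E = cycle_edges xs"
proof -
  obtain v where v: "v \<in> V" using V by fastforce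
  obtain x y where xy: "x \<noteq> y" "x \<noteq> v" "y \<noteq> v" "x \<in> V" "y \<in> V"
    and nv: "\<forall>w. {v, w} \<in> E \<longleftrightarrow> w = x \<or> w = y"
    using two_regular_neighbours[OF E v] by blast
  have Veq: "V = {v, x, y}"
    using V v xy by (intro card_subset_eq[symmetric]) auto
  have "{v, x} \<in> E" "{v, y} \<in> E" using nv by auto
  note vE = this
  obtain x' where x': "x' \<in> V" "x' \<noteq> v" "x' \<noteq> x" "\<forall>w. {x, w} \<in> E \<longleftrightarrow> w = v \<or> w = x'"
    using two_regular_other_neighbour[OF E vE(1)] by blast
  obtain y' where y': "y' \<in> V" "y' \<noteq> v" "y' \<noteq> y" "\<forall>w. {y, w} \<in> E \<longleftrightarrow> w = v \<or> w = y'"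
    using two_regular_other_neighbour[OF E vE(2)] by blast
  have "x' = y" "y' = x" using x' y' Veq by auto
  then have n: "\<And>w. {x, w} \<in> E \<longleftrightarrow> w = v \<or> w = y" "\<And>w. {y, w} \<in> E \<longleftrightarrow> w = v \<or> w = x"
    using x'(4) y'(4) by auto
  have "E = cycle_edges [v, x, y]"
    by (rule two_regular_is_cycle_edges[OF E])
      (use xy n nv in \<open>auto simp: Veq cycle_edges_3 doubleton_eq_iff\<close>)
  then show ?thesis using xy Veq by (intro exI[of _ "[v, x, y]"]) auto
qed

text \<open>The vertex \<open>w\<close> not adjacent to \<open>v\<close> has two neighbours among
  the other vertices, so they are the neighbours \<open>x\<close> and \<open>y\<close> of
  \<open>v\<close>.\<close>

lemma two_regular_cycle_4:
  assumes E: "two_regular V E" and V: "finite V" "card V = 4"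
  shows "\<exists>xs. distinct xs \<and> set xs = V \<and> E = cycle_edges xs"
proof -
  obtain v where v: "v \<in> V" using V by fastforce
  obtain x y where xy: "x \<noteq> y" "x \<noteq> v" "y \<noteq> v" "x \<in> V" "y \<in> V"
    and nv: "\<forall>w. {v, w} \<in> E \<longleftrightarrow> w = x \<or> w = y"
    using two_regular_neighbours[OF E v] by blast
  have "card (V - {v, x, y}) = 1" using V v xy by (simp add: card_Diff_subset)
  then obtain w where "V - {v, x, y} = {w}" by (auto simp: card_1_singleton_iff)
  then have w: "V = {v, x, y, w}" "w \<noteq> v" "w \<noteq> x" "w \<noteq> y" using v xy by auto
  then have "w \<in> V" by simp
  then obtain p q where pq: "p \<noteq> q" "p \<noteq> w" "q \<noteq> w" "p \<in> V" "q \<in> V"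
    and nw: "\<forall>z. {w, z} \<in> E \<longleftrightarrow> z = p \<or> z = q"
    using two_regular_neighbours[OF E] by blast
  have "{v, w} \<notin> E" using nv w by auto
  then have "{w, v} \<notin> E" by (simp add: insert_commute)
  then have "p \<noteq> v" "q \<noteq> v" using nw by auto
  then have "(p = x \<and> q = y) \<or> (p = y \<and> q = x)" using pq w by auto
  then have nw: "\<forall>z. {w, z} \<in> E \<longleftrightarrow> z = x \<or> z = y" using nw by auto
  have "{v, x} \<in> E" "{v, y} \<in> E" using nv by auto
  note vE = this
  obtain x' where x': "x' \<in> V" "x' \<noteq> v" "x' \<noteq> x" "\<forall>w. {x, w} \<in> E \<longleftrightarrow> w = v \<or> w = x'"
    using two_regular_other_neighbour[OF E vE(1)] by blast
  obtain y' where y': "y' \<in> V" "y' \<noteq> v" "y' \<noteq> y" "\<forall>w. {y, w} \<in> E \<longleftrightarrow> w = v \<or> w = y'"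
    using two_regular_other_neighbour[OF E vE(2)] by blast
  have "{x, w} \<in> E" "{y, w} \<in> E" using nw by (simp_all add: insert_commute[of _ w])
  then have "x' = w" "y' = w" using x'(4) y'(4) w by auto
  then have n: "\<And>z. {x, z} \<in> E \<longleftrightarrow> z = v \<or> z = w" "\<And>z. {y, z} \<in> E \<longleftrightarrow> z = v \<or> z = w"
    using x'(4) y'(4) by auto
  have "E = cycle_edges [v, x, w, y]"
    by (rule two_regular_is_cycle_edges[OF E])
      (use xy w(2-) n nv nw in \<open>auto simp: w(1) cycle_edges_4 doubleton_eq_iff\<close>)
  then show ?thesis using xy w by (intro exI[of _ "[v, x, w, y]"]) auto
qed

text \<open>Along the path \<open>y\<close>, \<open>v\<close>, \<open>x\<close>, \<open>w\<close>
  the neighbourhoods of \<open>v\<close> and \<open>x\<close> are full, so the fifth vertex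
  \<open>u\<close> has to join \<open>w\<close> and \<open>y\<close>.\<close>

lemma two_regular_cycle_5_aux:
  assumes E: "two_regular V E"
    and nv: "\<forall>z. {v, z} \<in> E \<longleftrightarrow> z = x \<or> z = y"
    and nx: "\<forall>z. {x, z} \<in> E \<longleftrightarrow> z = v \<or> z = w"
    and V: "V = {v, x, y, w, u}" and d: "distinct [v, x, y, w, u]"
  shows "E = cycle_edges [v, x, w, u, y]"
proof -
  have "{x, w} \<in> E" "{v, y} \<in> E" using nx nv by auto
  note xE = this
  obtain w' where w': "w' \<in> V" "w' \<noteq> x" "w' \<noteq> w" "\<forall>z. {w, z} \<in> E \<longleftrightarrow> z = x \<or> z = w'"
    using two_regular_other_neighbour[OF E xE(1)] by blast
  obtain y' where y': "y' \<in> V" "y' \<noteq> v" "y' \<noteq> y" "\<forall>z. {y, z} \<in> E \<longleftrightarrow> z = v \<or> z = y'"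
    using two_regular_other_neighbour[OF E xE(2)] by blast
  have "u \<in> V" using V by simp
  then obtain p q where pq: "p \<noteq> q" "p \<noteq> u" "q \<noteq> u" "p \<in> V" "q \<in> V"
    and nu: "\<forall>z. {u, z} \<in> E \<longleftrightarrow> z = p \<or> z = q"
    using two_regular_neighbours[OF E] by blast
  have "{v, u} \<notin> E" "{x, u} \<notin> E" using nv nx d by auto
  then have "{u, v} \<notin> E" "{u, x} \<notin> E" by (simp_all add: insert_commute)
  then have "p \<noteq> v" "p \<noteq> x" "q \<noteq> v" "q \<noteq> x" using nu by auto
  then have "(p = w \<and> q = y) \<or> (p = y \<and> q = w)" using pq V by auto
  then have nu: "\<forall>z. {u, z} \<in> E \<longleftrightarrow> z = w \<or> z = y" using nu by auto
  have "{w, u} \<in> E" "{y, u} \<in> E" using nu by (simp_all add: insert_commute[of _ u])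
  then have "w' = u" "y' = u" using w'(4) y'(4) d by auto
  then have n: "\<And>z. {w, z} \<in> E \<longleftrightarrow> z = x \<or> z = u" "\<And>z. {y, z} \<in> E \<longleftrightarrow> z = v \<or> z = u"
    using w'(4) y'(4) by auto
  note adj = n nv[rule_format] nx[rule_format] nu[rule_format]
  show ?thesis
  proof (rule two_regular_is_cycle_edges[OF E])
    fix p q assume "p \<in> V" "q \<in> V" "p \<noteq> q"
    then have "p = v \<or> p = x \<or> p = y \<or> p = w \<or> p = u" using V by simp
    then show "{p, q} \<in> E \<longleftrightarrow> {p, q} \<in> cycle_edges [v, x, w, u, y]"
      by (elim disjE) (use d in \<open>auto simp: adj cycle_edges_5 doubleton_eq_iff\<close>)
  qed (use d V in auto)
qed

lemma two_regular_cycle_5: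
  assumes E: "two_regular V E" and V: "finite V" "card V = 5"
  shows "\<exists>xs. distinct xs \<and> set xs = V \<and> E = cycle_edges xs"
proof -
  obtain v where v: "v \<in> V" using V by fastforce
  obtain x y where xy: "x \<noteq> y" "x \<noteq> v" "y \<noteq> v" "x \<in> V" "y \<in> V"
    and nv: "\<forall>w. {v, w} \<in> E \<longleftrightarrow> w = x \<or> w = y"
    using two_regular_neighbours[OF E v] by blast
  have "card (V - {v, x, y}) = 2" using V v xy by (simp add: card_Diff_subset)
  then obtain w u where "V - {v, x, y} = {w, u}" "w \<noteq> u" by (auto simp: card_2_iff)
  then have w: "V = {v, x, y, w, u}" "distinct [v, x, y, w, u]" using v xy by auto
  have "{v, x} \<in> E" using nv by auto
  then obtain x' where x': "x' \<in> V" "x' \<noteq> v" "x' \<noteq> x" "\<forall>w. {x, w} \<in> E \<longleftrightarrow> w = v \<or> w = x'"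
    using two_regular_other_neighbour[OF E] by blast
  have "x' \<noteq> y"
  proof
    assume "x' = y"
    then have nx: "\<forall>z. {x, z} \<in> E \<longleftrightarrow> z = v \<or> z = y" using x'(4) by simp
    then have xyE: "{x, y} \<in> E" by simp
    obtain y' where y': "\<forall>z. {y, z} \<in> E \<longleftrightarrow> z = x \<or> z = y'"
      using two_regular_other_neighbour[OF E xyE] by blast
    have "{v, y} \<in> E" using nv by simp
    then have "{y, v} \<in> E" by (simp add: insert_commute)
    then have "y' = v" using y' xy by auto
    have "w \<in> V" using w by simp
    then obtain p q where pq: "p \<noteq> q" "p \<noteq> w" "q \<noteq> w" "p \<in> V" "q \<in> V"
      and nw: "\<forall>z. {w, z} \<in> E \<longleftrightarrow> z = p \<or> z = q"
      using two_regular_neighbours[OF E] by blast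
    have "{v, w} \<notin> E" "{x, w} \<notin> E" "{y, w} \<notin> E" using nv nx y' \<open>y' = v\<close> w(2) by auto
    then have "{w, v} \<notin> E" "{w, x} \<notin> E" "{w, y} \<notin> E" by (simp_all add: insert_commute)
    then have "p \<noteq> v" "p \<noteq> x" "p \<noteq> y" "q \<noteq> v" "q \<noteq> x" "q \<noteq> y" using nw by auto
    then show False using pq w(1) by auto
  qed
  then have "x' = w \<or> x' = u" using x'(1-3) w(1) by auto
  then show ?thesis
  proof
    assume "x' = w"
    then have nx: "\<forall>z. {x, z} \<in> E \<longleftrightarrow> z = v \<or> z = w" using x'(4) by simp
    have "E = cycle_edges [v, x, w, u, y]" using E nv nx w by (rule two_regular_cycle_5_aux)
    then show ?thesis using w by (intro exI[of _ "[v, x, w, u, y]"]) auto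
  next
    assume "x' = u"
    then have nx: "\<forall>z. {x, z} \<in> E \<longleftrightarrow> z = v \<or> z = u" using x'(4) by simp
    have "V = {v, x, y, u, w}" "distinct [v, x, y, u, w]" using w by auto
    with E nv nx have "E = cycle_edges [v, x, u, w, y]" by (rule two_regular_cycle_5_aux)
    then show ?thesis using w by (intro exI[of _ "[v, x, u, w, y]"]) auto
  qed
qed

lemma vertices_bij_image_system:
  assumes \<phi>: "bij_betw \<phi> V V'" and E: "\<And>e. e \<in> E \<Longrightarrow> e \<subseteq> V" and E': "(`) \<phi> ` E = E'"
  shows "order_iso ({{}, V} \<union> (\<lambda>v. {v}) ` V \<union> E) ({{}, V'} \<union> (\<lambda>v. {v}) ` V' \<union> E')"
proof (rule order_isoI_embedding[of "(`) \<phi>"])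
  have im: "\<phi> ` V = V'" using \<phi> by (simp add: bij_betw_def)
  then have "(`) \<phi> ` (\<lambda>v. {v}) ` V = (\<lambda>v. {v}) ` V'" by (auto simp: image_image)
  then show "(`) \<phi> ` ({{}, V} \<union> (\<lambda>v. {v}) ` V \<union> E) = {{}, V'} \<union> (\<lambda>v. {v}) ` V' \<union> E'"
    using im E' by (simp add: image_Un)
  fix A B assume "A \<in> {{}, V} \<union> (\<lambda>v. {v}) ` V \<union> E" "B \<in> {{}, V} \<union> (\<lambda>v. {v}) ` V \<union> E"
  then have "A \<subseteq> V" "B \<subseteq> V" using E by auto
  then show "A \<subseteq> B \<longleftrightarrow> \<phi> ` A \<subseteq> \<phi> ` B"
    using \<phi> unfolding bij_betw_def by (metis inj_on_image_subset_iff)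
qed

lemma image_cycle_edges:
  assumes "\<And>i. i < length xs \<Longrightarrow> \<phi> (xs ! i) = ys ! i" "length xs = length ys"
  shows "(`) \<phi> ` cycle_edges xs = cycle_edges ys"
proof -
  have "\<phi> ` {xs ! i, xs ! (Suc i mod length xs)} = {ys ! i, ys ! (Suc i mod length ys)}"
    if "i < length xs" for i
  proof -
    have "Suc i mod length xs < length xs" using that by (intro mod_less_divisor) linarith
    then show ?thesis using assms that by simp
  qed
  then show ?thesis
    unfolding cycle_edges_def image_image using assms(2) by (intro image_cong) auto
qed

lemma two_regular_polygon:
  fixes S :: "'a::euclidean_space set"
  assumes "polytope S" "aff_dim S = 2"
  shows "two_regular (vertices S) (edges S)"
  unfolding two_regular_def
proof (intro conjI ballI)
  show "e \<subseteq> vertices S" "card e = 2" if "e \<in> edges S" for e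
    using that edge_subset card_edge assms(1) by auto
  show "card {e \<in> edges S. v \<in> e} = 2" if "v \<in> vertices S" for v
    using assms that by (rule vertex_in_two_edges)
qed

lemma small_polygon_edges:
  fixes S :: "'a::euclidean_space set"
  assumes S: "polytope S" "aff_dim S = 2" and card: "card (vertices S) \<le> 5"
  shows "\<exists>xs. distinct xs \<and> set xs = vertices S \<and> edges S = cycle_edges xs"
proof -
  have "3 \<le> card (vertices S)" using card_vertices_ge[OF S(1)] S(2) by simp
  then consider "card (vertices S) = 3" | "card (vertices S) = 4" | "card (vertices S) = 5"
    using card by linarith
  then show ?thesis
    using two_regular_cycle_3 two_regular_cycle_4 two_regular_cycle_5
      two_regular_polygon[OF S] finite_vertices[OF S(1)] by cases blast+
qed

lemma comb_equiv_small_polygons: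
  fixes S S' :: "'a::euclidean_space set"
  assumes S: "polytope S" "aff_dim S \<le> 2" and S': "polytope S'" "aff_dim S' \<le> 2"
    and card: "card (vertices S) = card (vertices S')" "card (vertices S) \<le> 5"
  shows "comb_equiv S S'"
proof -
  have fin: "finite (vertices S)" "finite (vertices S')" using S S' finite_vertices by auto
  have "\<exists>\<phi>. bij_betw \<phi> (vertices S) (vertices S') \<and> (`) \<phi> ` edges S = edges S'"
  \<comment> \<open>The number of vertices decides the dimension: at most two vertices force
    dimension at most 1, where there are no edges, and more than two force dimension 2.\<close>
  proof (cases "card (vertices S) \<le> 2")
    case True
    then have "aff_dim S \<le> 1" "aff_dim S' \<le> 1"
      using card_vertices_ge[OF S(1)] card_vertices_ge[OF S'(1)] card(1) by auto
    then have "edges S = {}" "edges S' = {}" using edges_low_dim S(1) S'(1) by blast+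
    moreover obtain \<phi> where "bij_betw \<phi> (vertices S) (vertices S')"
      using finite_same_card_bij[OF fin card(1)] by blast
    ultimately show ?thesis by auto
  next
    case False
    then have "\<not> aff_dim S \<le> 1" "\<not> aff_dim S' \<le> 1"
      using card_vertices_low_dim S(1) S'(1) card(1) by force+
    then have "aff_dim S = 2" "aff_dim S' = 2" using S(2) S'(2) by auto
    then obtain xs ys where xs: "distinct xs" "set xs = vertices S" "edges S = cycle_edges xs"
      and ys: "distinct ys" "set ys = vertices S'" "edges S' = cycle_edges ys"
      using small_polygon_edges S(1) S'(1) card by metis
    have len: "length xs = length ys"
      using xs(1,2) ys(1,2) card(1) distinct_card by metis
    have bx: "bij_betw ((!) xs) {..<length xs} (vertices S)"
      using xs by (intro bij_betw_nth) auto
    have nys: "bij_betw ((!) ys) {..<length xs} (vertices S')"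
      using ys len by (intro bij_betw_nth) auto
    define \<phi> where "\<phi> = (!) ys \<circ> inv_into {..<length xs} ((!) xs)"
    have "bij_betw \<phi> (vertices S) (vertices S')"
      unfolding \<phi>_def using bij_betw_trans[OF bij_betw_inv_into[OF bx] nys] .
    moreover have "\<phi> (xs ! i) = ys ! i" if "i < length xs" for i
      unfolding \<phi>_def using bx that by (simp add: bij_betw_def)
    then have "(`) \<phi> ` edges S = edges S'"
      unfolding xs(3) ys(3) using len by (rule image_cycle_edges)
    ultimately show ?thesis by blast
  qed
  then obtain \<phi> where \<phi>: "bij_betw \<phi> (vertices S) (vertices S')" "(`) \<phi> ` edges S = edges S'" by blast
  have "order_iso (vertex_sets S) (vertex_sets S')"
    unfolding vertex_sets_polygon[OF S] vertex_sets_polygon[OF S']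
    using \<phi>(1) edge_subset \<phi>(2) by (rule vertices_bij_image_system)
  then show ?thesis
    unfolding comb_equiv_iff
    using face_lattice_vertex_sets[OF S(1)] face_lattice_vertex_sets[OF S'(1)]
      order_iso_trans order_iso_sym by blast
qed

section \<open>Prism and pyramid\<close>

definition halfspaces :: "('a::euclidean_space \<times> real) set \<Rightarrow> 'a set" where
  "halfspaces K = {x. \<forall>(a, b)\<in>K. a \<bullet> x \<le> b}"

lemma halfspaces_insert: "x \<in> halfspaces (insert (a, b) K) \<longleftrightarrow> a \<bullet> x \<le> b \<and> x \<in> halfspaces K"
  by (simp add: halfspaces_def)

lemma halfspaces_empty: "halfspaces {} = UNIV"
  by (simp add: halfspaces_def)

text \<open>The library description of facets wants an irredundant family of halfspaces, so a
  minimal subfamily \<open>K'\<close> that still describes \<open>S\<close> within its affine hull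
  is used.\<close>

lemma facets_of_halfspaces:
  fixes S :: "'a::euclidean_space set"
  assumes K: "finite K" "0 \<notin> fst ` K"
    and W: "affine W" and S: "S = W \<inter> halfspaces K"
  shows "{F. F facet_of S} \<subseteq> (\<lambda>(a, b). S \<inter> {x. a \<bullet> x = b}) ` K"
proof -
  define hs where "hs = (\<lambda>(a, b). {x :: 'a. a \<bullet> x \<le> b})"
  have S': "S = affine hull S \<inter> \<Inter>(hs ` K)"
  proof -
    have "affine hull S \<subseteq> W" using W S by (simp add: hull_minimal)
    moreover have "\<Inter>(hs ` K) = halfspaces K" by (auto simp: hs_def halfspaces_def)
    moreover have "S \<subseteq> affine hull S" by (rule hull_subset)
    ultimately show ?thesis using S by blast
  qed
  let ?\<C> = "{K'. K' \<subseteq> K \<and> S = affine hull S \<inter> \<Inter>(hs ` K')}"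
  have "finite ?\<C>" using K(1) by (auto intro: finite_subset[of _ "Pow K"])
  moreover have "?\<C> \<noteq> {}" using S' by blast
  ultimately obtain K' where K': "K' \<in> ?\<C>" "\<forall>L\<in>?\<C>. L \<subseteq> K' \<longrightarrow> K' = L"
    by (rule finite_has_minimal[THEN bexE]) blast
  \<comment> \<open>Different pairs can describe the same halfspace, for instance multiples of each
    other; \<open>rep\<close> fixes one pair for each.\<close>
  define rep where "rep = inv_into K' hs"
  have rep: "rep h \<in> K'" "hs (rep h) = h" if "h \<in> hs ` K'" for h
    unfolding rep_def using that by (rule inv_into_into, rule f_inv_into_f)
  have seq: "S = affine hull S \<inter> \<Inter>(hs ` K')" using K'(1) by blast
  have faceq: "fst (rep h) \<noteq> 0 \<and> h = {x. fst (rep h) \<bullet> x \<le> snd (rep h)}" if "h \<in> hs ` K'" for h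
  proof -
    obtain a b where ab: "rep h = (a, b)" by (cases "rep h")
    then have "(a, b) \<in> K" using rep(1)[OF that] K'(1) by auto
    moreover have "h = {x. a \<bullet> x \<le> b}" using rep(2)[OF that] ab by (simp add: hs_def)
    ultimately show ?thesis using K(2) ab by force
  qed
  have psub: "S \<subset> affine hull S \<inter> \<Inter>F'" if F': "F' \<subset> hs ` K'" for F'
  proof -
    obtain L where L: "L \<subseteq> K'" "F' = hs ` L" using F' by (meson psubset_imp_subset subset_imageE)
    have "L \<noteq> K'" using F' L by blast
    then have "L \<notin> ?\<C>" using K'(2) L(1) by blast
    then have "S \<noteq> affine hull S \<inter> \<Inter>F'" using L K'(1) by blast
    moreover have "S \<subseteq> affine hull S \<inter> \<Inter>F'" using seq F' by blast
    ultimately show ?thesis by blast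
  qed
  show ?thesis
  proof
    fix F assume "F \<in> {F. F facet_of S}"
    then have "F facet_of S" by simp
    moreover have "finite (hs ` K')" using K'(1) K(1) by (auto intro: finite_subset)
    ultimately obtain h where h: "h \<in> hs ` K'" "F = S \<inter> {x. fst (rep h) \<bullet> x = snd (rep h)}"
      using facet_of_polyhedron_explicit[of "hs ` K'" S "\<lambda>h. fst (rep h)" "\<lambda>h. snd (rep h)" F] seq faceq psub
      by blast
    have "rep h \<in> K" using rep(1)[OF h(1)] K'(1) by blast
    then show "F \<in> (\<lambda>(a, b). S \<inter> {x. a \<bullet> x = b}) ` K"
      using h(2) by (auto simp: case_prod_unfold)
  qed
qed

text \<open>In dimension 2 there are as many vertices as facets, and each facet comes from an
  inequality. Lower dimensions allow two vertices, whence \<open>2 \<le> n\<close>.\<close>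

lemma card_vertices_halfspaces_polygon:
  fixes S :: "'a::euclidean_space set"
  assumes K: "finite K" "0 \<notin> fst ` K" "card K \<le> n" "2 \<le> n"
    and W: "affine W" and S: "S = W \<inter> halfspaces K" "polytope S" "aff_dim S \<le> 2"
  shows "card (vertices S) \<le> n"
proof (cases "aff_dim S = 2")
  case True
  have "card {F. F facet_of S} \<le> card ((\<lambda>(a, b). S \<inter> {x. a \<bullet> x = b}) ` K)"
    using facets_of_halfspaces[OF K(1,2) W S(1)] K(1) by (intro card_mono) auto
  also have "\<dots> \<le> card K" using K(1) by (rule card_image_le)
  finally show ?thesis using card_facets_polygon[OF S(2) True] K(3) by simp
next
  case False
  then have "aff_dim S \<le> 1" using S(3) by simp
  then show ?thesis using card_vertices_low_dim[OF S(2)] K(4) by simp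
qed

lemma unique_maximum_vertex:
  fixes c :: "'a::real_inner"
  assumes "v \<in> S" "\<And>x. x \<in> S \<Longrightarrow> c \<bullet> x \<le> c \<bullet> v" "\<And>x. x \<in> S \<Longrightarrow> c \<bullet> x = c \<bullet> v \<Longrightarrow> x = v"
  shows "v \<in> vertices S"
proof -
  have "S \<inter> {x. c \<bullet> x = c \<bullet> v} = {v}" using assms(1,3) by blast
  moreover have "S \<inter> {x. c \<bullet> x = c \<bullet> v} face_of S"
    using assms(2) calculation by (intro face_of_Int_supporting_hyperplane_le_strong) auto
  ultimately show ?thesis by (simp add: vertices_def face_of_singleton)
qed

text \<open>The dimension bound excludes a single point, whose empty face is a coatom but not a
  facet.\<close>

lemma coatom_imp_facet:
  fixes S :: "'a::euclidean_space set"
  assumes S: "polytope S" and dim: "1 \<le> aff_dim S" and F: "F \<in> coatoms (face_lattice S)"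
  shows "F facet_of S"
proof -
  have FS: "F face_of S" and c2: "card {G \<in> face_lattice S. F \<subseteq> G} = 2"
    using F by (auto simp: coatoms_def face_lattice_def)
  have top: "S \<in> face_lattice S" using S by (simp add: face_lattice_def face_of_refl polytope_imp_convex)
  have only: "G = F \<or> G = S" if "F \<noteq> S" "G face_of S" "F \<subseteq> G" for G
  proof -
    have "{F, S} \<subseteq> {G \<in> face_lattice S. F \<subseteq> G}"
      using FS top face_of_imp_subset by (auto simp: face_lattice_def)
    moreover have "finite {G \<in> face_lattice S. F \<subseteq> G}" using c2 by (intro card_ge_0_finite) simp
    ultimately have "{F, S} = {G \<in> face_lattice S. F \<subseteq> G}"
      using c2 that(1) by (intro card_subset_eq) auto
    then show ?thesis using that(2,3) by (auto simp: face_lattice_def)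
  qed
  have "F \<noteq> S"
  proof
    assume "F = S"
    then have "{G \<in> face_lattice S. F \<subseteq> G} = {S}"
      using top by (auto simp: face_lattice_def dest: face_of_imp_subset)
    then show False using c2 by simp
  qed
  have "F \<noteq> {}"
  proof
    assume "F = {}"
    have "S \<noteq> {}" using dim by auto
    then have "vertices S \<noteq> {}" using hull_vertices[OF S] by auto
    then obtain v where "v \<in> vertices S" by blast
    then have "{v} face_of S" by (simp add: vertices_def face_of_singleton)
    then have "{v} = S" using only[OF \<open>F \<noteq> S\<close>, of "{v}"] \<open>F = {}\<close> by blast
    then show False using dim by (metis aff_dim_sing not_one_le_zero)
  qed
  obtain G where "G facet_of S" "F \<subseteq> G"
    using face_of_polyhedron_subset_facet[OF polytope_imp_polyhedron[OF S] FS \<open>F \<noteq> {}\<close> \<open>F \<noteq> S\<close>] .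
  then have "G = F" using only[OF \<open>F \<noteq> S\<close>, of G] facet_of_imp_face_of by (metis facet_of_irrefl)
  then show ?thesis using \<open>G facet_of S\<close> by simp
qed

lemma facet_imp_coatom:
  fixes S :: "'a::euclidean_space set"
  assumes S: "polytope S" and F: "F facet_of S"
  shows "F \<in> coatoms (face_lattice S)"
proof -
  have FS: "F face_of S" using F by (rule facet_of_imp_face_of)
  have "G = F \<or> G = S" if G: "G face_of S" "F \<subseteq> G" for G
  proof (rule ccontr)
    assume *: "\<not> (G = F \<or> G = S)"
    have "F face_of G" using FS G face_of_subset face_of_imp_subset by blast
    moreover have "convex G" using G(1) face_of_imp_convex by blast
    ultimately have "aff_dim F < aff_dim G" using * face_of_aff_dim_lt by metis
    moreover have "aff_dim G < aff_dim S"
      using * G(1) S face_of_aff_dim_lt polytope_imp_convex by metis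
    ultimately show False using F by (simp add: facet_of_def)
  qed
  moreover have "S face_of S" using S by (simp add: face_of_refl polytope_imp_convex)
  moreover have "F \<subseteq> S" using FS by (rule face_of_imp_subset)
  ultimately have "{G \<in> face_lattice S. F \<subseteq> G} = {F, S}"
    using FS by (auto simp: face_lattice_def)
  moreover have "F \<noteq> S" using F facet_of_irrefl by blast
  ultimately show ?thesis using FS by (simp add: coatoms_def face_lattice_def)
qed

text \<open>For face lattices: any two facets have a common point. That \<open>C\<close> is not the
  empty face is expressed by its not being the least element, which isomorphisms preserve.\<close>

definition coatoms_meet :: "'a set set \<Rightarrow> bool" where
  "coatoms_meet \<F> \<longleftrightarrow>
     (\<forall>A\<in>coatoms \<F>. \<forall>B\<in>coatoms \<F>. \<exists>C\<in>\<F>. C \<subseteq> A \<and> C \<subseteq> B \<and> (\<exists>D\<in>\<F>. \<not> C \<subseteq> D))"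

lemma coatoms_meet_order_iso:
  assumes "order_iso \<F> \<G>" "coatoms_meet \<F>"
  shows "coatoms_meet \<G>"
proof -
  obtain f where f: "bij_betw f \<F> \<G>" "\<forall>A\<in>\<F>. \<forall>B\<in>\<F>. A \<subseteq> B \<longleftrightarrow> f A \<subseteq> f B"
    using assms(1) unfolding order_iso_def by blast
  have im: "coatoms \<G> = f ` coatoms \<F>" using image_coatoms[OF f] by simp
  show ?thesis
    unfolding coatoms_meet_def im
  proof (intro ballI)
    fix A' B' assume "A' \<in> f ` coatoms \<F>" "B' \<in> f ` coatoms \<F>"
    then obtain A B where AB: "A \<in> coatoms \<F>" "B \<in> coatoms \<F>" "A' = f A" "B' = f B" by blast
    obtain C D where CD: "C \<in> \<F>" "C \<subseteq> A" "C \<subseteq> B" "D \<in> \<F>" "\<not> C \<subseteq> D"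
      using assms(2)[unfolded coatoms_meet_def, rule_format, OF AB(1,2)] by blast
    have "A \<in> \<F>" "B \<in> \<F>" using AB by (auto simp: coatoms_def)
    then have "f C \<subseteq> A'" "f C \<subseteq> B'" "\<not> f C \<subseteq> f D" using f(2) CD AB(3,4) by auto
    moreover have "f C \<in> \<G>" "f D \<in> \<G>" using f(1) CD by (auto simp: bij_betw_def)
    ultimately show "\<exists>C\<in>\<G>. C \<subseteq> A' \<and> C \<subseteq> B' \<and> (\<exists>D\<in>\<G>. \<not> C \<subseteq> D)" by blast
  qed
qed

section \<open>The two solids in coordinates\<close>

locale three_coords =
  fixes i j k :: "'n::finite"
  assumes distinct: "i \<noteq> j" "i \<noteq> k" "j \<noteq> k" and all: "UNIV = {i, j, k}"
begin

definition pt :: "real \<Rightarrow> real \<Rightarrow> real \<Rightarrow> real ^ 'n" where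
  "pt a b c = axis i a + axis j b + axis k c"

lemma pt_nth [simp]: "pt a b c $ i = a" "pt a b c $ j = b" "pt a b c $ k = c"
  using distinct by (auto simp: pt_def axis_def)

lemma inner_pt [simp]: "pt a b c \<bullet> x = a * x $ i + b * x $ j + c * x $ k"
  by (simp add: pt_def inner_add_left inner_axis')

lemma vec_eq_coords: "x = y \<longleftrightarrow> x $ i = y $ i \<and> x $ j = y $ j \<and> x $ k = (y :: real ^ 'n) $ k"
proof -
  have "(\<forall>l. x $ l = y $ l) \<longleftrightarrow> (\<forall>l\<in>{i, j, k}. x $ l = y $ l)" using all by (metis UNIV_I)
  then show ?thesis by (simp add: vec_eq_iff)
qed

lemma pt_eq_0 [simp]: "pt a b c = 0 \<longleftrightarrow> a = 0 \<and> b = 0 \<and> c = 0"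
  by (simp add: vec_eq_coords)

definition prism_ineqs :: "((real ^ 'n) \<times> real) set" where
  "prism_ineqs = {(pt (-1) 0 0, 0), (pt 0 (-1) 0, 0), (pt 1 1 0, 1), (pt 0 0 (-1), 0), (pt 0 0 1, 1)}"

text \<open>The base is the unit square at height 0 and the apex \<open>pt 1 1 1\<close> stands
  above one of its corners; the section at height h is the square with both coordinates between h
  and 1.\<close>

definition pyramid_ineqs :: "((real ^ 'n) \<times> real) set" where
  "pyramid_ineqs = {(pt 0 0 (-1), 0), (pt (-1) 0 1, 0), (pt 0 (-1) 1, 0), (pt 1 0 0, 1), (pt 0 1 0, 1)}"

abbreviation "prism \<equiv> halfspaces prism_ineqs"
abbreviation "pyramid \<equiv> halfspaces pyramid_ineqs"

lemma mem_prism: "x \<in> prism \<longleftrightarrow> 0 \<le> x $ i \<and> 0 \<le> x $ j \<and> x $ i + x $ j \<le> 1 \<and> 0 \<le> x $ k \<and> x $ k \<le> 1"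
  unfolding prism_ineqs_def halfspaces_insert halfspaces_empty by auto

lemma mem_pyramid: "x \<in> pyramid \<longleftrightarrow> 0 \<le> x $ k \<and> x $ k \<le> x $ i \<and> x $ k \<le> x $ j \<and> x $ i \<le> 1 \<and> x $ j \<le> 1"
  unfolding pyramid_ineqs_def halfspaces_insert halfspaces_empty by auto

lemma ineqs_nonzero:
  "0 \<notin> fst ` prism_ineqs" "0 \<notin> fst ` pyramid_ineqs"
  by (simp_all add: prism_ineqs_def pyramid_ineqs_def eq_commute[of 0])

lemma finite_ineqs: "finite prism_ineqs" "finite pyramid_ineqs"
  by (simp_all add: prism_ineqs_def pyramid_ineqs_def)

lemma card_ineqs: "card prism_ineqs \<le> 5" "card pyramid_ineqs \<le> 5"
  by (simp_all add: prism_ineqs_def pyramid_ineqs_def card_insert_if)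

lemma bounded_by_unit_cube:
  assumes "\<And>x. x \<in> S \<Longrightarrow> 0 \<le> x $ i \<and> x $ i \<le> 1 \<and> 0 \<le> x $ j \<and> x $ j \<le> 1 \<and> 0 \<le> x $ k \<and> x $ k \<le> (1::real)"
  shows "bounded S"
proof (rule bounded_subset)
  show "S \<subseteq> cbox 0 (pt 1 1 1)"
  proof
    fix x assume x: "x \<in> S"
    have "0 \<le> x $ l \<and> x $ l \<le> pt 1 1 1 $ l" for l
    proof -
      have "l \<in> {i, j, k}" using all by blast
      then show ?thesis using assms[OF x] by auto
    qed
    then show "x \<in> cbox 0 (pt 1 1 1)" by (simp add: mem_box_cart)
  qed
qed (rule bounded_cbox)

lemma polyhedron_halfspaces:
  assumes "finite (K :: ((real ^ 'n) \<times> real) set)"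
  shows "polyhedron (halfspaces K)"
proof -
  have "halfspaces K = \<Inter>((\<lambda>(a, b). {x. a \<bullet> x \<le> b}) ` K)" by (auto simp: halfspaces_def)
  then show ?thesis
    using assms by (auto intro!: polyhedron_Inter simp: polyhedron_halfspace_le)
qed

lemma polytope_prism: "polytope prism"
proof -
  have "bounded prism" by (rule bounded_by_unit_cube) (auto simp: mem_prism)
  then show ?thesis
    using polyhedron_halfspaces[OF finite_ineqs(1)] by (simp add: polytope_eq_bounded_polyhedron)
qed

lemma polytope_pyramid: "polytope pyramid"
proof -
  have "bounded pyramid" by (rule bounded_by_unit_cube) (auto simp: mem_pyramid)
  then show ?thesis
    using polyhedron_halfspaces[OF finite_ineqs(2)] by (simp add: polytope_eq_bounded_polyhedron)
qed

lemma full_dimI: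
  assumes S: "polytope S" and mem: "pt 0 0 0 \<in> S" "pt 1 0 0 \<in> S" "pt 0 1 0 \<in> S" "pt p q r \<in> S" "r \<noteq> 0"
  shows "full_dim_polytope S"
proof -
  have "\<not> aff_dim S < int DIM(real ^ 'n)"
  proof
    assume "aff_dim S < int DIM(real ^ 'n)"
    then obtain a b where ab: "a \<noteq> 0" "S \<subseteq> {x. a \<bullet> x = b}"
      using aff_lowdim_subset_hyperplane by metis
    have "pt p q r \<bullet> a = b" "pt 0 0 0 \<bullet> a = b" "pt 1 0 0 \<bullet> a = b" "pt 0 1 0 \<bullet> a = b"
      using ab(2) mem by (auto simp: inner_commute[of _ a])
    then have "a $ i = 0 \<and> a $ j = 0 \<and> r * a $ k = 0" by simp
    then have "a = 0" using mem(5) by (simp add: vec_eq_coords)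
    then show False using ab(1) by simp
  qed
  then show ?thesis
    using S aff_dim_le_DIM[of S] by (simp add: full_dim_polytope_def)
qed

lemma full_dim_prism: "full_dim_polytope prism"
  by (rule full_dimI[OF polytope_prism, of 0 0 1]) (auto simp: mem_prism)

lemma full_dim_pyramid: "full_dim_polytope pyramid"
  by (rule full_dimI[OF polytope_pyramid, of 1 1 1]) (auto simp: mem_pyramid)

lemma aff_dim_slice:
  assumes "affine_hyperplane (H :: (real ^ 'n) set)"
  shows "aff_dim (S \<inter> H) \<le> 2"
proof -
  obtain a b where ab: "a \<noteq> 0" "H = {x. a \<bullet> x = b}"
    using assms unfolding affine_hyperplane_def by blast
  have "CARD('n) = 3" using distinct by (simp add: all)
  then have "aff_dim H = 2" using ab by (simp add: aff_dim_hyperplane)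
  moreover have "aff_dim (S \<inter> H) \<le> aff_dim H" by (intro aff_dim_subset) auto
  ultimately show ?thesis by simp
qed

lemma slice_affine: "affine_hyperplane (H :: (real ^ 'n) set) \<Longrightarrow> affine H"
  by (auto simp: affine_hyperplane_def affine_hyperplane)

lemma slice_polytope:
  assumes "polytope S" "affine_hyperplane (H :: (real ^ 'n) set)"
  shows "polytope (S \<inter> H)"
proof -
  have "polyhedron H" using assms(2) by (auto simp: affine_hyperplane_def polyhedron_hyperplane)
  then show ?thesis by (rule polytope_Int_polyhedron[OF assms(1)])
qed

lemma slice_vertices_le_5:
  assumes "affine_hyperplane (H :: (real ^ 'n) set)"
  shows "card (vertices (prism \<inter> H)) \<le> 5" "card (vertices (pyramid \<inter> H)) \<le> 5"
proof -
  show "card (vertices (prism \<inter> H)) \<le> 5"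
  proof (rule card_vertices_halfspaces_polygon[OF finite_ineqs(1) ineqs_nonzero(1) card_ineqs(1)])
    show "prism \<inter> H = H \<inter> prism" by (rule Int_commute)
  qed (use assms in \<open>simp_all add: slice_affine slice_polytope polytope_prism aff_dim_slice\<close>)
  show "card (vertices (pyramid \<inter> H)) \<le> 5"
  proof (rule card_vertices_halfspaces_polygon[OF finite_ineqs(2) ineqs_nonzero(2) card_ineqs(2)])
    show "pyramid \<inter> H = H \<inter> pyramid" by (rule Int_commute)
  qed (use assms in \<open>simp_all add: slice_affine slice_polytope polytope_pyramid aff_dim_slice\<close>)
qed

definition all_small_slices :: "(real ^ 'n) set \<Rightarrow> bool" where
  "all_small_slices Q \<longleftrightarrow> (\<forall>N\<le>5. \<exists>H. affine_hyperplane H \<and> card (vertices (Q \<inter> H)) = N)"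

lemma slice_types_subset_if_small:
  assumes P: "polytope P" "\<And>H. affine_hyperplane H \<Longrightarrow> card (vertices (P \<inter> H)) \<le> 5"
    and Q: "polytope Q" "all_small_slices Q"
  shows "slice_types P \<subseteq> slice_types Q"
proof
  fix T assume "T \<in> slice_types P"
  then obtain H where H: "affine_hyperplane H" "T = comb_type (P \<inter> H)"
    unfolding slice_types_def by blast
  obtain H' where H': "affine_hyperplane H'" "card (vertices (Q \<inter> H')) = card (vertices (P \<inter> H))"
    using Q(2) P(2)[OF H(1)] unfolding all_small_slices_def by blast
  have "comb_equiv (P \<inter> H) (Q \<inter> H')"
    using H H' P Q by (intro comb_equiv_small_polygons slice_polytope aff_dim_slice) auto
  then have "T = comb_type (Q \<inter> H')" using H(2) comb_type_cong by blast
  then show "T \<in> slice_types Q" unfolding slice_types_def using H'(1) by blast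
qed

text \<open>For three and four vertices, the listed points give the lower bound and the number of
  inequalities left on the hyperplane gives the upper one. For five vertices the general bound on
  slices of \<open>Q\<close> is the upper one.\<close>

lemma all_small_slicesI:
  assumes Q: "polytope Q" "\<And>H. affine_hyperplane H \<Longrightarrow> card (vertices (Q \<inter> H)) \<le> 5"
    and H: "a1 \<noteq> 0" "a2 \<noteq> 0" "a3 \<noteq> 0" "a4 \<noteq> 0" "a5 \<noteq> 0"
    and 1: "Q \<inter> {x. a1 \<bullet> x = b1} = {p}"
    and 2: "Q \<inter> {x. a2 \<bullet> x = b2} = closed_segment q r" "q \<noteq> r"
    and 3: "Q \<inter> {x. a3 \<bullet> x = b3} = {x. a3 \<bullet> x = b3} \<inter> halfspaces K3" "finite K3" "card K3 \<le> 3"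
      "0 \<notin> fst ` K3" "3 \<le> card V3" "V3 \<subseteq> vertices (Q \<inter> {x. a3 \<bullet> x = b3})"
    and 4: "Q \<inter> {x. a4 \<bullet> x = b4} = {x. a4 \<bullet> x = b4} \<inter> halfspaces K4" "finite K4" "card K4 \<le> 4"
      "0 \<notin> fst ` K4" "4 \<le> card V4" "V4 \<subseteq> vertices (Q \<inter> {x. a4 \<bullet> x = b4})"
    and 5: "5 \<le> card V5" "V5 \<subseteq> vertices (Q \<inter> {x. a5 \<bullet> x = b5})"
  shows "all_small_slices Q"
  unfolding all_small_slices_def
proof (intro allI impI)
  fix N :: nat assume "N \<le> 5"
  have hyp: "affine_hyperplane {x. a \<bullet> x = b}" if "a \<noteq> 0" for a :: "real ^ 'n" and b
    using that unfolding affine_hyperplane_def by blast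
  have ge: "card V \<le> card (vertices (Q \<inter> {x. a \<bullet> x = b}))"
    if "V \<subseteq> vertices (Q \<inter> {x. a \<bullet> x = b})" "a \<noteq> 0" for V a b
    using that by (intro card_mono finite_vertices slice_polytope[OF Q(1)] hyp) auto
  have le: "card (vertices (Q \<inter> {x. a \<bullet> x = b})) \<le> n"
    if "Q \<inter> {x. a \<bullet> x = b} = {x. a \<bullet> x = b} \<inter> halfspaces K" "finite K" "card K \<le> n" "2 \<le> n"
      "0 \<notin> fst ` K" "a \<noteq> 0" for a b K n
    using that(2,5,3,4) affine_hyperplane that(1) slice_polytope[OF Q(1) hyp[OF that(6)]]
      aff_dim_slice[OF hyp[OF that(6)]]
    by (rule card_vertices_halfspaces_polygon)
  consider "N = 0" | "N = 1" | "N = 2" | "N = 3" | "N = 4" | "N = 5" using \<open>N \<le> 5\<close> by linarith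
  then show "\<exists>H. affine_hyperplane H \<and> card (vertices (Q \<inter> H)) = N"
  proof cases
    case 1
    obtain H :: "(real ^ 'n) set" where "affine_hyperplane H" "Q \<inter> H = {}"
      using bounded_missed_by_hyperplane polytope_imp_bounded[OF Q(1)] by blast
    then show ?thesis using 1 by (intro exI[of _ H]) (simp add: vertices_def)
  next
    case 2
    have "vertices {p} = {p}" by (auto simp: vertices_def)
    then show ?thesis using 2 \<open>Q \<inter> {x. a1 \<bullet> x = b1} = {p}\<close> hyp[OF H(1), of b1]
      by (intro exI[of _ "{x. a1 \<bullet> x = b1}"]) simp
  next
    case 3
    have "vertices (closed_segment q r) = {q, r}" by (auto simp: vertices_def extreme_point_of_segment)
    then show ?thesis using 3 \<open>q \<noteq> r\<close> hyp[OF H(2), of b2]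
      by (intro exI[of _ "{x. a2 \<bullet> x = b2}"]) (simp add: \<open>Q \<inter> {x. a2 \<bullet> x = b2} = closed_segment q r\<close>)
  next
    case 4
    have "card (vertices (Q \<inter> {x. a3 \<bullet> x = b3})) = 3"
      using ge[OF assms(16) H(3)] le[OF assms(11-13) _ assms(14) H(3)] assms(15) by simp
    then show ?thesis using 4 hyp[OF H(3), of b3] by blast
  next
    case 5
    have "card (vertices (Q \<inter> {x. a4 \<bullet> x = b4})) = 4"
      using ge[OF assms(22) H(4)] le[OF assms(17-19) _ assms(20) H(4)] assms(21) by simp
    then show ?thesis using 5 hyp[OF H(4), of b4] by blast
  next
    case 6
    have "card (vertices (Q \<inter> {x. a5 \<bullet> x = b5})) = 5"
      using ge[OF assms(24) H(5)] Q(2)[OF hyp[OF H(5), of b5]] assms(23) by simp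
    then show ?thesis using 6 hyp[OF H(5), of b5] by blast
  qed
qed

lemma vertexI:
  fixes x :: "real ^ 'n"
  assumes "x \<in> S" "\<And>y. y \<in> S \<Longrightarrow> c1 * y $ i + c2 * y $ j + c3 * y $ k \<le> c1 * x $ i + c2 * x $ j + c3 * x $ k"
    "\<And>y. y \<in> S \<Longrightarrow> c1 * y $ i + c2 * y $ j + c3 * y $ k = c1 * x $ i + c2 * x $ j + c3 * x $ k \<Longrightarrow>
      y $ i = x $ i \<and> y $ j = x $ j \<and> y $ k = x $ k"
  shows "x \<in> vertices S"
proof (rule unique_maximum_vertex[of x S "pt c1 c2 c3"])
  show "x \<in> S" by (rule assms(1))
  show "pt c1 c2 c3 \<bullet> y \<le> pt c1 c2 c3 \<bullet> x" if "y \<in> S" for y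
    using assms(2)[OF that] by simp
  show "y = x" if "y \<in> S" "pt c1 c2 c3 \<bullet> y = pt c1 c2 c3 \<bullet> x" for y
    using assms(3)[OF that(1)] that(2) unfolding vec_eq_coords by simp
qed

lemma segment_j: "closed_segment (pt 0 0 0) (pt 0 1 0) = {x. x $ i = 0 \<and> x $ k = 0 \<and> 0 \<le> x $ j \<and> x $ j \<le> 1}"
proof (intro set_eqI iffI)
  fix x assume "x \<in> closed_segment (pt 0 0 0) (pt 0 1 0)"
  then show "x \<in> {x. x $ i = 0 \<and> x $ k = 0 \<and> 0 \<le> x $ j \<and> x $ j \<le> 1}"
    by (auto simp: closed_segment_def)
next
  fix x :: "real ^ 'n" assume "x \<in> {x. x $ i = 0 \<and> x $ k = 0 \<and> 0 \<le> x $ j \<and> x $ j \<le> 1}"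
  then show "x \<in> closed_segment (pt 0 0 0) (pt 0 1 0)"
    unfolding closed_segment_def
    by (intro CollectI exI[of _ "x $ j"]) (simp add: vec_eq_coords)
qed

text \<open>The planes cut out a vertex, an edge, the bottom triangle and a rectangular facet. The
  last one separates the vertices with values 0, 2, 2 from those with values 4, 4, 6; it crosses
  five edges and meets all five facets.\<close>

lemma prism_slices: "all_small_slices prism"
proof (rule all_small_slicesI[OF polytope_prism slice_vertices_le_5(1),
      of "pt 1 1 1" "pt 1 0 1" "pt 0 0 1" "pt 1 0 0" "pt 2 4 2" 0 "pt 0 0 0" 0 "pt 0 0 0" "pt 0 1 0"
        0 "{(pt (-1) 0 0, 0), (pt 0 (-1) 0, 0), (pt 1 1 0, 1)}" "{pt 0 0 0, pt 1 0 0, pt 0 1 0}"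
        0 "{(pt 0 (-1) 0, 0), (pt 0 1 0, 1), (pt 0 0 (-1), 0), (pt 0 0 1, 1)}"
          "{pt 0 0 0, pt 0 1 0, pt 0 0 1, pt 0 1 1}"
        "{pt 0 (3/4) 0, pt (1/2) (1/2) 0, pt 1 0 (1/2), pt (1/2) 0 1, pt 0 (1/4) 1}" 3])
  show "prism \<inter> {x. pt 1 1 1 \<bullet> x = 0} = {pt 0 0 0}"
    by (auto simp: mem_prism vec_eq_coords)
  show "prism \<inter> {x. pt 1 0 1 \<bullet> x = 0} = closed_segment (pt 0 0 0) (pt 0 1 0)"
    unfolding segment_j by (auto simp: mem_prism)
  show "prism \<inter> {x. pt 0 0 1 \<bullet> x = 0} = {x. pt 0 0 1 \<bullet> x = 0} \<inter>
      halfspaces {(pt (-1) 0 0, 0), (pt 0 (-1) 0, 0), (pt 1 1 0, 1)}"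
    by (auto simp: mem_prism halfspaces_insert halfspaces_empty)
  show "prism \<inter> {x. pt 1 0 0 \<bullet> x = 0} = {x. pt 1 0 0 \<bullet> x = 0} \<inter>
      halfspaces {(pt 0 (-1) 0, 0), (pt 0 1 0, 1), (pt 0 0 (-1), 0), (pt 0 0 1, 1)}"
    by (auto simp: mem_prism halfspaces_insert halfspaces_empty)
  let ?T = "prism \<inter> {x. pt 0 0 1 \<bullet> x = 0}"
  have "pt 0 0 0 \<in> vertices ?T" by (rule vertexI[of _ _ "-1" "-1" 0]) (auto simp: mem_prism)
  moreover have "pt 1 0 0 \<in> vertices ?T" by (rule vertexI[of _ _ 1 0 0]) (auto simp: mem_prism)
  moreover have "pt 0 1 0 \<in> vertices ?T" by (rule vertexI[of _ _ 0 1 0]) (auto simp: mem_prism)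
  ultimately show "{pt 0 0 0, pt 1 0 0, pt 0 1 0} \<subseteq> vertices ?T" by simp
  let ?R = "prism \<inter> {x. pt 1 0 0 \<bullet> x = 0}"
  have "pt 0 0 0 \<in> vertices ?R" by (rule vertexI[of _ _ 0 "-1" "-1"]) (auto simp: mem_prism)
  moreover have "pt 0 1 0 \<in> vertices ?R" by (rule vertexI[of _ _ 0 1 "-1"]) (auto simp: mem_prism)
  moreover have "pt 0 0 1 \<in> vertices ?R" by (rule vertexI[of _ _ 0 "-1" 1]) (auto simp: mem_prism)
  moreover have "pt 0 1 1 \<in> vertices ?R" by (rule vertexI[of _ _ 0 1 1]) (auto simp: mem_prism)
  ultimately show "{pt 0 0 0, pt 0 1 0, pt 0 0 1, pt 0 1 1} \<subseteq> vertices ?R" by simp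
  let ?S = "prism \<inter> {x. pt 2 4 2 \<bullet> x = 3}"
  have "pt 0 (3/4) 0 \<in> vertices ?S"
    by (rule vertexI[of _ _ "-1" 0 "-1"]) (auto simp: mem_prism)
  moreover have "pt (1/2) (1/2) 0 \<in> vertices ?S"
    by (rule vertexI[of _ _ 1 1 "-1"]) (auto simp: mem_prism)
  moreover have "pt 1 0 (1/2) \<in> vertices ?S"
    by (rule vertexI[of _ _ 1 0 0]) (auto simp: mem_prism)
  moreover have "pt (1/2) 0 1 \<in> vertices ?S"
    by (rule vertexI[of _ _ 0 "-1" 1]) (auto simp: mem_prism)
  moreover have "pt 0 (1/4) 1 \<in> vertices ?S"
    by (rule vertexI[of _ _ "-1" 0 1]) (auto simp: mem_prism)
  ultimately show "{pt 0 (3/4) 0, pt (1/2) (1/2) 0, pt 1 0 (1/2), pt (1/2) 0 1, pt 0 (1/4) 1} \<subseteq> vertices ?S"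
    by simp
qed (auto simp: vec_eq_coords card_insert_if)

text \<open>Again a vertex, an edge, a triangular facet and the base. The last plane separates
  \<open>pt 0 0 0\<close> and the apex from the other three vertices, crossing two base edges and
  the three remaining lateral edges.\<close>

lemma pyramid_slices: "all_small_slices pyramid"
proof (rule all_small_slicesI[OF polytope_pyramid slice_vertices_le_5(2),
      of "pt 1 1 0" "pt 1 0 0" "pt 1 0 0" "pt 0 0 1" "pt 2 2 (-4)" 0 "pt 0 0 0" 0 "pt 0 0 0" "pt 0 1 0"
        1 "{(pt 0 0 (-1), 0), (pt 0 (-1) 1, 0), (pt 0 1 0, 1)}" "{pt 1 0 0, pt 1 1 0, pt 1 1 1}"
        0 "{(pt (-1) 0 0, 0), (pt 0 (-1) 0, 0), (pt 1 0 0, 1), (pt 0 1 0, 1)}"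
          "{pt 0 0 0, pt 1 0 0, pt 0 1 0, pt 1 1 0}"
        "{pt (1/2) 0 0, pt 0 (1/2) 0, pt 1 (1/2) (1/2), pt (1/2) 1 (1/2), pt 1 1 (3/4)}" 1])
  show "pyramid \<inter> {x. pt 1 1 0 \<bullet> x = 0} = {pt 0 0 0}"
    by (auto simp: mem_pyramid vec_eq_coords)
  show "pyramid \<inter> {x. pt 1 0 0 \<bullet> x = 0} = closed_segment (pt 0 0 0) (pt 0 1 0)"
    unfolding segment_j by (auto simp: mem_pyramid)
  show "pyramid \<inter> {x. pt 1 0 0 \<bullet> x = 1} = {x. pt 1 0 0 \<bullet> x = 1} \<inter>
      halfspaces {(pt 0 0 (-1), 0), (pt 0 (-1) 1, 0), (pt 0 1 0, 1)}"
    by (auto simp: mem_pyramid halfspaces_insert halfspaces_empty)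
  show "pyramid \<inter> {x. pt 0 0 1 \<bullet> x = 0} = {x. pt 0 0 1 \<bullet> x = 0} \<inter>
      halfspaces {(pt (-1) 0 0, 0), (pt 0 (-1) 0, 0), (pt 1 0 0, 1), (pt 0 1 0, 1)}"
    by (auto simp: mem_pyramid halfspaces_insert halfspaces_empty)
  let ?T = "pyramid \<inter> {x. pt 1 0 0 \<bullet> x = 1}"
  have "pt 1 0 0 \<in> vertices ?T" by (rule vertexI[of _ _ 0 "-1" 0]) (auto simp: mem_pyramid)
  moreover have "pt 1 1 0 \<in> vertices ?T" by (rule vertexI[of _ _ 0 1 "-1"]) (auto simp: mem_pyramid)
  moreover have "pt 1 1 1 \<in> vertices ?T" by (rule vertexI[of _ _ 0 0 1]) (auto simp: mem_pyramid)
  ultimately show "{pt 1 0 0, pt 1 1 0, pt 1 1 1} \<subseteq> vertices ?T" by simp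
  let ?R = "pyramid \<inter> {x. pt 0 0 1 \<bullet> x = 0}"
  have "pt 0 0 0 \<in> vertices ?R" by (rule vertexI[of _ _ "-1" "-1" 0]) (auto simp: mem_pyramid)
  moreover have "pt 1 0 0 \<in> vertices ?R" by (rule vertexI[of _ _ 1 "-1" 0]) (auto simp: mem_pyramid)
  moreover have "pt 0 1 0 \<in> vertices ?R" by (rule vertexI[of _ _ "-1" 1 0]) (auto simp: mem_pyramid)
  moreover have "pt 1 1 0 \<in> vertices ?R" by (rule vertexI[of _ _ 1 1 0]) (auto simp: mem_pyramid)
  ultimately show "{pt 0 0 0, pt 1 0 0, pt 0 1 0, pt 1 1 0} \<subseteq> vertices ?R" by simp
  let ?S = "pyramid \<inter> {x. pt 2 2 (-4) \<bullet> x = 1}"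
  have "pt (1/2) 0 0 \<in> vertices ?S"
    by (rule vertexI[of _ _ 0 "-1" 0]) (auto simp: mem_pyramid)
  moreover have "pt 0 (1/2) 0 \<in> vertices ?S"
    by (rule vertexI[of _ _ "-1" 0 0]) (auto simp: mem_pyramid)
  moreover have "pt 1 (1/2) (1/2) \<in> vertices ?S"
    by (rule vertexI[of _ _ 1 "-1" 1]) (auto simp: mem_pyramid)
  moreover have "pt (1/2) 1 (1/2) \<in> vertices ?S"
    by (rule vertexI[of _ _ "-1" 1 1]) (auto simp: mem_pyramid)
  moreover have "pt 1 1 (3/4) \<in> vertices ?S"
    by (rule vertexI[of _ _ 1 1 0]) (auto simp: mem_pyramid)
  ultimately show "{pt (1/2) 0 0, pt 0 (1/2) 0, pt 1 (1/2) (1/2), pt (1/2) 1 (1/2), pt 1 1 (3/4)} \<subseteq> vertices ?S"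
    by simp
qed (auto simp: vec_eq_coords card_insert_if)

section \<open>Comparison of prism and pyramid\<close>

lemma setwise_slice_equiv_prism_pyramid: "setwise_slice_equiv prism pyramid"
  unfolding setwise_slice_equiv_def
  using slice_types_subset_if_small[OF polytope_prism slice_vertices_le_5(1) polytope_pyramid pyramid_slices]
    slice_types_subset_if_small[OF polytope_pyramid slice_vertices_le_5(2) polytope_prism prism_slices]
  by (rule subset_antisym)

lemma prism_triangle_facet:
  assumes "\<epsilon> \<in> {0, 1}"
  shows "prism \<inter> {x. pt 0 0 1 \<bullet> x = \<epsilon>} facet_of prism"
proof -
  let ?T = "prism \<inter> {x. pt 0 0 1 \<bullet> x = \<epsilon>}"
  have face: "?T face_of prism"
  proof (cases "\<epsilon> = 0")
    case True
    then show ?thesis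
      using polytope_prism
      by (intro face_of_Int_supporting_hyperplane_ge) (auto simp: mem_prism polytope_imp_convex)
  next
    case False
    then show ?thesis
      using assms polytope_prism
      by (intro face_of_Int_supporting_hyperplane_le) (auto simp: mem_prism polytope_imp_convex)
  qed
  have "affine_hyperplane {x. pt 0 0 1 \<bullet> x = \<epsilon>}"
    unfolding affine_hyperplane_def by (intro exI[of _ "pt 0 0 1"] exI[of _ \<epsilon>]) simp
  then have poly: "polytope ?T" and le: "aff_dim ?T \<le> 2"
    using slice_polytope[OF polytope_prism] aff_dim_slice by blast+
  have "pt 0 0 \<epsilon> \<in> vertices ?T"
    by (rule vertexI[of _ _ "-1" "-1" 0]) (use assms in \<open>auto simp: mem_prism\<close>)
  moreover have "pt 1 0 \<epsilon> \<in> vertices ?T"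
    by (rule vertexI[of _ _ 1 0 0]) (use assms in \<open>auto simp: mem_prism\<close>)
  moreover have "pt 0 1 \<epsilon> \<in> vertices ?T"
    by (rule vertexI[of _ _ 0 1 0]) (use assms in \<open>auto simp: mem_prism\<close>)
  ultimately have "{pt 0 0 \<epsilon>, pt 1 0 \<epsilon>, pt 0 1 \<epsilon>} \<subseteq> vertices ?T" by simp
  then have "card {pt 0 0 \<epsilon>, pt 1 0 \<epsilon>, pt 0 1 \<epsilon>} \<le> card (vertices ?T)"
    using finite_vertices[OF poly] by (intro card_mono) auto
  moreover have "card {pt 0 0 \<epsilon>, pt 1 0 \<epsilon>, pt 0 1 \<epsilon>} = 3" by (simp add: vec_eq_coords)
  ultimately have "\<not> aff_dim ?T \<le> 1" using card_vertices_low_dim[OF poly] by linarith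
  then have "aff_dim ?T = 2" using le by simp
  moreover have "CARD('n) = 3" using distinct by (simp add: all)
  then have "aff_dim prism = 3" using full_dim_prism by (simp add: full_dim_polytope_def)
  ultimately show ?thesis using face by (auto simp: facet_of_def)
qed

text \<open>The bottom and the top triangle are disjoint facets.\<close>

lemma not_coatoms_meet_prism: "\<not> coatoms_meet (face_lattice prism)"
proof
  assume "coatoms_meet (face_lattice prism)"
  moreover have "prism \<inter> {x. pt 0 0 1 \<bullet> x = 0} \<in> coatoms (face_lattice prism)"
    "prism \<inter> {x. pt 0 0 1 \<bullet> x = 1} \<in> coatoms (face_lattice prism)"
    using facet_imp_coatom[OF polytope_prism] prism_triangle_facet by blast+
  ultimately obtain C D where "C \<subseteq> prism \<inter> {x. pt 0 0 1 \<bullet> x = 0}" "C \<subseteq> prism \<inter> {x. pt 0 0 1 \<bullet> x = 1}"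
      "\<not> C \<subseteq> D"
    unfolding coatoms_meet_def by meson
  then show False by force
qed

text \<open>The lateral facets share the apex, and each of them meets the base in
  \<open>pt 0 0 0\<close> or \<open>pt 1 1 0\<close>.\<close>

lemma coatoms_meet_pyramid: "coatoms_meet (face_lattice pyramid)"
  unfolding coatoms_meet_def
proof (intro ballI)
  fix A B assume AB: "A \<in> coatoms (face_lattice pyramid)" "B \<in> coatoms (face_lattice pyramid)"
  have "CARD('n) = 3" using distinct by (simp add: all)
  then have "1 \<le> aff_dim pyramid" using full_dim_pyramid by (simp add: full_dim_polytope_def)
  then have facets: "A facet_of pyramid" "B facet_of pyramid"
    using coatom_imp_facet[OF polytope_pyramid] AB by blast+
  define f where "f = (\<lambda>(a, b). pyramid \<inter> {x :: real ^ 'n. a \<bullet> x = b})"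
  have "A \<in> f ` pyramid_ineqs" "B \<in> f ` pyramid_ineqs"
    using facets_of_halfspaces[OF finite_ineqs(2) ineqs_nonzero(2) affine_UNIV, where S = pyramid] facets
    unfolding f_def by auto
  then obtain p q where p: "p \<in> pyramid_ineqs" "A = f p" and q: "q \<in> pyramid_ineqs" "B = f q" by blast
  have pts: "pt 1 1 1 \<in> pyramid" "pt 0 0 0 \<in> pyramid" "pt 1 1 0 \<in> pyramid" "pt 1 0 0 \<in> pyramid" "pt 0 1 0 \<in> pyramid"
    by (auto simp: mem_pyramid)
  have apex: "pt 1 1 1 \<in> f p" if "p \<in> pyramid_ineqs" "p \<noteq> (pt 0 0 (-1), 0)" for p
    using that pts(1) by (auto simp: pyramid_ineqs_def f_def)
  have base: "f p \<inter> f (pt 0 0 (-1), 0) \<noteq> {}" if "p \<in> pyramid_ineqs" for p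
  proof -
    have "pt 0 0 0 \<in> f p \<inter> f (pt 0 0 (-1), 0) \<or> pt 1 1 0 \<in> f p \<inter> f (pt 0 0 (-1), 0)"
      using that pts by (auto simp: pyramid_ineqs_def f_def)
    then show ?thesis by blast
  qed
  have "A \<inter> B \<noteq> {}"
  proof (cases "p = (pt 0 0 (-1), 0) \<or> q = (pt 0 0 (-1), 0)")
    case True
    then show ?thesis using base[OF p(1)] base[OF q(1)] p(2) q(2) by blast
  next
    case False
    then show ?thesis using apex[OF p(1)] apex[OF q(1)] p(2) q(2) by blast
  qed
  moreover have "A \<inter> B \<in> face_lattice pyramid" "{} \<in> face_lattice pyramid"
    using face_of_Int[OF facets[THEN facet_of_imp_face_of]] by (simp_all add: face_lattice_def)
  ultimately show "\<exists>C\<in>face_lattice pyramid. C \<subseteq> A \<and> C \<subseteq> B \<and> (\<exists>D\<in>face_lattice pyramid. \<not> C \<subseteq> D)"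
    by (intro bexI[of _ "A \<inter> B"]) auto
qed

lemma not_comb_equiv_prism_pyramid: "\<not> comb_equiv prism pyramid"
proof
  assume "comb_equiv prism pyramid"
  then have "order_iso (face_lattice pyramid) (face_lattice prism)"
    unfolding comb_equiv_iff by (rule order_iso_sym)
  then show False
    using coatoms_meet_order_iso coatoms_meet_pyramid not_coatoms_meet_prism by blast
qed

end

lemma setwise_slice_equiv_not_imp_comb_equiv:
  assumes "CARD('n) = 3"
  shows "\<exists>P Q :: (real ^ 'n::finite) set. full_dim_polytope P \<and> full_dim_polytope Q \<and>
    setwise_slice_equiv P Q \<and> \<not> comb_equiv P Q"
proof -
  obtain i j k :: 'n where "UNIV = {i, j, k}" "i \<noteq> j" "i \<noteq> k" "j \<noteq> k"
    using assms unfolding card_3_iff by metis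
  then interpret three_coords i j k by unfold_locales
  show ?thesis
    using full_dim_prism full_dim_pyramid setwise_slice_equiv_prism_pyramid
      not_comb_equiv_prism_pyramid by blast
qed

theorem theorem5p11:
  assumes "CARD('n::finite) \<ge> 3"
  shows
    "(\<forall>P Q :: (real ^ 'n) set. full_dim_polytope P \<and> full_dim_polytope Q \<longrightarrow>
        (P = Q \<longleftrightarrow> pointwise_slice_equiv P Q) \<and>
        (pointwise_slice_equiv P Q \<longleftrightarrow> lifted_arrangement P = lifted_arrangement Q) \<and>
        (P = Q \<longrightarrow> same_OM P Q) \<and>
        (same_OM P Q \<longleftrightarrow> same_arrangement_OM P Q) \<and>
        (same_OM P Q \<longrightarrow> setwise_slice_equiv P Q) \<and>
        (same_OM P Q \<longrightarrow> comb_equiv P Q)) \<and>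
     (\<exists>P Q :: (real ^ 'n) set. full_dim_polytope P \<and> full_dim_polytope Q \<and>
        same_OM P Q \<and> P \<noteq> Q) \<and>
     (\<exists>P Q :: (real ^ 'n) set. full_dim_polytope P \<and> full_dim_polytope Q \<and>
        setwise_slice_equiv P Q \<and> \<not> same_OM P Q) \<and>
     (\<exists>P Q :: (real ^ 'n) set. full_dim_polytope P \<and> full_dim_polytope Q \<and>
        comb_equiv P Q \<and> \<not> same_OM P Q) \<and>
     (\<exists>P Q :: (real ^ 'n) set. full_dim_polytope P \<and> full_dim_polytope Q \<and>
        comb_equiv P Q \<and> \<not> setwise_slice_equiv P Q) \<and>
     (CARD('n) = 3 \<longrightarrow>
       (\<exists>P Q :: (real ^ 'n) set. full_dim_polytope P \<and> full_dim_polytope Q \<and>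
          setwise_slice_equiv P Q \<and> \<not> comb_equiv P Q))"
proof (intro conjI allI impI)
  fix P Q :: "(real ^ 'n) set"
  assume PQ: "full_dim_polytope P \<and> full_dim_polytope Q"
  then have full: "full_dim_polytope P" "full_dim_polytope Q" by blast+
  then have poly: "polytope P" "polytope Q" by (auto simp: full_dim_polytope_def)
  show slices: "P = Q \<longleftrightarrow> pointwise_slice_equiv P Q"
    by (rule eq_iff_pointwise_slice_equiv[OF full])
  show "pointwise_slice_equiv P Q \<longleftrightarrow> lifted_arrangement P = lifted_arrangement Q"
    using slices eq_iff_lifted_arrangement_eq[OF poly] by simp
  show "same_OM P Q" if "P = Q"
    using that same_OM_refl[OF poly(1)] by simp
  show "same_OM P Q \<longleftrightarrow> same_arrangement_OM P Q"
    by (rule same_OM_iff_same_arrangement_OM)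
  show "setwise_slice_equiv P Q" if "same_OM P Q"
    using that full by (rule same_OM_imp_setwise_slice_equiv)
  show "comb_equiv P Q" if "same_OM P Q"
    using that poly by (rule same_OM_imp_comb_equiv)
qed (rule same_OM_not_imp_eq setwise_slice_equiv_not_imp_same_OM[OF assms]
    comb_equiv_not_imp_same_OM[OF assms] comb_equiv_not_imp_setwise_slice_equiv[OF assms]
    setwise_slice_equiv_not_imp_comb_equiv, assumption?)+

end
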